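(* Let $n\ge1$, $\lambda\in\mathbb{R}^n$, $\mu\in\mathbb{R}$, put $k=\mu-\sum_i\lambda_i$, $t_i=-2\lambda_i$, $|t|=\sum_it_i$, and assume $k\in\mathbb{N}$ and $t=(t_1,\dots,t_n)\in\mathbb{N}^n$. For an integer $m$ let $$d_{nmt}=\#\Big\{\alpha=(\alpha_1,\ldots,\alpha_n)\in\mathbb{N}^n:\ \alpha_i\le t_i\ (i=1,\dots,n),\ \sum_i\alpha_i=m\Big\}.$$ Then the dimensions $h^j_{nkt}=\dim\mathrm{H}^j(\mathfrak{sl}(2),\mathcal{D}_{\lambda,\mu})$, $j=0,1,2$, are given as follows. - If $0\le k\le\frac{|t|+1}{2}$ or $k>|t|+1$: $h^2_{nkt}=0$, $h^0_{nkt}=\binom{n+k-2}{k}$, $h^1_{nkt}=\binom{n+k-2}{k}$. - If $\frac{|t|+1}{2}\le k\le|t|+1$: $h^2_{nkt}=d_{n(k-1)t}-d_{nkt}$, $h^0_{nkt}=\binom{n+k-2}{k}+d_{n(k-1)t}-d_{nkt}$, $h^1_{nkt}=\binom{n+k-2}{k}+2\,(d_{n(k-1)t}-d_{nkt})$.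
   Context: $\mathbb{N}=\{0,1,2,\dots\}$; $\binom{n-2}{0}=1$ for all $n\ge1$; for $\alpha\in\mathbb{N}^n$, $\alpha!=\prod_i\alpha_i!$. For $h\in C^\infty(\mathbb{R})$ let $X_h=h\frac{d}{dx}$, with $[X_{h_1},X_{h_2}]=X_{h_1h_2'-h_2h_1'}$, and $\mathfrak{sl}(2)=\mathrm{Span}_{\mathbb R}(X_1,X_x,X_{x^2})$. For $\nu\in\mathbb{R}$, $\mathcal{F}_\nu=\{f\,dx^\nu: f\in C^\infty(\mathbb{R})\}$ with action $X_h\cdot(f\,dx^\nu)=L^\nu_{X_h}(f\,dx^\nu)=(hf'+\nu h'f)dx^\nu$. $\mathcal{D}_{\lambda,\mu}$ is the space of $n$-ary differential operators from $\mathcal{F}_{\lambda_1}\otimes\cdots\otimes\mathcal{F}_{\lambda_n}$ to $\mathcal{F}_\mu$, i.e. finite sums $\sum_\alpha A_\alpha\Omega^\alpha$ with $A_\alpha\in C^\infty(\mathbb{R})$, where $\Omega^\alpha(f_1dx^{\lambda_1}\otimes\cdots\otimes f_ndx^{\lambda_n})=\frac1{\alpha!}f_1^{(\alpha_1)}\cdots f_n^{(\alpha_n)}dx^\mu$. The action on it is $X_h\cdot A=L^\mu_{X_h}\circ A-A\circ L^{\lambda}_{X_h}$, with $L^\lambda_{X_h}$ defined by the Leibniz rule on the tensor product. $\mathrm{H}^j(\mathfrak{sl}(2),\cdot)$ is the usual (Chevalley–Eilenberg) cohomology. *)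

theory Defs
  imports
    "HOL-Analysis.Analysis"
    "HOL-Library.Function_Algebras"
    "Jordan_Normal_Form.VS_Connect"
begin

instantiation "fun" :: (type, real_vector) real_vector
begin

definition scaleR_fun_def: "c *\<^sub>R f = (\<lambda>x. c *\<^sub>R f x)"

instance
  by standard (auto simp: scaleR_fun_def fun_eq_iff scaleR_add_left scaleR_add_right)

end

text \<open>The space \<open>Z / B\<close> of cosets, as a module over \<open>class_ring\<close>, the field of real
  numbers. The ring multiplication and unit, which the record type also carries, are irrelevant
  for modules.\<close>

definition quotient_space :: "'a::real_vector set \<Rightarrow> 'a set \<Rightarrow> (real, 'a set) module" where
  "quotient_space Z B =
    \<lparr> carrier = (\<lambda>z. (\<lambda>b. z + b) ` B) ` Z,
      mult = undefined, one = undefined,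
      zero = B,
      add = (\<lambda>X Y. {x + y |x y. x \<in> X \<and> y \<in> Y}),
      smult = (\<lambda>c X. {c *\<^sub>R x + b |x b. x \<in> X \<and> b \<in> B}) \<rparr>"

text \<open>A Lie algebra is given by a subspace \<open>g\<close> and a bracket \<open>br\<close>, a module over it by a
  subspace \<open>M\<close> and an action \<open>act\<close>. A \<open>j\<close>-cochain is an alternating \<open>j\<close>-linear map on \<open>g\<close>,
  written as a function of argument lists and set to \<open>0\<close> outside the lists of length \<open>j\<close>
  over \<open>g\<close>, so that equality of cochains is equality of functions.\<close>

definition ce_cochains :: "'g::real_vector set \<Rightarrow> 'm::real_vector set \<Rightarrow> nat \<Rightarrow> ('g list \<Rightarrow> 'm) set"
  where
  "ce_cochains g M j = {w.
     (\<forall>xs. length xs = j \<and> set xs \<subseteq> g \<longrightarrow> w xs \<in> M) \<and>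
     (\<forall>xs. \<not> (length xs = j \<and> set xs \<subseteq> g) \<longrightarrow> w xs = 0) \<and>
     (\<forall>xs i. length xs = j \<and> set xs \<subseteq> g \<and> i < j \<longrightarrow>
        (\<forall>x\<in>g. \<forall>y\<in>g. w (xs[i := x + y]) = w (xs[i := x]) + w (xs[i := y])) \<and>
        (\<forall>c. \<forall>x\<in>g. w (xs[i := c *\<^sub>R x]) = c *\<^sub>R w (xs[i := x]))) \<and>
     (\<forall>xs i l. length xs = j \<and> set xs \<subseteq> g \<and> i < l \<and> l < j \<and> xs ! i = xs ! l \<longrightarrow> w xs = 0)}"

definition delete_nth :: "nat \<Rightarrow> 'a list \<Rightarrow> 'a list" where
  "delete_nth i xs = take i xs @ drop (Suc i) xs"

definition ce_differential ::
  "'g::real_vector set \<Rightarrow> ('g \<Rightarrow> 'g \<Rightarrow> 'g) \<Rightarrow> ('g \<Rightarrow> 'm \<Rightarrow> 'm) \<Rightarrow> nat \<Rightarrow>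
    ('g list \<Rightarrow> 'm::real_vector) \<Rightarrow> 'g list \<Rightarrow> 'm" where
  "ce_differential g br act j w = (\<lambda>xs.
     if length xs = Suc j \<and> set xs \<subseteq> g then
       (\<Sum>i\<le>j. (-1) ^ i *\<^sub>R act (xs ! i) (w (delete_nth i xs))) +
       (\<Sum>l\<le>j. \<Sum>i<l. (-1) ^ (i + l) *\<^sub>R
          w (br (xs ! i) (xs ! l) # delete_nth i (delete_nth l xs)))
     else 0)"

definition ce_cocycles ::
  "'g::real_vector set \<Rightarrow> ('g \<Rightarrow> 'g \<Rightarrow> 'g) \<Rightarrow> 'm::real_vector set \<Rightarrow> ('g \<Rightarrow> 'm \<Rightarrow> 'm) \<Rightarrow> nat \<Rightarrow>
    ('g list \<Rightarrow> 'm) set" where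
  "ce_cocycles g br M act j = {w \<in> ce_cochains g M j. ce_differential g br act j w = 0}"

fun ce_coboundaries ::
  "'g::real_vector set \<Rightarrow> ('g \<Rightarrow> 'g \<Rightarrow> 'g) \<Rightarrow> 'm::real_vector set \<Rightarrow> ('g \<Rightarrow> 'm \<Rightarrow> 'm) \<Rightarrow> nat \<Rightarrow>
    ('g list \<Rightarrow> 'm) set" where
  "ce_coboundaries g br M act 0 = {0}"
| "ce_coboundaries g br M act (Suc j) = ce_differential g br act j ` ce_cochains g M j"

definition ce_cohomology ::
  "'g::real_vector set \<Rightarrow> ('g \<Rightarrow> 'g \<Rightarrow> 'g) \<Rightarrow> 'm::real_vector set \<Rightarrow> ('g \<Rightarrow> 'm \<Rightarrow> 'm) \<Rightarrow> nat \<Rightarrow>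
    (real, ('g list \<Rightarrow> 'm) set) module" where
  "ce_cohomology g br M act j =
     quotient_space (ce_cocycles g br M act j) (ce_coboundaries g br M act j)"

text \<open>The vector field \<open>h d/dx\<close> and the density \<open>f dx\<^sup>\<nu>\<close> are represented by their coefficients
  \<open>h\<close> and \<open>f\<close>.\<close>

definition smooth :: "(real \<Rightarrow> real) \<Rightarrow> bool" where
  "smooth f \<longleftrightarrow> (\<forall>m x. (deriv ^^ m) f field_differentiable at x)"

definition vf_bracket :: "(real \<Rightarrow> real) \<Rightarrow> (real \<Rightarrow> real) \<Rightarrow> real \<Rightarrow> real" where
  "vf_bracket h1 h2 = (\<lambda>x. h1 x * deriv h2 x - h2 x * deriv h1 x)"

definition sl2 :: "(real \<Rightarrow> real) set" where
  "sl2 = span {\<lambda>x. 1, \<lambda>x. x, \<lambda>x. x\<^sup>2}"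

definition lie_density :: "real \<Rightarrow> (real \<Rightarrow> real) \<Rightarrow> (real \<Rightarrow> real) \<Rightarrow> real \<Rightarrow> real" where
  "lie_density \<nu> h f = (\<lambda>x. h x * deriv f x + \<nu> * deriv h x * f x)"

text \<open>An \<open>n\<close>-ary operator on the tensor product of density modules is represented by its values on
  decomposable tensors, that is as a function of tuples indexed by a finite type \<open>'n\<close> with \<open>n\<close>
  elements. It is set to \<open>0\<close> on tuples that are not smooth. The weights enter only through
  the action.\<close>

definition Omega :: "('n::finite \<Rightarrow> nat) \<Rightarrow> ('n \<Rightarrow> real \<Rightarrow> real) \<Rightarrow> real \<Rightarrow> real" where
  "Omega \<alpha> F =
     (if \<forall>i. smooth (F i)
      then (\<lambda>x. 1 / (\<Prod>i\<in>UNIV. fact (\<alpha> i)) * (\<Prod>i\<in>UNIV. (deriv ^^ \<alpha> i) (F i) x))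
      else 0)"

definition diff_ops :: "(('n::finite \<Rightarrow> real \<Rightarrow> real) \<Rightarrow> real \<Rightarrow> real) set" where
  "diff_ops = {A. \<exists>S a. finite S \<and> (\<forall>\<alpha>\<in>S. smooth (a \<alpha>)) \<and>
                    A = (\<lambda>F x. \<Sum>\<alpha>\<in>S. a \<alpha> x * Omega \<alpha> F x)}"

text \<open>The sum over \<open>i\<close> below is \<open>A\<close> composed with the action on the tensor product, which is given
  by the Leibniz rule.\<close>

definition op_action ::
  "('n::finite \<Rightarrow> real) \<Rightarrow> real \<Rightarrow> (real \<Rightarrow> real) \<Rightarrow>
    (('n \<Rightarrow> real \<Rightarrow> real) \<Rightarrow> real \<Rightarrow> real) \<Rightarrow> ('n \<Rightarrow> real \<Rightarrow> real) \<Rightarrow> real \<Rightarrow> real" where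
  "op_action lam \<mu> h A = (\<lambda>F.
     if \<forall>i. smooth (F i)
     then lie_density \<mu> h (A F) - (\<Sum>i\<in>UNIV. A (F(i := lie_density (lam i) h (F i))))
     else 0)"

definition sl2_cohomology ::
  "('n::finite \<Rightarrow> real) \<Rightarrow> real \<Rightarrow> nat \<Rightarrow>
    (real, ((real \<Rightarrow> real) list \<Rightarrow> ('n \<Rightarrow> real \<Rightarrow> real) \<Rightarrow> real \<Rightarrow> real) set) module" where
  "sl2_cohomology lam \<mu> = ce_cohomology sl2 vf_bracket diff_ops (op_action lam \<mu>)"

definition dnum :: "('n::finite \<Rightarrow> nat) \<Rightarrow> int \<Rightarrow> nat" where
  "dnum t m = card {\<alpha> :: 'n \<Rightarrow> nat. (\<forall>i. \<alpha> i \<le> t i) \<and> int (\<Sum>i\<in>UNIV. \<alpha> i) = m}"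

text \<open>\<open>has_dim V d\<close>: \<open>V\<close> is a real vector space of finite dimension \<open>d\<close>. Finiteness is stated
  because \<open>vectorspace.dim\<close> is an unspecified number for infinite-dimensional spaces;
  \<open>d\<close> is an integer so that dimension formulas may contain differences.\<close>

definition has_dim :: "(real, 'v) module \<Rightarrow> int \<Rightarrow> bool" where
  "has_dim V d \<longleftrightarrow> vectorspace class_ring V \<and> vectorspace.fin_dim class_ring V \<and>
     int (vectorspace.dim class_ring V) = d"

end

theory Submission
  imports Defs
begin

text \<open>
  An operator \<open>\<Sum> a\<^sub>\<alpha> \<Omega>\<^sup>\<alpha>\<close> is the same thing as its family of coefficients \<open>a\<^sub>\<alpha>\<close>. In terms of
  coefficients the vector field \<open>d/dx\<close> acts by differentiation, so that it is surjective and its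
  kernel consists of the operators with constant coefficients. In other words, the module of
  differential operators is coinduced from the isotropy algebra of the point \<open>0\<close>, which is spanned
  by \<open>x d/dx\<close> and \<open>x\<^sup>2 d/dx\<close>, and its cohomology is that of the isotropy algebra with values in
  the space of coefficients at \<open>0\<close>. Concretely, a cocycle can be corrected by a coboundary until
  its values on \<open>d/dx\<close> vanish, and what remains is determined by its value at \<open>x = 0\<close>.

  On the coefficients at \<open>0\<close> the field \<open>x d/dx\<close> is diagonal: it multiplies \<open>\<Omega>\<^sup>\<alpha>\<close> by
  \<open>k - |\<alpha>|\<close>. The field \<open>x\<^sup>2 d/dx\<close> acts by
  \<open>\<Omega>\<^sup>\<alpha> \<mapsto> \<Sum>\<^sub>i (t\<^sub>i + 1 - \<alpha>\<^sub>i) \<Omega>\<close> with exponent \<open>\<alpha> - \<epsilon>\<^sub>i\<close>, so it lowers \<open>|\<alpha>|\<close> by one.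
  Only cochains of weight \<open>0\<close> contribute to cohomology, and these are built from the spaces \<open>V\<^sub>m\<close> of
  homogeneous coefficient vectors of degrees \<open>m = k\<close> and \<open>m = k - 1\<close>. Writing \<open>e\<close> for the lowering
  map from degree \<open>k\<close> to degree \<open>k - 1\<close>, the result is
  \<open>H\<^sup>0 = ker e\<close>, \<open>H\<^sup>1 = ker e \<oplus> coker e\<close> and \<open>H\<^sup>2 = coker e\<close>; these are the
  lemmas \<open>has_dim_cohomology_0\<close>, \<open>has_dim_cohomology_1\<close> and \<open>has_dim_cohomology_2\<close>.

  Since the dimensions of the two homogeneous spaces differ by the binomial coefficient of the
  theorem, only the dimension of \<open>coker e\<close> is left. Together with a raising operator, \<open>e\<close> makes the
  space of all coefficient vectors a tensor product of Verma modules with highest weights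
  \<open>t\<^sub>i\<close>, in which degree \<open>m\<close> has weight \<open>|t| - 2m\<close>. If the target degree has positive weight, the
  commutation relation shows that \<open>e\<close> is onto (\<open>lower_surj\<close>). If the source degree has negative
  weight, split the exponents into those bounded by \<open>t\<close> and the others. On the others \<open>e\<close> is onto
  (\<open>lower_off_box_surj\<close>), and modulo them, that is on the tensor product of the finite-dimensional
  quotients, \<open>e\<close> is injective (\<open>lower_inj_mod_off_box\<close>); counting the exponents bounded by \<open>t\<close> gives the
  dimension of \<open>coker e\<close> (\<open>rank_lower_large\<close>).
\<close>

section \<open>Dimensions of quotient spaces\<close>

hide_const (open) VectorSpace.subspace
hide_fact (open) VectorSpace.subspace_def

definition coset :: "'a::real_vector set \<Rightarrow> 'a \<Rightarrow> 'a set" where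
  "coset B z = (\<lambda>b. z + b) ` B"

lemma coset_eq_iff:
  assumes "subspace B"
  shows "coset B z = coset B w \<longleftrightarrow> z - w \<in> B"
  unfolding coset_def
proof
  assume "(\<lambda>b. z + b) ` B = (\<lambda>b. w + b) ` B"
  moreover have "z \<in> (\<lambda>b. z + b) ` B"
    using subspace_0[OF assms] by (auto intro: image_eqI[of _ _ 0])
  ultimately show "z - w \<in> B" by auto
next
  have sub: "(\<lambda>b. z + b) ` B \<subseteq> (\<lambda>b. w + b) ` B" if "z - w \<in> B" for z w
  proof
    fix y assume "y \<in> (\<lambda>b. z + b) ` B"
    then obtain b where "b \<in> B" "y = w + ((z - w) + b)" by auto
    then show "y \<in> (\<lambda>b. w + b) ` B" using that subspace_add[OF assms] by blast
  qed
  assume "z - w \<in> B"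
  moreover from this have "w - z \<in> B"
    using subspace_neg[OF assms, of "z - w"] by simp
  ultimately show "(\<lambda>b. z + b) ` B = (\<lambda>b. w + b) ` B" using sub by blast
qed

lemma quotient_space_carrier: "carrier (quotient_space Z B) = coset B ` Z"
  by (simp add: quotient_space_def coset_def)

lemma quotient_space_zero: "\<zero>\<^bsub>quotient_space Z B\<^esub> = coset B 0"
  by (simp add: quotient_space_def coset_def)

lemma quotient_space_add:
  assumes "subspace B"
  shows "coset B z \<oplus>\<^bsub>quotient_space Z B\<^esub> coset B w = coset B (z + w)"
proof -
  have "{x + y |x y. x \<in> coset B z \<and> y \<in> coset B w} = coset B (z + w)"
    unfolding coset_def
  proof (intro equalityI subsetI)
    fix v assume "v \<in> {x + y |x y. x \<in> (\<lambda>b. z + b) ` B \<and> y \<in> (\<lambda>b. w + b) ` B}"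
    then obtain b c where "b \<in> B" "c \<in> B" "v = (z + b) + (w + c)" by auto
    moreover from this have "v = (z + w) + (b + c)" by simp
    ultimately show "v \<in> (\<lambda>b. z + w + b) ` B" using subspace_add[OF assms] by blast
  next
    fix v assume "v \<in> (\<lambda>b. z + w + b) ` B"
    then obtain b where "b \<in> B" "v = (z + b) + (w + 0)" by (auto simp: add.assoc add.left_commute)
    then show "v \<in> {x + y |x y. x \<in> (\<lambda>b. z + b) ` B \<and> y \<in> (\<lambda>b. w + b) ` B}"
      using subspace_0[OF assms] by blast
  qed
  then show ?thesis by (simp add: quotient_space_def coset_def)
qed

lemma quotient_space_smult:
  assumes "subspace B"
  shows "c \<odot>\<^bsub>quotient_space Z B\<^esub> coset B z = coset B (c *\<^sub>R z)"
proof -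
  have "{c *\<^sub>R x + b |x b. x \<in> coset B z \<and> b \<in> B} = coset B (c *\<^sub>R z)"
    unfolding coset_def
  proof (intro equalityI subsetI)
    fix v assume "v \<in> {c *\<^sub>R x + b |x b. x \<in> (\<lambda>b. z + b) ` B \<and> b \<in> B}"
    then obtain a b where ab: "a \<in> B" "b \<in> B" "v = c *\<^sub>R (z + a) + b" by auto
    then have "v = c *\<^sub>R z + (c *\<^sub>R a + b)" by (simp add: scaleR_add_right)
    moreover have "c *\<^sub>R a + b \<in> B"
      using ab subspace_add[OF assms] subspace_scale[OF assms] by blast
    ultimately show "v \<in> (\<lambda>b. c *\<^sub>R z + b) ` B" by blast
  next
    fix v assume "v \<in> (\<lambda>b. c *\<^sub>R z + b) ` B"
    then obtain b where "b \<in> B" "v = c *\<^sub>R (z + 0) + b" by auto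
    then show "v \<in> {c *\<^sub>R x + b |x b. x \<in> (\<lambda>b. z + b) ` B \<and> b \<in> B}"
      using subspace_0[OF assms] by blast
  qed
  then show ?thesis by (simp add: quotient_space_def coset_def)
qed

lemma quotient_space_vectorspace:
  assumes Z: "subspace Z" and B: "subspace B"
  shows "vectorspace class_ring (quotient_space Z B)"
proof (rule vs_criteria)
  show "field (class_ring :: real ring)" by (rule class_field)
  show "\<zero>\<^bsub>quotient_space Z B\<^esub> \<in> carrier (quotient_space Z B)"
    unfolding quotient_space_carrier quotient_space_zero using subspace_0[OF Z] by blast
  show "\<forall>v\<in>carrier (quotient_space Z B). \<exists>u\<in>carrier (quotient_space Z B).
          v \<oplus>\<^bsub>quotient_space Z B\<^esub> u = \<zero>\<^bsub>quotient_space Z B\<^esub>"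
  proof
    fix v assume "v \<in> carrier (quotient_space Z B)"
    then obtain z where "z \<in> Z" "v = coset B z" unfolding quotient_space_carrier by blast
    then show "\<exists>u\<in>carrier (quotient_space Z B).
        v \<oplus>\<^bsub>quotient_space Z B\<^esub> u = \<zero>\<^bsub>quotient_space Z B\<^esub>"
      unfolding quotient_space_carrier quotient_space_zero
      using subspace_neg[OF Z] quotient_space_add[OF B, where Z = Z and z = z and w = "- z"]
      by (metis imageI right_minus)
  qed
qed (auto simp: quotient_space_carrier quotient_space_zero quotient_space_add[OF B]
    quotient_space_smult[OF B] algebra_simps 
    intro!: imageI subspace_add[OF Z] subspace_scale[OF Z])

lemma quotient_space_lincomb:
  assumes Z: "subspace Z" and B: "subspace B"
    and "finite D" "D \<subseteq> Z" "inj_on (coset B) D"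
  shows "module.lincomb (quotient_space Z B) a (coset B ` D) =
    coset B (\<Sum>d\<in>D. a (coset B d) *\<^sub>R d)"
  using assms(3-)
proof (induction D rule: finite_induct)
  interpret Q: vectorspace class_ring "quotient_space Z B"
    by (rule quotient_space_vectorspace[OF Z B])
  case empty
  show ?case by (simp add: Q.lincomb_def quotient_space_zero)
next
  interpret Q: vectorspace class_ring "quotient_space Z B"
    by (rule quotient_space_vectorspace[OF Z B])
  case (insert d D)
  have sub: "coset B ` D \<subseteq> carrier (quotient_space Z B)" "coset B d \<in> carrier (quotient_space Z B)"
    using insert.prems by (auto simp: quotient_space_carrier)
  have new: "coset B d \<notin> coset B ` D"
    using insert.prems(2) insert.hyps(2) by (auto simp: inj_on_def)
  have "Q.lincomb a (coset B ` insert d D) = Q.lincomb a (coset B ` D \<union> {coset B d})"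
    by simp
  also have "\<dots> = a (coset B d) \<odot>\<^bsub>quotient_space Z B\<^esub> coset B d
      \<oplus>\<^bsub>quotient_space Z B\<^esub> Q.lincomb a (coset B ` D)"
    by (rule Q.lincomb_insert) (use insert.hyps sub new in auto)
  also have "\<dots> = coset B (\<Sum>d\<in>insert d D. a (coset B d) *\<^sub>R d)"
    using insert by (simp add: quotient_space_smult[OF B] quotient_space_add[OF B])
  finally show ?case .
qed

text \<open>A quotient \<open>Z / B\<close> is measured by a linear map \<open>\<phi>\<close> to a space in which bases are at hand: if
  \<open>B\<close> is the preimage of the subspace with basis \<open>C0\<close>, then \<open>\<phi>\<close> identifies the quotient with the
  span of the remaining basis vectors \<open>C\<close>. The cosets of preimages of \<open>C\<close> form a basis.\<close>

theorem has_dim_quotient_space: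
  fixes \<phi> :: "'a::real_vector \<Rightarrow> 'b::real_vector"
  assumes Z: "subspace Z" and \<phi>: "linear \<phi>"
    and fin: "finite C" and ind: "independent (C0 \<union> C)" and disj: "C0 \<inter> C = {}"
    and im: "\<phi> ` Z = span (C0 \<union> C)"
    and B_eq: "B = {z \<in> Z. \<phi> z \<in> span C0}"
  shows "has_dim (quotient_space Z B) (int (card C))"
proof -
  have B: "subspace B"
    unfolding B_eq subspace_def
    using Z by (auto simp: subspace_0 subspace_add subspace_scale span_0 span_add span_scale
        linear_0[OF \<phi>] linear_add[OF \<phi>] linear_scale[OF \<phi>])
  interpret Q: vectorspace class_ring "quotient_space Z B"
    by (rule quotient_space_vectorspace[OF Z B])
  have "\<forall>c\<in>C. \<exists>z\<in>Z. \<phi> z = c"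
    using im span_superset[of "C0 \<union> C"] by (metis UnCI image_iff subset_iff)
  then obtain s where s: "\<And>c. c \<in> C \<Longrightarrow> s c \<in> Z" "\<And>c. c \<in> C \<Longrightarrow> \<phi> (s c) = c" by metis
  have trivial: "\<forall>c\<in>C. a c = 0" if sum: "(\<Sum>c\<in>C. a c *\<^sub>R c) \<in> span C0" for a
  proof (rule ccontr)
    assume "\<not> ?thesis"
    then obtain d where d: "d \<in> C" "a d \<noteq> 0" by blast
    let ?r = "\<Sum>c\<in>C - {d}. a c *\<^sub>R c"
    have sub: "C0 \<subseteq> C0 \<union> C - {d}" "C - {d} \<subseteq> C0 \<union> C - {d}" using d disj by auto
    have "(\<Sum>c\<in>C. a c *\<^sub>R c) - ?r \<in> span (C0 \<union> C - {d})"
    proof (rule span_diff)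
      show "(\<Sum>c\<in>C. a c *\<^sub>R c) \<in> span (C0 \<union> C - {d})"
        using sum span_mono[OF sub(1)] by blast
      show "?r \<in> span (C0 \<union> C - {d})"
        using sub(2) by (intro span_sum span_scale span_base) blast
    qed
    moreover have "(\<Sum>c\<in>C. a c *\<^sub>R c) - ?r = a d *\<^sub>R d"
      using fin d by (simp add: sum.remove)
    ultimately have "inverse (a d) *\<^sub>R (a d *\<^sub>R d) \<in> span (C0 \<union> C - {d})"
      by (metis span_scale)
    then have "d \<in> span (C0 \<union> C - {d})" using d by simp
    then show False using ind d unfolding dependent_def by blast
  qed
  have inj: "inj_on (coset B) (s ` C)" "inj_on s C"
  proof -
    show "inj_on s C" using s by (metis inj_onI)
    have "c = d" if "c \<in> C" "d \<in> C" "coset B (s c) = coset B (s d)" for c d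
    proof (rule ccontr)
      assume "c \<noteq> d"
      have "\<phi> (s c - s d) \<in> span C0" using that(3) B_eq coset_eq_iff[OF B] by blast
      then have "c - d \<in> span C0" using that s by (simp add: linear_diff[OF \<phi>])
      moreover have "c - d = (\<Sum>b\<in>C. (if b = c then 1 else if b = d then -1 else 0) *\<^sub>R b)"
      proof -
        have "(\<Sum>b\<in>C. (if b = c then 1 else if b = d then -1 else 0) *\<^sub>R b)
            = (\<Sum>b\<in>C. (if b = c then b else 0) + (if b = d then - b else 0))"
          using \<open>c \<noteq> d\<close> by (intro sum.cong) auto
        also have "\<dots> = c - d" using that fin by (simp add: sum.distrib)
        finally show ?thesis ..
      qed
      ultimately show False using trivial that(1) by fastforce
    qed
    then show "inj_on (coset B) (s ` C)" by (auto simp: inj_on_def)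
  qed
  let ?D = "coset B ` s ` C"
  have D: "finite ?D" "?D \<subseteq> carrier (quotient_space Z B)"
    using fin s by (auto simp: quotient_space_carrier)
  have comb: "Q.lincomb a ?D = coset B (\<Sum>c\<in>C. a (coset B (s c)) *\<^sub>R s c)" for a
    using quotient_space_lincomb[OF Z B _ _ inj(1), of a] fin s(1) inj(2)
    by (auto simp: sum.reindex)
  have \<phi>_sum: "\<phi> (\<Sum>c\<in>C. a c *\<^sub>R s c) = (\<Sum>c\<in>C. a c *\<^sub>R c)" for a
    using s by (simp add: linear_sum[OF \<phi>] linear_scale[OF \<phi>])
  have "Q.basis ?D"
    unfolding Q.basis_def
  proof (intro conjI D)
    show "Q.lin_indpt ?D"
    proof (rule Q.finite_lin_indpt2[OF D])
      fix a assume "Q.lincomb a ?D = \<zero>\<^bsub>quotient_space Z B\<^esub>"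
      then have "(\<Sum>c\<in>C. a (coset B (s c)) *\<^sub>R s c) \<in> B"
        unfolding comb quotient_space_zero coset_eq_iff[OF B] by simp
      then have "(\<Sum>c\<in>C. a (coset B (s c)) *\<^sub>R c) \<in> span C0"
        unfolding B_eq by (simp add: \<phi>_sum)
      then show "\<forall>v\<in>?D. a v = \<zero>\<^bsub>class_ring\<^esub>"
        using trivial[of "\<lambda>c. a (coset B (s c))"] by auto
    qed
    have "coset B z \<in> Q.span ?D" if z: "z \<in> Z" for z
    proof -
      have "\<phi> z \<in> span (C0 \<union> C)" using im z by blast
      then obtain x y where xy: "\<phi> z = x + y" "x \<in> span C0" "y \<in> span C"
        unfolding span_Un by blast
      obtain u where u: "y = (\<Sum>c\<in>C. u c *\<^sub>R c)"
        using xy(3) unfolding span_finite[OF fin] by auto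
      \<comment> \<open>Linear combinations in the quotient have coefficients indexed by cosets, so each coset has
        to be traced back to its basis vector.\<close>
      define a where "a = u \<circ> \<phi> \<circ> s \<circ> (\<lambda>X. SOME c. c \<in> C \<and> X = coset B (s c))"
      have a: "a (coset B (s c)) = u c" if "c \<in> C" for c
      proof -
        have "(SOME c'. c' \<in> C \<and> coset B (s c) = coset B (s c')) = c"
          using inj that by (intro some_equality) (auto simp: inj_on_def)
        then show ?thesis using that s by (simp add: a_def)
      qed
      have mem: "(\<Sum>c\<in>C. u c *\<^sub>R s c) \<in> Z"
        using s by (intro subspace_sum[OF Z] subspace_scale[OF Z])
      have "z - (\<Sum>c\<in>C. u c *\<^sub>R s c) \<in> B"
        unfolding B_eq using xy u z mem by (simp add: linear_diff[OF \<phi>] \<phi>_sum subspace_diff[OF Z])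
      then have "coset B z = Q.lincomb a ?D"
        by (simp add: comb a coset_eq_iff[OF B])
      then show ?thesis unfolding Q.finite_span[OF D] by auto
    qed
    then show "Q.span ?D = carrier (quotient_space Z B)"
      using Q.span_is_subset2[OF D(2)] by (auto simp: quotient_space_carrier)
  qed
  moreover have "card ?D = card C" using inj by (simp add: card_image)
  ultimately show ?thesis
    unfolding has_dim_def Q.fin_dim_def
    using Q.vectorspace_axioms Q.dim_basis[OF D(1)] D by (auto simp: Q.basis_def)
qed

section \<open>Rank and nullity in possibly infinite-dimensional spaces\<close>

lemma finite_basis_extension:
  fixes S :: "'a::real_vector set"
  assumes "finite A" "S \<subseteq> span A" "I \<subseteq> S" "independent I" and S: "subspace S"
  obtains C where "finite C" "finite I" "I \<inter> C = {}" "independent (I \<union> C)" "span (I \<union> C) = S"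
    "card I + card C = dim S"
proof -
  obtain B where B: "I \<subseteq> B" "B \<subseteq> S" "independent B" "S \<subseteq> span B"
    using maximal_independent_subset_extend[OF assms(3,4)] by blast
  have "finite B"
    using independent_span_bound[OF assms(1) B(3)] B(2) assms(2) by blast
  moreover have "span B = S" using B span_minimal[OF B(2) S] by blast
  ultimately have "card B = dim S" using dim_span_eq_card_independent[OF B(3)] by simp
  show ?thesis
  proof (rule that)
    have "I \<union> (B - I) = B" using B(1) by blast
    then show "independent (I \<union> (B - I))" "span (I \<union> (B - I)) = S"
      using B \<open>span B = S\<close> by simp_all
    show "card I + card (B - I) = dim S"
      using \<open>card B = dim S\<close> \<open>finite B\<close> B(1) card_mono[OF \<open>finite B\<close> B(1)]
      by (simp add: card_Diff_subset finite_subset)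
  qed (use \<open>finite B\<close> B(1) finite_subset in auto)
qed

text \<open>The ambient spaces below are function spaces of infinite dimension, so the finiteness assumption
  concerns the subspace only. A basis of the kernel is extended to a basis of \<open>S\<close>; the map is
  injective on the span of the added vectors and sends them to a basis of the image.\<close>

lemma rank_nullity:
  fixes f :: "'a::real_vector \<Rightarrow> 'b::real_vector"
  assumes f: "linear f" and S: "subspace S" and fin: "finite A" "S \<subseteq> span A"
  shows "dim S = dim {x \<in> S. f x = 0} + dim (f ` S)"
proof -
  let ?K = "{x \<in> S. f x = 0}"
  have K: "subspace ?K"
    using S by (auto simp: subspace_def linear_0[OF f] linear_add[OF f] linear_scale[OF f])
  obtain I where I: "finite I" "independent I" "span I = ?K" "card I = dim ?K"
    using finite_basis_extension[OF fin(1), of ?K "{}"] fin(2) K by (auto simp: independent_empty)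
  have "I \<subseteq> S" using span_superset[of I] I(3) by blast
  then obtain C where C: "finite C" "I \<inter> C = {}" "independent (I \<union> C)" "span (I \<union> C) = S"
      "card I + card C = dim S"
    using finite_basis_extension[OF fin _ I(2) S] by metis
  have inj: "inj_on f (span C)"
  proof -
    have "x = 0" if x: "x \<in> span C" "f x = 0" for x
    proof (rule ccontr)
      assume "x \<noteq> 0"
      have "x \<in> span I" using x I(3) C(4) span_mono[of C "I \<union> C"] by auto
      obtain a where a: "x = (\<Sum>c\<in>C. a c *\<^sub>R c)" using x(1) unfolding span_finite[OF C(1)] by auto
      obtain b where b: "x = (\<Sum>c\<in>I. b c *\<^sub>R c)"
        using \<open>x \<in> span I\<close> unfolding span_finite[OF I(1)] by auto
      have "(\<Sum>c\<in>I \<union> C. (if c \<in> C then a c else - b c) *\<^sub>R c) =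
          (\<Sum>c\<in>I. - b c *\<^sub>R c) + (\<Sum>c\<in>C. a c *\<^sub>R c)"
        using C(1,2) I(1) by (subst sum.union_disjoint) (auto intro!: arg_cong2[of _ _ _ _ "(+)"] sum.cong)
      also have "\<dots> = 0" using a b by (simp add: sum_negf)
      finally have zero: "(\<Sum>c\<in>I \<union> C. (if c \<in> C then a c else - b c) *\<^sub>R c) = 0" .
      have "a c = 0" if "c \<in> C" for c
        using independentD[OF C(3) _ order_refl zero, of c] C(1) I(1) that by simp
      then show False using a \<open>x \<noteq> 0\<close> by simp
    qed
    then show ?thesis
      using linear_injective_on_subspace_0[OF f subspace_span, of C] by blast
  qed
  have "f ` S = span (f ` C)"
  proof -
    have "f ` S = span (f ` I \<union> f ` C)"
      using linear_span_image[OF f, of "I \<union> C"] C(4) by (simp add: image_Un)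
    also have "\<dots> = span (f ` C)"
    proof
      have "f ` I \<subseteq> span (f ` C)" using I(3) span_superset[of I] by (auto simp: span_zero)
      then show "span (f ` I \<union> f ` C) \<subseteq> span (f ` C)"
        using span_superset[of "f ` C"] by (intro span_minimal) auto
    qed (rule span_mono, blast)
    finally show ?thesis .
  qed
  moreover have "independent (f ` C)"
    by (rule linear_independent_injective_image[OF f independent_mono[OF C(3)] inj]) blast
  moreover have "card (f ` C) = card C"
    by (rule card_image[OF inj_on_subset[OF inj span_superset]])
  ultimately have "dim (f ` S) = card C" by (metis dim_span_eq_card_independent)
  then show ?thesis using C(5) I(4) by simp
qed

definition supported_on :: "'a set \<Rightarrow> ('a \<Rightarrow> real) set" where
  "supported_on P = {v. \<forall>a. v a \<noteq> 0 \<longrightarrow> a \<in> P}"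

lemma supported_onD: "v \<in> supported_on P \<Longrightarrow> a \<notin> P \<Longrightarrow> v a = 0"
  by (auto simp: supported_on_def)

lemma subspace_supported_on: "subspace (supported_on P)"
  by (force simp: subspace_def supported_on_def scaleR_fun_def)

lemma supported_on_mono: "P \<subseteq> Q \<Longrightarrow> v \<in> supported_on P \<Longrightarrow> v \<in> supported_on Q"
  by (auto simp: supported_on_def)

lemma supported_on_Int: "supported_on (P \<inter> Q) = supported_on P \<inter> supported_on Q"
  by (auto simp: supported_on_def)

definition unit_fun :: "'a \<Rightarrow> 'a \<Rightarrow> real" where
  "unit_fun a = (\<lambda>b. if b = a then 1 else 0)"

lemma sum_fun_apply: "(\<Sum>i\<in>I. f i) x = (\<Sum>i\<in>I. f i x)" for f :: "'i \<Rightarrow> 'a \<Rightarrow> 'b::comm_monoid_add"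
  by (induction I rule: infinite_finite_induct) auto

lemma sum_unit_fun:
  assumes "finite P"
  shows "(\<Sum>a\<in>P. c a *\<^sub>R unit_fun a) = (\<lambda>b. if b \<in> P then c b else 0)"
proof
  fix b
  have "(\<Sum>a\<in>P. c a *\<^sub>R unit_fun a) b = (\<Sum>a\<in>P. if b = a then c a else 0)"
    by (auto simp: sum_fun_apply scaleR_fun_def unit_fun_def intro!: sum.cong)
  then show "(\<Sum>a\<in>P. c a *\<^sub>R unit_fun a) b = (if b \<in> P then c b else 0)"
    using assms by simp
qed

lemma inj_unit_fun: "inj_on unit_fun P"
  by (auto simp: inj_on_def unit_fun_def fun_eq_iff split: if_splits)

lemma span_unit_fun:
  assumes "finite P"
  shows "span (unit_fun ` P) = supported_on P"
proof
  show "span (unit_fun ` P) \<subseteq> supported_on P"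
    by (intro span_minimal subspace_supported_on)
      (auto simp: supported_on_def unit_fun_def split: if_splits)
  show "supported_on P \<subseteq> span (unit_fun ` P)"
  proof
    fix v assume "v \<in> supported_on P"
    then have "v = (\<Sum>a\<in>P. v a *\<^sub>R unit_fun a)"
      unfolding sum_unit_fun[OF assms] by (force simp: supported_on_def fun_eq_iff)
    also have "\<dots> \<in> span (unit_fun ` P)" by (intro span_sum span_scale span_base) auto
    finally show "v \<in> span (unit_fun ` P)" .
  qed
qed

lemma dim_supported_on:
  assumes "finite P"
  shows "dim (supported_on P) = card P"
proof -
  have "independent (unit_fun ` P)"
    unfolding independent_explicit_module
  proof (intro allI impI)
    fix T u v assume T: "finite T" "T \<subseteq> unit_fun ` P" "(\<Sum>v\<in>T. u v *\<^sub>R v) = 0" "v \<in> T"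
    then obtain Q where Q: "Q \<subseteq> P" "T = unit_fun ` Q" unfolding subset_image_iff by blast
    then have "finite Q" using assms finite_subset by blast
    have "(\<Sum>v\<in>T. u v *\<^sub>R v) = (\<Sum>a\<in>Q. u (unit_fun a) *\<^sub>R unit_fun a)"
      unfolding Q(2) by (simp only: sum.reindex[OF inj_unit_fun] comp_def)
    also have "\<dots> = (\<lambda>b. if b \<in> Q then u (unit_fun b) else 0)" by (rule sum_unit_fun) fact
    finally have eq: "(\<Sum>v\<in>T. u v *\<^sub>R v) = (\<lambda>b. if b \<in> Q then u (unit_fun b) else 0)" .
    have "(if b \<in> Q then u (unit_fun b) else 0) = 0" for b
      using fun_cong[OF trans[OF eq[symmetric] T(3)], of b] by (simp only: zero_fun_apply)
    then have "\<forall>b\<in>Q. u (unit_fun b) = 0"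
      by presburger
    then show "u v = 0" using T(4) Q by auto
  qed
  then have "dim (span (unit_fun ` P)) = card (unit_fun ` P)" by (rule dim_span_eq_card_independent)
  then show ?thesis by (simp add: span_unit_fun[OF assms] card_image[OF inj_unit_fun])
qed

section \<open>Lowering and raising operators\<close>

text \<open>A function \<open>v\<close> on exponents stands for the operator \<open>\<Sum> v(\<alpha>) \<Omega>\<^sup>\<alpha>\<close> with constant coefficients.
  Degrees are integers, so that degree \<open>k - 1\<close> makes sense for \<open>k = 0\<close>, where the homogeneous
  space is zero.\<close>

abbreviation deg :: "('n::finite \<Rightarrow> nat) \<Rightarrow> int" where
  "deg \<alpha> \<equiv> int (\<Sum>i\<in>UNIV. \<alpha> i)"

definition incr :: "'n \<Rightarrow> ('n \<Rightarrow> nat) \<Rightarrow> 'n \<Rightarrow> nat" where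
  "incr i \<alpha> = \<alpha>(i := Suc (\<alpha> i))"

definition decr :: "'n \<Rightarrow> ('n \<Rightarrow> nat) \<Rightarrow> 'n \<Rightarrow> nat" where
  "decr i \<alpha> = \<alpha>(i := \<alpha> i - 1)"

definition homog :: "int \<Rightarrow> (('n::finite \<Rightarrow> nat) \<Rightarrow> real) set" where
  "homog m = supported_on {\<alpha>. deg \<alpha> = m}"

text \<open>The isotropy action of \<open>x\<^sup>2 d/dx\<close>, and a raising operator that completes it to an action of
  \<open>sl\<^sub>2\<close> on a product of Verma modules. In \<open>raise\<close> the factor \<open>\<alpha> i\<close> removes the terms with
  \<open>\<alpha> i = 0\<close>, for which \<open>decr\<close> has no meaning.\<close>

definition lower :: "('n::finite \<Rightarrow> nat) \<Rightarrow> (('n \<Rightarrow> nat) \<Rightarrow> real) \<Rightarrow> ('n \<Rightarrow> nat) \<Rightarrow> real" where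
  "lower t v = (\<lambda>\<alpha>. \<Sum>i\<in>UNIV. (real (t i) - real (\<alpha> i)) * v (incr i \<alpha>))"

definition raise :: "(('n::finite \<Rightarrow> nat) \<Rightarrow> real) \<Rightarrow> ('n \<Rightarrow> nat) \<Rightarrow> real" where
  "raise v = (\<lambda>\<alpha>. \<Sum>i\<in>UNIV. real (\<alpha> i) * v (decr i \<alpha>))"

lemma incr_apply: "incr i \<alpha> l = (if l = i then Suc (\<alpha> i) else \<alpha> l)"
  and decr_apply: "decr i \<alpha> l = (if l = i then \<alpha> i - 1 else \<alpha> l)"
  by (auto simp: incr_def decr_def)

lemma decr_incr [simp]: "decr i (incr i \<alpha>) = \<alpha>"
  by (auto simp: incr_apply decr_apply)

lemma incr_decr: "0 < \<alpha> i \<Longrightarrow> incr i (decr i \<alpha>) = \<alpha>"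
  by (auto simp: incr_apply decr_apply)

lemma incr_decr_commute: "i \<noteq> l \<Longrightarrow> incr i (decr l \<alpha>) = decr l (incr i \<alpha>)"
  by (auto simp: incr_apply decr_apply fun_eq_iff)

lemma deg_incr [simp]: "deg (incr i \<alpha>) = deg \<alpha> + 1"
  by (simp add: incr_def sum.remove[of UNIV i] del: of_nat_sum)

lemma deg_decr: "0 < \<alpha> i \<Longrightarrow> deg (decr i \<alpha>) = deg \<alpha> - 1"
  using deg_incr[of i "decr i \<alpha>"] by (simp add: incr_decr del: deg_incr)

lemma linear_lower: "linear (lower t)"
proof (rule linearI)
  show "lower t (v + w) = lower t v + lower t w" for v w
    by (rule ext) (simp add: lower_def distrib_left sum.distrib)
  show "lower t (c *\<^sub>R v) = c *\<^sub>R lower t v" for c v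
    by (rule ext) (simp add: lower_def scaleR_fun_def sum_distrib_left mult.left_commute)
qed

lemma linear_raise: "linear raise"
proof (rule linearI)
  show "raise (v + w) = raise v + raise w" for v w :: "('a \<Rightarrow> nat) \<Rightarrow> real"
    by (rule ext) (simp add: raise_def distrib_left sum.distrib)
  show "raise (c *\<^sub>R v) = c *\<^sub>R raise v" for c and v :: "('a \<Rightarrow> nat) \<Rightarrow> real"
    by (rule ext) (simp add: raise_def scaleR_fun_def sum_distrib_left mult.left_commute)
qed

lemma lower_homog:
  assumes "v \<in> homog m"
  shows "lower t v \<in> homog (m - 1)"
proof -
  have "lower t v \<alpha> = 0" if "deg \<alpha> \<noteq> m - 1" for \<alpha>
  proof -
    have "v (incr i \<alpha>) = 0" for i
      using assms that unfolding homog_def by (intro supported_onD[of v]) (auto simp del: of_nat_sum)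
    then show ?thesis by (simp add: lower_def)
  qed
  then show ?thesis unfolding homog_def supported_on_def by blast
qed

lemma raise_homog:
  assumes "v \<in> homog m"
  shows "raise v \<in> homog (m + 1)"
proof -
  have "raise v \<alpha> = 0" if "deg \<alpha> \<noteq> m + 1" for \<alpha>
  proof -
    have "real (\<alpha> i) * v (decr i \<alpha>) = 0" for i
    proof (cases "\<alpha> i")
      case (Suc _)
      then have "deg (decr i \<alpha>) \<noteq> m" using that deg_decr[of \<alpha> i] by simp
      then show ?thesis using assms unfolding homog_def by (simp add: supported_onD)
    qed simp
    then show ?thesis unfolding raise_def by (intro sum.neutral ballI)
  qed
  then show ?thesis unfolding homog_def supported_on_def by blast
qed

text \<open>The commutator of the two operators is diagonal: the terms that move a unit between two different
  positions cancel.\<close>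

lemma lower_raise:
  "lower t (raise v) \<alpha> = raise (lower t v) \<alpha> + (real (\<Sum>i\<in>UNIV. t i) - 2 * real_of_int (deg \<alpha>)) * v \<alpha>"
proof -
  let ?x = "\<lambda>i l. (real (t i) - real (\<alpha> i)) * (real (incr i \<alpha> l) * v (decr l (incr i \<alpha>)))"
  let ?y = "\<lambda>i l. real (\<alpha> l) * ((real (t i) - real (decr l \<alpha> i)) * v (incr i (decr l \<alpha>)))"
  have xy: "?x i l = ?y i l + (if i = l then (real (t i) - 2 * real (\<alpha> i)) * v \<alpha> else 0)" for i l
  proof (cases "i = l")
    case True
    then show ?thesis
      by (cases "\<alpha> l") (auto simp: incr_decr incr_apply decr_apply algebra_simps)
  next
    case False
    then show ?thesis by (simp add: incr_decr_commute) (simp add: incr_apply decr_apply)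
  qed
  have "lower t (raise v) \<alpha> = (\<Sum>i\<in>UNIV. \<Sum>l\<in>UNIV. ?x i l)"
    by (simp add: lower_def raise_def sum_distrib_left)
  also have "\<dots> = (\<Sum>i\<in>UNIV. \<Sum>l\<in>UNIV. ?y i l) + (\<Sum>i\<in>UNIV. (real (t i) - 2 * real (\<alpha> i)) * v \<alpha>)"
    unfolding xy sum.distrib by simp
  also have "(\<Sum>i\<in>UNIV. \<Sum>l\<in>UNIV. ?y i l) = raise (lower t v) \<alpha>"
    unfolding lower_def raise_def sum_distrib_left by (rule sum.swap)
  also have "(\<Sum>i\<in>UNIV. (real (t i) - 2 * real (\<alpha> i)) * v \<alpha>) =
      (real (\<Sum>i\<in>UNIV. t i) - 2 * real_of_int (deg \<alpha>)) * v \<alpha>"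
    by (simp add: sum_distrib_right[symmetric] sum_subtractf sum_distrib_left[symmetric])
  finally show ?thesis .
qed

lemma lower_raise_homog:
  assumes "v \<in> homog m"
  shows "lower t (raise v) = raise (lower t v) + (real (\<Sum>i\<in>UNIV. t i) - 2 * real_of_int m) *\<^sub>R v"
proof
  fix \<alpha>
  have "real_of_int (deg \<alpha>) * v \<alpha> = real_of_int m * v \<alpha>"
    using assms unfolding homog_def by (cases "deg \<alpha> = m") (auto simp: supported_onD)
  then show "lower t (raise v) \<alpha> =
      (raise (lower t v) + (real (\<Sum>i\<in>UNIV. t i) - 2 * real_of_int m) *\<^sub>R v) \<alpha>"
    unfolding lower_raise by (simp add: scaleR_fun_def left_diff_distrib del: of_int_of_nat_eq of_nat_sum mult_cancel_right)
qed

lemma lower_power_homog: "v \<in> homog m \<Longrightarrow> (lower t ^^ r) v \<in> homog (m - int r)"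
proof (induction r)
  case (Suc r)
  then show ?case using lower_homog[of "(lower t ^^ r) v" "m - int r" t] by (simp add: algebra_simps)
qed simp

lemma raise_power_homog: "v \<in> homog m \<Longrightarrow> (raise ^^ r) v \<in> homog (m + int r)"
proof (induction r)
  case (Suc r)
  then show ?case using raise_homog[of "(raise ^^ r) v" "m + int r"] by (simp add: algebra_simps)
qed simp

text \<open>The standard commutation formulas of \<open>sl\<^sub>2\<close> on vectors of a fixed weight. The scalar is a sum of
  consecutive weights, which form an arithmetic progression.\<close>

lemma lower_power_raise:
  assumes "v \<in> homog m"
  shows "(lower t ^^ Suc r) (raise v) = raise ((lower t ^^ Suc r) v) +
    (real (Suc r) * (real (\<Sum>i\<in>UNIV. t i) - 2 * real_of_int m + real r)) *\<^sub>R (lower t ^^ r) v"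
proof (induction r)
  case 0
  show ?case using lower_raise_homog[OF assms, of t] by simp
next
  case (Suc r)
  let ?T = "real (\<Sum>i\<in>UNIV. t i)" and ?m = "real_of_int m" and ?w = "(lower t ^^ Suc r) v"
  have "(lower t ^^ Suc (Suc r)) (raise v) = lower t (raise ?w) +
      (real (Suc r) * (?T - 2 * ?m + real r)) *\<^sub>R ?w"
    using Suc[THEN arg_cong, of "lower t"]
    by (simp only: linear_add[OF linear_lower] linear_scale[OF linear_lower] funpow.simps o_def)
  also have "lower t (raise ?w) = raise (lower t ?w) + (?T - 2 * real_of_int (m - int (Suc r))) *\<^sub>R ?w"
    by (rule lower_raise_homog[OF lower_power_homog[OF assms]])
  finally have "(lower t ^^ Suc (Suc r)) (raise v) = raise (lower t ?w) +
      ((?T - 2 * real_of_int (m - int (Suc r))) + (real (Suc r) * (?T - 2 * ?m + real r))) *\<^sub>R ?w"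
    by (simp only: scaleR_add_left add.assoc)
  also have "(?T - 2 * real_of_int (m - int (Suc r))) + (real (Suc r) * (?T - 2 * ?m + real r)) =
      real (Suc (Suc r)) * (?T - 2 * ?m + real (Suc r))"
    by (simp add: algebra_simps)
  finally show ?case by simp
qed

lemma lower_raise_power:
  assumes "v \<in> homog m"
  shows "lower t ((raise ^^ Suc r) v) = (raise ^^ Suc r) (lower t v) +
    (real (Suc r) * (real (\<Sum>i\<in>UNIV. t i) - 2 * real_of_int m - real r)) *\<^sub>R (raise ^^ r) v"
proof (induction r)
  case 0
  show ?case using lower_raise_homog[OF assms, of t] by simp
next
  case (Suc r)
  let ?T = "real (\<Sum>i\<in>UNIV. t i)" and ?m = "real_of_int m" and ?w = "(raise ^^ Suc r) v"
  have "lower t ((raise ^^ Suc (Suc r)) v) = lower t (raise ?w)" by simp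
  also have "\<dots> = raise (lower t ?w) + (?T - 2 * real_of_int (m + int (Suc r))) *\<^sub>R ?w"
    by (rule lower_raise_homog[OF raise_power_homog[OF assms]])
  also have "raise (lower t ?w) = (raise ^^ Suc (Suc r)) (lower t v) +
      (real (Suc r) * (?T - 2 * ?m - real r)) *\<^sub>R ?w"
    unfolding Suc by (simp add: linear_add[OF linear_raise] linear_scale[OF linear_raise])
  finally have "lower t ((raise ^^ Suc (Suc r)) v) = (raise ^^ Suc (Suc r)) (lower t v) +
      ((real (Suc r) * (?T - 2 * ?m - real r)) + (?T - 2 * real_of_int (m + int (Suc r)))) *\<^sub>R ?w"
    by (simp only: scaleR_add_left add.assoc)
  also have "(real (Suc r) * (?T - 2 * ?m - real r)) + (?T - 2 * real_of_int (m + int (Suc r))) =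
      real (Suc (Suc r)) * (?T - 2 * ?m - real (Suc r))"
    by (simp add: algebra_simps)
  finally show ?case .
qed

lemma homog_negative: "m < 0 \<Longrightarrow> homog m = {0}"
proof -
  assume "m < 0"
  moreover have "0 \<le> deg \<alpha>" for \<alpha> :: "'a \<Rightarrow> nat" by (rule of_nat_0_le_iff)
  ultimately have "deg \<alpha> \<noteq> m" for \<alpha> :: "'a \<Rightarrow> nat" by (metis not_less)
  then have "{\<alpha> :: 'a \<Rightarrow> nat. deg \<alpha> = m} = {}" by blast
  then show "homog m = ({0} :: (('a \<Rightarrow> nat) \<Rightarrow> real) set)"
    unfolding homog_def by (auto simp: supported_on_def fun_eq_iff)
qed

lemma subspace_homog: "subspace (homog m)"
  unfolding homog_def by (rule subspace_supported_on)

text \<open>On a vector killed by \<open>r + 1\<close> lowerings, lowering after raising acts modulo vectors killed by \<open>r\<close>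
  lowerings as a scalar, which is positive because the weight is. Hence induction on the number of
  lowerings that kill the vector reaches every vector of the target.\<close>

lemma lower_surj:
  assumes m: "2 * m < int (\<Sum>i\<in>UNIV. t i)"
  shows "lower t ` homog (m + 1) = homog m"
proof
  show "lower t ` homog (m + 1) \<subseteq> homog m" using lower_homog[of _ "m + 1" t] by auto
  have surj: "v \<in> lower t ` homog (m + 1)" if "v \<in> homog m" "(lower t ^^ r) v = 0" for r v
    using that
  proof (induction r arbitrary: v)
    case 0
    have "v = 0" using "0"(2) by (simp only: funpow.simps id_apply)
    then show ?case using subspace_0[OF subspace_homog, of "m + 1"] linear_0[OF linear_lower, of t]
      by (metis imageI)
  next
    case (Suc r)
    \<comment> \<open>The scalar by which \<open>r + 1\<close> lowerings of the raised vector differ from \<open>r\<close> lowerings of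
      the vector itself.\<close>
    define c where "c = real (Suc r) * (real (\<Sum>i\<in>UNIV. t i) - 2 * real_of_int m + real r)"
    define u where "u = inverse c *\<^sub>R raise v"
    have "real_of_int (2 * m) < real (\<Sum>i\<in>UNIV. t i)"
      using m by linarith
    then have "c \<noteq> 0" by (simp add: c_def)
    have u: "u \<in> homog (m + 1)"
      unfolding u_def by (intro subspace_scale[OF subspace_homog] raise_homog Suc.prems)
    have pow: "linear (lower t ^^ r)" for r
    proof (induction r)
      case 0
      show ?case by (simp add: linear_iff)
    next
      case (Suc r)
      show ?case using linear_compose[OF Suc linear_lower] by (simp only: funpow.simps)
    qed
    have "(lower t ^^ r) (lower t (raise v)) = c *\<^sub>R (lower t ^^ r) v"
      using lower_power_raise[OF Suc.prems(1), where t = t and r = r] Suc.prems(2)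
      by (simp only: c_def linear_0[OF linear_raise] add_0 funpow_Suc_right o_def)
    then have "(lower t ^^ r) (v - lower t u) = 0"
      using \<open>c \<noteq> 0\<close> by (simp add: u_def linear_diff[OF pow] linear_scale[OF pow] linear_scale[OF linear_lower])
    moreover have "v - lower t u \<in> homog m"
      using Suc.prems(1) lower_homog[OF u, of t] subspace_diff[OF subspace_homog, of v m] by simp
    ultimately obtain x where x: "x \<in> homog (m + 1)" "v - lower t u = lower t x"
      using Suc.IH by blast
    then have "v = lower t (x + u)" by (simp add: linear_add[OF linear_lower] algebra_simps)
    then show ?case using subspace_add[OF subspace_homog x(1) u] by blast
  qed
  show "homog m \<subseteq> lower t ` homog (m + 1)"
  proof
    fix v :: "('a \<Rightarrow> nat) \<Rightarrow> real" assume v: "v \<in> homog m"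
    have "(lower t ^^ nat (m + 1)) v \<in> homog (m - int (nat (m + 1)))" by (rule lower_power_homog[OF v])
    moreover have "m - int (nat (m + 1)) < 0" by linarith
    ultimately have "(lower t ^^ nat (m + 1)) v = 0"
      using homog_negative by (metis singletonD)
    then show "v \<in> lower t ` homog (m + 1)" using surj v by blast
  qed
qed

text \<open>The exponents bounded by \<open>t\<close> index a basis of the tensor product of the finite-dimensional
  quotients of the Verma modules; the others index the submodule that is divided out. As far as
  lowering alone is concerned, the two parts are both invariant, since the coefficient
  \<open>t\<^sub>i - \<alpha>\<^sub>i\<close> vanishes exactly where a step would cross the boundary.\<close>

definition in_box :: "('n::finite \<Rightarrow> nat) \<Rightarrow> int \<Rightarrow> ('n \<Rightarrow> nat) set" where
  "in_box t m = {\<alpha>. (\<forall>i. \<alpha> i \<le> t i) \<and> deg \<alpha> = m}"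

definition off_box :: "('n::finite \<Rightarrow> nat) \<Rightarrow> int \<Rightarrow> ('n \<Rightarrow> nat) set" where
  "off_box t m = {\<alpha>. (\<exists>i. t i < \<alpha> i) \<and> deg \<alpha> = m}"

lemma off_box_eq: "off_box t m = {\<alpha>. \<exists>i. t i < \<alpha> i} \<inter> {\<alpha>. deg \<alpha> = m}"
  by (auto simp: off_box_def)

lemma lower_in_box:
  assumes "v \<in> supported_on (in_box t m)"
  shows "lower t v \<in> supported_on (in_box t (m - 1))"
proof -
  have "lower t v \<alpha> = 0" if "\<alpha> \<notin> in_box t (m - 1)" for \<alpha>
  proof -
    have "incr i \<alpha> \<notin> in_box t m" for i
    proof
      assume "incr i \<alpha> \<in> in_box t m"
      then have le: "\<forall>l. incr i \<alpha> l \<le> t l" and d: "deg \<alpha> + 1 = m"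
        unfolding in_box_def by (simp_all del: of_nat_sum)
      have "\<alpha> l \<le> t l" for l using le[rule_format, of l] by (simp add: incr_apply split: if_splits)
      moreover have "deg \<alpha> = m - 1" using d by linarith
      ultimately have "\<alpha> \<in> in_box t (m - 1)" unfolding in_box_def by blast
      then show False using that by contradiction
    qed
    then have "v (incr i \<alpha>) = 0" for i by (rule supported_onD[OF assms])
    then show ?thesis by (simp add: lower_def)
  qed
  then show ?thesis unfolding supported_on_def by blast
qed

lemma lower_off_box:
  assumes "v \<in> supported_on (off_box t m)"
  shows "lower t v \<in> supported_on (off_box t (m - 1))"
proof -
  have "lower t v \<alpha> = 0" if "\<alpha> \<notin> off_box t (m - 1)" for \<alpha>
  proof -
    have "(real (t i) - real (\<alpha> i)) * v (incr i \<alpha>) = 0" for i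
    proof (cases "t i = \<alpha> i")
      case False
      have "incr i \<alpha> \<notin> off_box t m"
      proof
        assume "incr i \<alpha> \<in> off_box t m"
        then obtain l where l: "t l < incr i \<alpha> l" and d: "deg \<alpha> + 1 = m"
          unfolding off_box_def by (auto simp del: of_nat_sum)
        have "t l < \<alpha> l" using l False by (simp add: incr_apply split: if_splits)
        moreover have "deg \<alpha> = m - 1" using d by linarith
        ultimately have "\<alpha> \<in> off_box t (m - 1)" unfolding off_box_def by blast
        then show False using that by contradiction
      qed
      then show ?thesis using supported_onD[OF assms] by simp
    qed simp
    then show ?thesis unfolding lower_def by (intro sum.neutral ballI)
  qed
  then show ?thesis unfolding supported_on_def by blast
qed

lemma raise_off_box:
  assumes "v \<in> supported_on {\<alpha>. \<exists>i. t i < \<alpha> i}"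
  shows "raise v \<in> supported_on {\<alpha>. \<exists>i. t i < \<alpha> i}"
proof -
  have "raise v \<alpha> = 0" if "\<alpha> \<notin> {\<alpha>. \<exists>i. t i < \<alpha> i}" for \<alpha>
  proof -
    have "decr i \<alpha> l \<le> t l" for i l
    proof -
      have "decr i \<alpha> l \<le> \<alpha> l" by (simp add: decr_apply)
      also have "\<alpha> l \<le> t l" using that by (simp add: not_less)
      finally show ?thesis .
    qed
    then have "v (decr i \<alpha>) = 0" for i
      by (intro supported_onD[OF assms]) (simp add: not_less)
    then show ?thesis by (simp add: raise_def)
  qed
  then show ?thesis unfolding supported_on_def by blast
qed

text \<open>In negative weight a vector that is killed by lowering vanishes in a finite-dimensional module:
  high powers of the raising operator kill it, and lowering such a power returns a nonzero multiple
  of the preceding one, so that all powers, and finally the vector itself, are zero.\<close>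

lemma lower_inj_mod_off_box:
  assumes m: "int (\<Sum>i\<in>UNIV. t i) < 2 * m" and v: "v \<in> homog m"
    and lv: "lower t v \<in> supported_on {\<alpha>. \<exists>i. t i < \<alpha> i}" (is "_ \<in> ?O")
  shows "v \<in> supported_on {\<alpha>. \<exists>i. t i < \<alpha> i}"
proof -
  have O: "subspace ?O" by (rule subspace_supported_on)
  have raise_pow: "(raise ^^ r) w \<in> ?O" if "w \<in> ?O" for r w
    using that by (induction r) (auto intro: raise_off_box)
  have large: "(raise ^^ r) v \<in> ?O" if "int (\<Sum>i\<in>UNIV. t i) < m + int r" for r
  proof -
    have "\<exists>i. t i < \<alpha> i" if "deg \<alpha> = m + int r" for \<alpha> :: "'a \<Rightarrow> nat"
    proof (rule ccontr)
      assume "\<not> ?thesis"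
      then have "(\<Sum>i\<in>UNIV. \<alpha> i) \<le> (\<Sum>i\<in>UNIV. t i)" by (intro sum_mono) (simp add: not_less)
      then show False using that \<open>int (\<Sum>i\<in>UNIV. t i) < m + int r\<close> by linarith
    qed
    then have "{\<alpha>. deg \<alpha> = m + int r} \<subseteq> {\<alpha>. \<exists>i. t i < \<alpha> i}" by blast
    then show ?thesis
      by (rule supported_on_mono) (rule raise_power_homog[OF v, unfolded homog_def])
  qed
  have step: "(raise ^^ r) v \<in> ?O" if "(raise ^^ Suc r) v \<in> ?O" for r
  proof -
    define c where "c = real (Suc r) * (real (\<Sum>i\<in>UNIV. t i) - 2 * real_of_int m - real r)"
    have "real (\<Sum>i\<in>UNIV. t i) < real_of_int (2 * m)" using m by linarith
    then have "c \<noteq> 0" by (simp add: c_def)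
    have "lower t ((raise ^^ Suc r) v) \<in> ?O"
    proof -
      have "(raise ^^ Suc r) v \<in> supported_on (off_box t (m + int (Suc r)))"
        using that raise_power_homog[OF v, of "Suc r"]
        unfolding off_box_eq homog_def supported_on_Int by simp
      then have "lower t ((raise ^^ Suc r) v) \<in> supported_on (off_box t (m + int (Suc r) - 1))"
        by (rule lower_off_box)
      then show ?thesis unfolding off_box_eq supported_on_Int by simp
    qed
    moreover have "(raise ^^ Suc r) (lower t v) \<in> ?O" by (rule raise_pow[OF lv])
    ultimately have "lower t ((raise ^^ Suc r) v) - (raise ^^ Suc r) (lower t v) \<in> ?O"
      by (rule subspace_diff[OF O])
    then have "c *\<^sub>R (raise ^^ r) v \<in> ?O"
      unfolding lower_raise_power[OF v] c_def[symmetric] add_diff_cancel_left' .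
    then have "inverse c *\<^sub>R (c *\<^sub>R (raise ^^ r) v) \<in> ?O"
      by (rule subspace_scale[OF O])
    then show ?thesis using \<open>c \<noteq> 0\<close> by simp
  qed
  have "v \<in> ?O" if "(raise ^^ r) v \<in> ?O" for r
    using that
  proof (induction r)
    case (Suc r)
    show ?case by (rule Suc.IH[OF step[OF Suc.prems]])
  qed simp
  moreover have "(raise ^^ Suc (nat (\<bar>m\<bar> + int (\<Sum>i\<in>UNIV. t i)))) v \<in> ?O"
    by (rule large) linarith
  ultimately show ?thesis by blast
qed

text \<open>Consider vectors supported where a fixed component \<open>i\<close> exceeds \<open>t i\<close>. Raising that component and
  dividing by the lowering coefficient, which does not vanish there, gives a preimage up to terms in
  which the component \<open>i\<close> is larger. As the degree is fixed, this cannot go on for ever.\<close>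

lemma lower_off_box_surj:
  assumes v: "v \<in> supported_on (off_box t m)"
  shows "v \<in> lower t ` supported_on (off_box t (m + 1))"
proof -
  let ?R = "lower t ` supported_on (off_box t (m + 1))"
  let ?P = "\<lambda>i s. {\<alpha>. t i < \<alpha> i \<and> s \<le> int (\<alpha> i) \<and> deg \<alpha> = m}"
  have R: "subspace ?R" by (rule linear_subspace_image[OF linear_lower subspace_supported_on])
  have dir: "w \<in> ?R" if "w \<in> supported_on (?P i s)" "m < s + int d" for w i s d
    using that
  proof (induction d arbitrary: w s)
    case 0
    have "int (\<alpha> i) \<le> deg \<alpha>" for \<alpha> :: "'a \<Rightarrow> nat"
      unfolding of_nat_le_iff by (rule member_le_sum) auto
    then have "\<alpha> \<notin> ?P i s" for \<alpha> using 0(2) by (smt (verit) mem_Collect_eq of_nat_0)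
    then have "w \<alpha> = 0" for \<alpha> using supported_onD[OF 0(1)] by blast
    then have "w = 0" by (simp add: fun_eq_iff)
    then show ?case using subspace_0[OF R] by (simp only:)
  next
    case (Suc d)
    define u where "u = (\<lambda>\<beta>. if 0 < \<beta> i then w (decr i \<beta>) / (real (t i) + 1 - real (\<beta> i)) else 0)"
    have u_nz: "0 < \<beta> i" "decr i \<beta> \<in> ?P i s" if "u \<beta> \<noteq> 0" for \<beta>
    proof -
      show "0 < \<beta> i" using that by (simp add: u_def split: if_splits)
      have "w (decr i \<beta>) \<noteq> 0" using that by (simp add: u_def split: if_splits)
      then show "decr i \<beta> \<in> ?P i s" using supported_onD[OF Suc.prems(1)] by blast
    qed
    have "u \<in> supported_on (off_box t (m + 1))"
    proof -
      have "\<beta> \<in> off_box t (m + 1)" if "u \<beta> \<noteq> 0" for \<beta>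
      proof -
        have "t i < decr i \<beta> i" "deg (decr i \<beta>) = m" using u_nz(2)[OF that] by blast+
        then have "t i < \<beta> i" "deg \<beta> = m + 1"
          using deg_decr[of \<beta> i, OF u_nz(1)[OF that]] by (simp add: decr_apply, linarith)
        then show ?thesis unfolding off_box_def by blast
      qed
      then show ?thesis unfolding supported_on_def by blast
    qed
    moreover have "w - lower t u \<in> supported_on (?P i (s + 1))"
    proof -
      have main: "(real (t i) - real (\<alpha> i)) * u (incr i \<alpha>) = w \<alpha>" for \<alpha>
      proof (cases "t i = \<alpha> i")
        case True
        then show ?thesis using supported_onD[OF Suc.prems(1), of \<alpha>] by simp
      qed (simp add: u_def incr_apply)
      have "\<alpha> \<in> ?P i (s + 1)" if nz: "(w - lower t u) \<alpha> \<noteq> 0" for \<alpha>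
      proof -
        have "lower t u \<alpha> = w \<alpha> + (\<Sum>l\<in>UNIV - {i}. (real (t l) - real (\<alpha> l)) * u (incr l \<alpha>))"
          unfolding lower_def main[symmetric] by (rule sum.remove) auto
        then have "(\<Sum>l\<in>UNIV - {i}. (real (t l) - real (\<alpha> l)) * u (incr l \<alpha>)) \<noteq> 0"
          using nz by auto
        then obtain l where l: "l \<noteq> i" "u (incr l \<alpha>) \<noteq> 0"
          by (metis (no_types, lifting) DiffD2 insertI1 mult_zero_right sum.neutral)
        have pos: "0 < incr l \<alpha> i" and
          D: "t i < decr i (incr l \<alpha>) i" "s \<le> int (decr i (incr l \<alpha>) i)" "deg (decr i (incr l \<alpha>)) = m"
          using u_nz[OF l(2)] by blast+
        have "deg \<alpha> = m" using D(3) unfolding deg_decr[of "incr l \<alpha>" i, OF pos] deg_incr by linarith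
        then show ?thesis using l(1) D(1,2) pos by (auto simp: decr_apply incr_apply)
      qed
      then show ?thesis unfolding supported_on_def by blast
    qed
    then have "w - lower t u \<in> ?R" by (rule Suc.IH) (use Suc.prems(2) in simp)
    ultimately have "(w - lower t u) + lower t u \<in> ?R" by (intro subspace_add[OF R] imageI)
    then show ?case by simp
  qed
  \<comment> \<open>A general vector is a sum of vectors each of which has such a fixed component.\<close>
  define f where "f = (\<lambda>\<alpha>. SOME i. t i < \<alpha> i)"
  define w where "w i = (\<lambda>\<alpha>. if f \<alpha> = i then v \<alpha> else 0)" for i
  have "w i \<in> ?R" for i
  proof (rule dir)
    have "\<alpha> \<in> ?P i 0" if "w i \<alpha> \<noteq> 0" for \<alpha>
    proof -
      have "v \<alpha> \<noteq> 0" "f \<alpha> = i" using that by (auto simp: w_def split: if_splits)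
      then have "\<alpha> \<in> off_box t m" using supported_onD[OF v] by blast
      then have "\<exists>i. t i < \<alpha> i" "deg \<alpha> = m" by (auto simp: off_box_def simp del: of_nat_sum)
      moreover from someI_ex[OF this(1)] have "t i < \<alpha> i" using \<open>f \<alpha> = i\<close> by (simp add: f_def)
      ultimately show ?thesis by simp
    qed
    then show "w i \<in> supported_on (?P i 0)" unfolding supported_on_def by blast
    show "m < 0 + int (nat m + 1)" by linarith
  qed
  then have "(\<Sum>i\<in>UNIV. w i) \<in> ?R" by (intro subspace_sum[OF R])
  moreover have "(\<Sum>i\<in>UNIV. w i) = v" by (rule ext) (simp add: sum_fun_apply w_def)
  ultimately show ?thesis by simp
qed

section \<open>Dimensions of the kernel and cokernel of the lowering operator\<close>

lemma bij_betw_map_list: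
  assumes xs: "distinct xs" "set xs = UNIV"
  shows "bij_betw (\<lambda>\<alpha>. map \<alpha> xs) {\<alpha> :: 'n::finite \<Rightarrow> nat. deg \<alpha> = int N}
    {l. length l = length xs \<and> sum_list l = N}"
proof (rule bij_betw_imageI)
  show "inj_on (\<lambda>\<alpha>. map \<alpha> xs) {\<alpha> :: 'n \<Rightarrow> nat. deg \<alpha> = int N}"
    using xs(2) by (auto simp: inj_on_def fun_eq_iff)
  have sum: "sum_list (map \<alpha> xs) = (\<Sum>i\<in>UNIV. \<alpha> i)" for \<alpha> :: "'n \<Rightarrow> nat"
    using sum_list_distinct_conv_sum_set[OF xs(1)] xs(2) by metis
  have "l \<in> (\<lambda>\<alpha>. map \<alpha> xs) ` {\<alpha> :: 'n \<Rightarrow> nat. deg \<alpha> = int N}"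
    if "length l = length xs" "sum_list l = N" for l
  proof -
    define \<alpha> where "\<alpha> = the \<circ> map_of (zip xs l)"
    have "map \<alpha> xs = l"
      using that(1) xs(1) by (intro nth_equalityI) (auto simp: \<alpha>_def map_of_zip_nth)
    moreover from this have "deg \<alpha> = int N" using sum[of \<alpha>] that(2) by simp
    ultimately show ?thesis by blast
  qed
  then show "(\<lambda>\<alpha>. map \<alpha> xs) ` {\<alpha> :: 'n \<Rightarrow> nat. deg \<alpha> = int N} =
      {l. length l = length xs \<and> sum_list l = N}"
    using sum by (auto simp del: of_nat_sum)
qed

lemma card_deg: "card {\<alpha> :: 'n::finite \<Rightarrow> nat. deg \<alpha> = int N} = (N + CARD('n) - 1) choose N"
proof -
  obtain xs :: "'n list" where xs: "set xs = UNIV" "distinct xs"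
    using finite_distinct_list[OF finite[of "UNIV :: 'n set"]] by blast
  then have "length xs = CARD('n)" by (metis distinct_card)
  then show ?thesis
    using bij_betw_same_card[OF bij_betw_map_list[OF xs(2,1), of N]]
      card_length_sum_list[of "CARD('n)" N] by simp
qed

lemma finite_deg: "finite {\<alpha> :: 'n::finite \<Rightarrow> nat. deg \<alpha> = m}"
proof (rule finite_subset)
  show "{\<alpha> :: 'n \<Rightarrow> nat. deg \<alpha> = m} \<subseteq> PiE UNIV (\<lambda>_. {..nat m})"
  proof
    fix \<alpha> :: "'n \<Rightarrow> nat" assume "\<alpha> \<in> {\<alpha>. deg \<alpha> = m}"
    moreover have "int (\<alpha> i) \<le> deg \<alpha>" for i
      unfolding of_nat_le_iff by (rule member_le_sum) auto
    ultimately have "\<alpha> i \<le> nat m" for i by (metis mem_Collect_eq nat_int nat_mono)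
    then show "\<alpha> \<in> PiE UNIV (\<lambda>_. {..nat m})" by auto
  qed
qed (intro finite_PiE, auto)

text \<open>Pascal's rule. For \<open>k = 0\<close> the truncated subtraction in the binomial coefficient does no harm,
  because \<open>choose 0\<close> is always \<open>1\<close>.\<close>

lemma card_deg_diff:
  "int (card {\<alpha> :: 'n::finite \<Rightarrow> nat. deg \<alpha> = int k}) - int (card {\<alpha> :: 'n \<Rightarrow> nat. deg \<alpha> = int k - 1}) =
    int ((CARD('n) + k - 2) choose k)"
proof (cases k)
  case 0
  have "deg \<alpha> \<noteq> -1" for \<alpha> :: "'n \<Rightarrow> nat" using of_nat_0_le_iff[of "\<Sum>i\<in>UNIV. \<alpha> i"] by linarith
  then have "{\<alpha> :: 'n \<Rightarrow> nat. deg \<alpha> = -1} = {}" by blast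
  then show ?thesis using 0 card_deg[of 0, where 'n = 'n] by simp
next
  case (Suc m)
  then have eq: "int k - 1 = int m" by simp
  have pos: "0 < CARD('n)" by simp
  then have *: "k + CARD('n) - 1 = Suc (CARD('n) + k - 2)" "m + CARD('n) - 1 = CARD('n) + k - 2"
    using Suc by linarith+
  have "(k + CARD('n) - 1) choose k = ((CARD('n) + k - 2) choose m) + ((CARD('n) + k - 2) choose k)"
    unfolding *(1) by (subst (1 3) Suc) (rule binomial_Suc_Suc)
  then have "int ((k + CARD('n) - 1) choose k) - int ((m + CARD('n) - 1) choose m) =
      int ((CARD('n) + k - 2) choose k)"
    unfolding *(2) by linarith
  then show ?thesis unfolding eq card_deg .
qed

lemma dim_homog: "dim (homog m :: (('n::finite \<Rightarrow> nat) \<Rightarrow> real) set) = card {\<alpha> :: 'n \<Rightarrow> nat. deg \<alpha> = m}"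
  unfolding homog_def by (rule dim_supported_on[OF finite_deg])

lemma dnum_eq: "dnum t m = card (in_box t m)"
  by (simp add: dnum_def in_box_def)

lemma finite_in_box: "finite (in_box t m)" and finite_off_box: "finite (off_box t m)"
  by (rule finite_subset[OF _ finite_deg[of m]]; auto simp: in_box_def off_box_def)+

lemma card_deg_split:
  fixes t :: "'n::finite \<Rightarrow> nat"
  shows "card {\<alpha> :: 'n \<Rightarrow> nat. deg \<alpha> = m} = dnum t m + card (off_box t m)"
proof -
  have eq: "{\<alpha>. deg \<alpha> = m} = in_box t m \<union> off_box t m" and disj: "in_box t m \<inter> off_box t m = {}"
    by (auto simp: in_box_def off_box_def not_less[symmetric] simp del: of_nat_sum)
  show ?thesis
    unfolding eq dnum_eq by (rule card_Un_disjoint[OF finite_in_box finite_off_box disj])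
qed

text \<open>Restriction to the exponents bounded by \<open>t\<close> maps the image of the lowering operator onto the image
  of the bounded part, which has full dimension by injectivity. The kernel of the restriction
  consists of all vectors supported on the unbounded exponents, since these all lie in the image.\<close>

lemma rank_lower_large:
  fixes t :: "'n::finite \<Rightarrow> nat"
  assumes m: "int (\<Sum>i\<in>UNIV. t i) < 2 * m"
  shows "dim (lower t ` homog m) = card (off_box t (m - 1)) + dnum t m"
proof -
  define r :: "(('n \<Rightarrow> nat) \<Rightarrow> real) \<Rightarrow> ('n \<Rightarrow> nat) \<Rightarrow> real"
    where "r v = (\<lambda>\<alpha>. if \<forall>i. \<alpha> i \<le> t i then v \<alpha> else 0)" for v
  have r: "linear r" by (rule linearI) (auto simp: r_def fun_eq_iff scaleR_fun_def)
  have r_box: "r v \<in> supported_on (in_box t l)" if "v \<in> homog l" for v l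
  proof -
    have "\<alpha> \<in> in_box t l" if "r v \<alpha> \<noteq> 0" for \<alpha>
      using that supported_onD[OF \<open>v \<in> homog l\<close>[unfolded homog_def], of \<alpha>]
      unfolding in_box_def r_def by (cases "deg \<alpha> = l") (auto split: if_splits)
    then show ?thesis unfolding supported_on_def by blast
  qed
  have r_id: "r v = v" if "v \<in> supported_on (in_box t l)" for v l
    using supported_onD[OF that] by (auto simp: r_def in_box_def fun_eq_iff)
  have r_0: "r v = 0" if "v \<in> supported_on (off_box t l)" for v l
    using supported_onD[OF that] by (auto simp: r_def off_box_def fun_eq_iff not_less)
  have r_ker: "v \<in> supported_on (off_box t l)" if "v \<in> homog l" "r v = 0" for v l
  proof -
    have "\<alpha> \<in> off_box t l" if "v \<alpha> \<noteq> 0" for \<alpha>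
    proof -
      have "deg \<alpha> = l" using that \<open>v \<in> homog l\<close> unfolding homog_def supported_on_def by blast
      moreover have "\<not> (\<forall>i. \<alpha> i \<le> t i)"
        using that fun_cong[OF \<open>r v = 0\<close>, of \<alpha>] by (simp add: r_def split: if_splits)
      ultimately show ?thesis unfolding off_box_def not_le[symmetric] by blast
    qed
    then show ?thesis unfolding supported_on_def by blast
  qed
  have box_homog: "supported_on (in_box t l) \<subseteq> homog l" for l
    unfolding homog_def by (rule subsetI, erule supported_on_mono[rotated]) (auto simp: in_box_def)
  have off_box_homog: "supported_on (off_box t l) \<subseteq> homog l" for l
    unfolding homog_def by (rule subsetI, erule supported_on_mono[rotated]) (auto simp: off_box_def)
  let ?W = "lower t ` homog m"
  have W: "subspace ?W" by (rule linear_subspace_image[OF linear_lower subspace_homog])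
  have W_sub: "?W \<subseteq> homog (m - 1)" using lower_homog by blast
  have span_homog: "span (unit_fun ` {\<alpha> :: 'n \<Rightarrow> nat. deg \<alpha> = l}) = homog l" for l
    unfolding homog_def by (rule span_unit_fun[OF finite_deg])
  have ker: "{w \<in> ?W. r w = 0} = supported_on (off_box t (m - 1))"
  proof (intro equalityI subsetI)
    fix w assume "w \<in> supported_on (off_box t (m - 1))"
    moreover from lower_off_box_surj[OF this] have "w \<in> ?W" using off_box_homog[of m] by auto
    ultimately show "w \<in> {w \<in> ?W. r w = 0}" using r_0 by blast
  qed (use r_ker W_sub in blast)
  have im: "r ` ?W = lower t ` supported_on (in_box t m)"
  proof -
    have "r (lower t v) = lower t (r v)" if v: "v \<in> homog m" for v
    proof -
      have "v - r v \<in> supported_on (off_box t m)"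
      proof (rule r_ker)
        show "v - r v \<in> homog m"
          by (rule subspace_diff[OF subspace_homog v subsetD[OF box_homog r_box[OF v]]])
        show "r (v - r v) = 0" by (simp add: linear_diff[OF r] r_id[OF r_box[OF v]])
      qed
      then have "r (lower t (v - r v)) = 0" by (rule r_0[OF lower_off_box])
      then have "r (lower t v) = r (lower t (r v))"
        by (simp add: linear_diff[OF r] linear_diff[OF linear_lower])
      also have "\<dots> = lower t (r v)" by (rule r_id[OF lower_in_box[OF r_box[OF v]]])
      finally show ?thesis .
    qed
    then have "r ` ?W = lower t ` r ` homog m" unfolding image_image by (rule image_cong[OF refl])
    also have "r ` homog m = supported_on (in_box t m)"
    proof
      show "supported_on (in_box t m) \<subseteq> r ` homog m"
      proof
        fix v assume v: "v \<in> supported_on (in_box t m)"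
        then show "v \<in> r ` homog m" using imageI[of v "homog m" r] box_homog[of m] r_id[OF v] by auto
      qed
    qed (use r_box in blast)
    finally show ?thesis .
  qed
  have "{v \<in> supported_on (in_box t m). lower t v = 0} = {0}"
  proof -
    have "v = 0" if v: "v \<in> supported_on (in_box t m)" "lower t v = 0" for v
    proof -
      have "v \<in> supported_on {\<alpha>. \<exists>i. t i < \<alpha> i}"
      proof (rule lower_inj_mod_off_box[OF m subsetD[OF box_homog v(1)]])
        show "lower t v \<in> supported_on {\<alpha>. \<exists>i. t i < \<alpha> i}"
          unfolding v(2) by (rule subspace_0[OF subspace_supported_on])
      qed
      then have "v \<in> supported_on (in_box t m \<inter> {\<alpha>. \<exists>i. t i < \<alpha> i})"
        using v(1) by (simp add: supported_on_Int)
      also have "in_box t m \<inter> {\<alpha>. \<exists>i. t i < \<alpha> i} = {}" unfolding in_box_def not_le[symmetric] by blast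
      finally show ?thesis by (simp add: supported_on_def fun_eq_iff)
    qed
    moreover have "0 \<in> supported_on (in_box t m)" by (rule subspace_0[OF subspace_supported_on])
    moreover have "lower t 0 = 0" by (rule linear_0[OF linear_lower])
    ultimately show ?thesis by blast
  qed
  moreover have "dim (supported_on (in_box t m)) =
      dim {v \<in> supported_on (in_box t m). lower t v = 0} + dim (lower t ` supported_on (in_box t m))"
    by (rule rank_nullity[OF linear_lower subspace_supported_on, of "unit_fun ` in_box t m"])
      (simp_all add: finite_in_box span_unit_fun)
  ultimately have "dim (lower t ` supported_on (in_box t m)) = dnum t m"
    using dim_span_eq_card_independent[OF independent_empty, where 'a = "('n \<Rightarrow> nat) \<Rightarrow> real"]
    unfolding dim_supported_on[OF finite_in_box] dnum_eq by simp
  moreover have "dim ?W = dim {w \<in> ?W. r w = 0} + dim (r ` ?W)"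
    by (rule rank_nullity[OF r W, of "unit_fun ` {\<alpha>. deg \<alpha> = m - 1}"])
      (simp_all only: finite_imageI finite_deg span_homog W_sub)
  ultimately show ?thesis
    unfolding ker im dim_supported_on[OF finite_off_box] by (simp only:)
qed

lemma independent_Un:
  fixes A B :: "'a::real_vector set"
  assumes A: "independent A" "finite A" and B: "independent B" "finite B"
    and disj: "span A \<inter> span B = {0}"
  shows "independent (A \<union> B)"
proof -
  have AB: "A \<inter> B = {}"
  proof -
    have "A \<inter> B \<subseteq> span A \<inter> span B" by (auto simp: span_base)
    then have "A \<inter> B \<subseteq> {0}" unfolding disj .
    moreover have "0 \<notin> A" using dependent_zero A(1) by blast
    ultimately show ?thesis by blast
  qed
  have "u v = 0" if u: "(\<Sum>v\<in>A \<union> B. u v *\<^sub>R v) = 0" and v: "v \<in> A \<union> B" for u v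
  proof -
    have sum: "(\<Sum>v\<in>A. u v *\<^sub>R v) = - (\<Sum>v\<in>B. u v *\<^sub>R v)"
      using u sum.union_disjoint[OF A(2) B(2) AB, of "\<lambda>v. u v *\<^sub>R v"] by (simp add: eq_neg_iff_add_eq_0)
    have spanA: "(\<Sum>v\<in>A. u v *\<^sub>R v) \<in> span A" and spanB: "(\<Sum>v\<in>B. u v *\<^sub>R v) \<in> span B"
      by (intro span_sum span_scale span_base, assumption)+
    have "(\<Sum>v\<in>A. u v *\<^sub>R v) \<in> span B" unfolding sum by (rule span_neg[OF spanB])
    with spanA have "(\<Sum>v\<in>A. u v *\<^sub>R v) \<in> span A \<inter> span B" by (rule IntI)
    then have zA: "(\<Sum>v\<in>A. u v *\<^sub>R v) = 0" unfolding disj by (rule singletonD)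
    then have zB: "(\<Sum>v\<in>B. u v *\<^sub>R v) = 0" using sum by simp
    from v show ?thesis
    proof
      assume "v \<in> A"
      then show ?thesis by (rule independentD[OF A order_refl zA])
    next
      assume "v \<in> B"
      then show ?thesis by (rule independentD[OF B order_refl zB])
    qed
  qed
  then show ?thesis
    by (rule independent_if_scalars_zero[OF finite_UnI[OF A(2) B(2)]])
qed

lemma homog_Int:
  assumes "v \<in> homog l" "v \<in> homog m" "l \<noteq> m"
  shows "v = 0"
proof
  fix \<alpha>
  show "v \<alpha> = 0 \<alpha>"
    using assms supported_onD[of v _ \<alpha>] unfolding homog_def by (cases "deg \<alpha> = l") auto
qed

text \<open>Bases that exhibit the kernel (\<open>K\<close>), the image (\<open>I\<close>) and a complement of the image (\<open>C\<close>) at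
  once. The kernel and the target have different degrees, hence the union is independent; this is
  what the first cohomology needs, where kernel and cokernel occur together.\<close>

lemma lower_bases:
  fixes t :: "'n::finite \<Rightarrow> nat" and m :: int
  obtains K I C where "finite K" "finite I" "finite C" "I \<inter> (K \<union> C) = {}" "K \<inter> C = {}"
    "independent (I \<union> (K \<union> C))"
    "span K = {v \<in> homog m. lower t v = 0}" "span I = lower t ` homog m"
    "span (I \<union> C) = homog (m - 1)"
    "card K + dim (lower t ` homog m) = card {\<alpha> :: 'n \<Rightarrow> nat. deg \<alpha> = m}"
    "card C + dim (lower t ` homog m) = card {\<alpha> :: 'n \<Rightarrow> nat. deg \<alpha> = m - 1}"
proof -
  let ?u = "\<lambda>l. unit_fun ` {\<alpha> :: 'n \<Rightarrow> nat. deg \<alpha> = l}"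
  let ?K = "{v \<in> homog m. lower t v = 0}" and ?W = "lower t ` homog m"
  have fin: "finite (?u l)" for l by (rule finite_imageI[OF finite_deg])
  have span_homog: "span (?u l) = homog l" for l
    unfolding homog_def by (rule span_unit_fun[OF finite_deg])
  have K: "subspace ?K"
    using subspace_homog[of m] linear_0[OF linear_lower, of t]
    by (auto simp: subspace_def linear_add[OF linear_lower] linear_scale[OF linear_lower])
  have W: "subspace ?W" by (rule linear_subspace_image[OF linear_lower subspace_homog])
  have W_sub: "?W \<subseteq> homog (m - 1)" using lower_homog by blast
  have "?K \<subseteq> span (?u m)" unfolding span_homog by blast
  from finite_basis_extension[OF fin this empty_subsetI independent_empty K]
  obtain Kb where Kb: "finite Kb" "independent Kb" "span Kb = ?K" "card Kb = dim ?K" by auto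
  have "?W \<subseteq> span (?u (m - 1))" unfolding span_homog by (rule W_sub)
  from finite_basis_extension[OF fin this empty_subsetI independent_empty W]
  obtain I where I: "finite I" "independent I" "span I = ?W" "card I = dim ?W" by auto
  have "I \<subseteq> homog (m - 1)" using span_superset[of I] I(3) W_sub by blast
  have "homog (m - 1) \<subseteq> span (?u (m - 1))" unfolding span_homog by (rule order_refl)
  then obtain C where C: "finite C" "finite I" "I \<inter> C = {}" "independent (I \<union> C)" "span (I \<union> C) = homog (m - 1)"
    "card I + card C = dim (homog (m - 1) :: (('n \<Rightarrow> nat) \<Rightarrow> real) set)"
    by (rule finite_basis_extension[OF fin _ \<open>I \<subseteq> homog (m - 1)\<close> I(2) subspace_homog])
  have "span Kb \<inter> span (I \<union> C) = {0}"
  proof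
    show "span Kb \<inter> span (I \<union> C) \<subseteq> {0}"
      unfolding Kb(3) C(5) using homog_Int[of _ m "m - 1"] by auto
  qed (simp add: span_zero)
  then have ind: "independent (Kb \<union> (I \<union> C))"
    by (intro independent_Un Kb(1,2) C(1,4) finite_UnI I(1))
  have disj: "Kb \<inter> (I \<union> C) = {}"
  proof -
    have "Kb \<inter> (I \<union> C) \<subseteq> span Kb \<inter> span (I \<union> C)"
      by (auto simp: span_base)
    then have "Kb \<inter> (I \<union> C) \<subseteq> {0}" unfolding \<open>span Kb \<inter> span (I \<union> C) = {0}\<close> .
    moreover have "0 \<notin> Kb" using dependent_zero Kb(2) by blast
    ultimately show ?thesis by blast
  qed
  have "homog m \<subseteq> span (?u m)" unfolding span_homog by (rule order_refl)
  then have rank: "dim (homog m :: (('n \<Rightarrow> nat) \<Rightarrow> real) set) = dim ?K + dim ?W"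
    by (rule rank_nullity[OF linear_lower subspace_homog fin])
  show ?thesis
  proof (rule that[of Kb I C])
    show "I \<inter> (Kb \<union> C) = {}" "Kb \<inter> C = {}" using disj C(3) by blast+
    have "I \<union> (Kb \<union> C) = Kb \<union> (I \<union> C)" by blast
    then show "independent (I \<union> (Kb \<union> C))" using ind by simp
    show "card Kb + dim ?W = card {\<alpha> :: 'n \<Rightarrow> nat. deg \<alpha> = m}"
      using rank Kb(4) unfolding dim_homog by linarith
    show "card C + dim ?W = card {\<alpha> :: 'n \<Rightarrow> nat. deg \<alpha> = m - 1}"
      using C(6) I(4) unfolding dim_homog by linarith
    show "finite Kb" by (rule Kb(1))
    show "finite I" by (rule I(1))
    show "finite C" by (rule C(1))
    show "span Kb = ?K" by (rule Kb(3))
    show "span I = ?W" by (rule I(3))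
    show "span (I \<union> C) = homog (m - 1)" by (rule C(5))
  qed
qed

section \<open>Cochains on the projective algebra in coordinates\<close>

text \<open>The coefficients of the polynomial \<open>h\<close>, expressed by values of \<open>h\<close> in order to be defined and
  linear for all functions.\<close>

definition c0 :: "(real \<Rightarrow> real) \<Rightarrow> real" where "c0 h = h 0"
definition c1 :: "(real \<Rightarrow> real) \<Rightarrow> real" where "c1 h = (h 1 - h (-1)) / 2"
definition c2 :: "(real \<Rightarrow> real) \<Rightarrow> real" where "c2 h = (h 1 + h (-1)) / 2 - h 0"

lemmas c_defs = c0_def c1_def c2_def

definition e0 :: "real \<Rightarrow> real" where "e0 = (\<lambda>x. 1)"
definition e1 :: "real \<Rightarrow> real" where "e1 = (\<lambda>x. x)"
definition e2 :: "real \<Rightarrow> real" where "e2 = (\<lambda>x. x\<^sup>2)"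

lemmas e_defs = e0_def e1_def e2_def

lemma c_basis [simp]:
  "c0 e0 = 1" "c1 e0 = 0" "c2 e0 = 0"
  "c0 e1 = 0" "c1 e1 = 1" "c2 e1 = 0"
  "c0 e2 = 0" "c1 e2 = 0" "c2 e2 = 1"
  by (simp_all add: c_defs e_defs)

lemma c_linear [simp]:
  "c0 (g + h) = c0 g + c0 h" "c1 (g + h) = c1 g + c1 h" "c2 (g + h) = c2 g + c2 h"
  "c0 (a *\<^sub>R h) = a * c0 h" "c1 (a *\<^sub>R h) = a * c1 h" "c2 (a *\<^sub>R h) = a * c2 h"
  unfolding c_defs scaleR_fun_def plus_fun_apply real_scaleR_def by argo+

lemma sl2_eq: "sl2 = span {e0, e1, e2}"
  by (simp add: sl2_def e_defs)

lemma c_eval: "h \<in> sl2 \<Longrightarrow> h x = c0 h + c1 h * x + c2 h * x\<^sup>2"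
  unfolding sl2_eq
proof (induction rule: span_induct_alt)
  case base
  then show ?case by (simp add: c_defs)
next
  case (step c g h)
  have "g x = c0 g + c1 g * x + c2 g * x\<^sup>2" using step(1) by (auto simp: e_defs c_defs)
  then have "(c *\<^sub>R g + h) x =
      c * (c0 g + c1 g * x + c2 g * x\<^sup>2) + (c0 h + c1 h * x + c2 h * x\<^sup>2)"
    using step(2) by (simp only: scaleR_fun_def plus_fun_apply real_scaleR_def)
  also have "\<dots> = c0 (c *\<^sub>R g + h) + c1 (c *\<^sub>R g + h) * x + c2 (c *\<^sub>R g + h) * x\<^sup>2"
    unfolding c_linear by (simp add: algebra_simps)
  finally show ?case .
qed

lemma e_sl2: "e0 \<in> sl2" "e1 \<in> sl2" "e2 \<in> sl2"
  unfolding sl2_eq by (simp_all add: span_base)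

lemma subspace_sl2: "subspace sl2"
  unfolding sl2_eq by (rule subspace_span)

lemma sl2_poly: "(\<lambda>x. a + b * x + c * x\<^sup>2) \<in> sl2"
proof -
  have "a *\<^sub>R e0 + b *\<^sub>R e1 + c *\<^sub>R e2 \<in> sl2"
    using e_sl2 by (intro subspace_add[OF subspace_sl2] subspace_scale[OF subspace_sl2])
  also have "a *\<^sub>R e0 + b *\<^sub>R e1 + c *\<^sub>R e2 = (\<lambda>x. a + b * x + c * x\<^sup>2)"
    by (simp add: scaleR_fun_def fun_eq_iff e_defs)
  finally show ?thesis .
qed

lemma c_poly: "c0 (\<lambda>x. a + b * x + c * x\<^sup>2) = a" "c1 (\<lambda>x. a + b * x + c * x\<^sup>2) = b"
    "c2 (\<lambda>x. a + b * x + c * x\<^sup>2) = c"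
  by (simp_all add: c_defs field_simps)

lemma sl2_expand:
  assumes "h \<in> sl2"
  shows "h = c0 h *\<^sub>R e0 + c1 h *\<^sub>R e1 + c2 h *\<^sub>R e2"
proof
  fix x show "h x = (c0 h *\<^sub>R e0 + c1 h *\<^sub>R e1 + c2 h *\<^sub>R e2) x"
    by (simp add: scaleR_fun_def e_defs c_eval[OF assms, of x])
qed

lemma sl2_deriv:
  assumes "h \<in> sl2"
  shows "(h has_field_derivative c1 h + 2 * c2 h * x) (at x)"
proof -
  have "h = (\<lambda>x. c0 h + c1 h * x + c2 h * x\<^sup>2)" using c_eval[OF assms] by (rule ext)
  moreover have "((\<lambda>x. c0 h + c1 h * x + c2 h * x\<^sup>2) has_field_derivative c1 h + 2 * c2 h * x) (at x)"
    by (auto intro!: derivative_eq_intros)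
  ultimately show ?thesis by simp
qed

lemma vf_bracket_sl2:
  assumes "g \<in> sl2" "h \<in> sl2"
  shows "vf_bracket g h = (\<lambda>x. (c0 g * c1 h - c1 g * c0 h) + 2 * (c0 g * c2 h - c2 g * c0 h) * x +
    (c1 g * c2 h - c2 g * c1 h) * x\<^sup>2)"
proof
  fix x
  have "vf_bracket g h x = g x * (c1 h + 2 * c2 h * x) - h x * (c1 g + 2 * c2 g * x)"
    unfolding vf_bracket_def by (simp add: DERIV_imp_deriv[OF sl2_deriv] assms)
  then show "vf_bracket g h x = (c0 g * c1 h - c1 g * c0 h) + 2 * (c0 g * c2 h - c2 g * c0 h) * x +
    (c1 g * c2 h - c2 g * c1 h) * x\<^sup>2"
    unfolding c_eval[OF assms(1), of x] c_eval[OF assms(2), of x]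
    by (simp add: algebra_simps power2_eq_square)
qed

lemma vf_bracket_coords:
  assumes "g \<in> sl2" "h \<in> sl2"
  shows "vf_bracket g h \<in> sl2" "c0 (vf_bracket g h) = c0 g * c1 h - c1 g * c0 h"
    "c1 (vf_bracket g h) = 2 * (c0 g * c2 h - c2 g * c0 h)"
    "c2 (vf_bracket g h) = c1 g * c2 h - c2 g * c1 h"
  unfolding vf_bracket_sl2[OF assms] by (rule sl2_poly c_poly)+

text \<open>Alternating maps on the three-dimensional algebra, given by their values on the basis: the
  coefficients are the minors of the coordinates of the arguments.\<close>

definition cochain0 :: "'m::real_vector \<Rightarrow> (real \<Rightarrow> real) list \<Rightarrow> 'm" where
  "cochain0 A = (\<lambda>xs. if xs = [] then A else 0)"

definition cochain1 :: "'m::real_vector \<Rightarrow> 'm \<Rightarrow> 'm \<Rightarrow> (real \<Rightarrow> real) list \<Rightarrow> 'm" where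
  "cochain1 A B C = (\<lambda>xs. if length xs = 1 \<and> set xs \<subseteq> sl2
     then c0 (xs ! 0) *\<^sub>R A + c1 (xs ! 0) *\<^sub>R B + c2 (xs ! 0) *\<^sub>R C else 0)"

definition cochain2 :: "'m::real_vector \<Rightarrow> 'm \<Rightarrow> 'm \<Rightarrow> (real \<Rightarrow> real) list \<Rightarrow> 'm" where
  "cochain2 A B C = (\<lambda>xs. if length xs = 2 \<and> set xs \<subseteq> sl2 then
     (c0 (xs ! 0) * c1 (xs ! 1) - c1 (xs ! 0) * c0 (xs ! 1)) *\<^sub>R A +
     (c0 (xs ! 0) * c2 (xs ! 1) - c2 (xs ! 0) * c0 (xs ! 1)) *\<^sub>R B +
     (c1 (xs ! 0) * c2 (xs ! 1) - c2 (xs ! 0) * c1 (xs ! 1)) *\<^sub>R C else 0)"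

definition cochain3 :: "'m::real_vector \<Rightarrow> (real \<Rightarrow> real) list \<Rightarrow> 'm" where
  "cochain3 A = (\<lambda>xs. if length xs = 3 \<and> set xs \<subseteq> sl2 then
     (c0 (xs ! 0) * (c1 (xs ! 1) * c2 (xs ! 2) - c2 (xs ! 1) * c1 (xs ! 2))
      - c1 (xs ! 0) * (c0 (xs ! 1) * c2 (xs ! 2) - c2 (xs ! 1) * c0 (xs ! 2))
      + c2 (xs ! 0) * (c0 (xs ! 1) * c1 (xs ! 2) - c1 (xs ! 1) * c0 (xs ! 2))) *\<^sub>R A else 0)"

lemma length_1_conv: "length xs = Suc 0 \<longleftrightarrow> (\<exists>x. xs = [x])"
  by (auto simp: length_Suc_conv)
lemma length_2_conv: "length xs = 2 \<longleftrightarrow> (\<exists>x y. xs = [x, y])"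
  by (auto simp: length_Suc_conv numeral_2_eq_2)
lemma length_3_conv: "length xs = 3 \<longleftrightarrow> (\<exists>x y z. xs = [x, y, z])"
  by (auto simp: length_Suc_conv numeral_3_eq_3)

lemma cochain_eval:
  "cochain0 A [] = A"
  "g \<in> sl2 \<Longrightarrow> cochain1 A B C [g] = c0 g *\<^sub>R A + c1 g *\<^sub>R B + c2 g *\<^sub>R C"
  "g \<in> sl2 \<Longrightarrow> h \<in> sl2 \<Longrightarrow> cochain2 A B C [g, h] = (c0 g * c1 h - c1 g * c0 h) *\<^sub>R A +
     (c0 g * c2 h - c2 g * c0 h) *\<^sub>R B + (c1 g * c2 h - c2 g * c1 h) *\<^sub>R C"
  by (simp_all add: cochain0_def cochain1_def cochain2_def)

lemma cochain_basis:
  "cochain1 A B C [e0] = A" "cochain1 A B C [e1] = B" "cochain1 A B C [e2] = C"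
  "cochain2 A B C [e0, e1] = A" "cochain2 A B C [e0, e2] = B" "cochain2 A B C [e1, e2] = C"
  by (simp_all add: cochain_eval e_sl2)

lemma cochain3_basis: "cochain3 A [e0, e1, e2] = A"
  by (simp add: cochain3_def e_sl2)

lemma ce_cochains_closed:
    "w \<in> ce_cochains g M j \<Longrightarrow> length xs = j \<Longrightarrow> set xs \<subseteq> g \<Longrightarrow> w xs \<in> M"
  and ce_cochains_outside:
    "w \<in> ce_cochains g M j \<Longrightarrow> \<not> (length xs = j \<and> set xs \<subseteq> g) \<Longrightarrow> w xs = 0"
  and ce_cochains_multilinear:
    "w \<in> ce_cochains g M j \<Longrightarrow> length xs = j \<Longrightarrow> set xs \<subseteq> g \<Longrightarrow> i < j \<Longrightarrow>
      (\<forall>x\<in>g. \<forall>y\<in>g. w (xs[i := x + y]) = w (xs[i := x]) + w (xs[i := y])) \<and>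
      (\<forall>c. \<forall>x\<in>g. w (xs[i := c *\<^sub>R x]) = c *\<^sub>R w (xs[i := x]))"
  unfolding ce_cochains_def mem_Collect_eq by simp_all

lemma ce_cochains_alternating:
  assumes "w \<in> ce_cochains g M j"
    and "length xs = j \<and> set xs \<subseteq> g \<and> i < l \<and> l < j \<and> xs ! i = xs ! l"
  shows "w xs = 0"
  by (rule assms(1)[unfolded ce_cochains_def mem_Collect_eq, THEN conjunct2, THEN conjunct2,
        THEN conjunct2, rule_format, OF assms(2)])

lemma ce_cochainsI:
  assumes "\<And>xs. w xs \<in> M"
    and "\<And>xs. \<not> (length xs = j \<and> set xs \<subseteq> g) \<Longrightarrow> w xs = 0"
    and "\<And>xs i. length xs = j \<and> set xs \<subseteq> g \<and> i < j \<Longrightarrow>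
      (\<forall>x\<in>g. \<forall>y\<in>g. w (xs[i := x + y]) = w (xs[i := x]) + w (xs[i := y])) \<and>
      (\<forall>c. \<forall>x\<in>g. w (xs[i := c *\<^sub>R x]) = c *\<^sub>R w (xs[i := x]))"
    and "\<And>xs i l. length xs = j \<and> set xs \<subseteq> g \<and> i < l \<and> l < j \<and> xs ! i = xs ! l \<Longrightarrow> w xs = 0"
  shows "w \<in> ce_cochains g M j"
  unfolding ce_cochains_def mem_Collect_eq
proof (intro conjI)
  show "\<forall>xs. length xs = j \<and> set xs \<subseteq> g \<longrightarrow> w xs \<in> M"
    by (intro allI impI assms(1))
  show "\<forall>xs. \<not> (length xs = j \<and> set xs \<subseteq> g) \<longrightarrow> w xs = 0"
    by (intro allI impI, rule assms(2))
  show "\<forall>xs i. length xs = j \<and> set xs \<subseteq> g \<and> i < j \<longrightarrow>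
      (\<forall>x\<in>g. \<forall>y\<in>g. w (xs[i := x + y]) = w (xs[i := x]) + w (xs[i := y])) \<and>
      (\<forall>c. \<forall>x\<in>g. w (xs[i := c *\<^sub>R x]) = c *\<^sub>R w (xs[i := x]))"
    by (intro allI, rule impI, rule assms(3))
  show "\<forall>xs i l. length xs = j \<and> set xs \<subseteq> g \<and> i < l \<and> l < j \<and> xs ! i = xs ! l \<longrightarrow> w xs = 0"
    by (intro allI, rule impI, rule assms(4))
qed

lemma ce_cochains_0:
  "ce_cochains sl2 M 0 = cochain0 ` M"
proof (intro equalityI subsetI)
  fix w assume "w \<in> ce_cochains sl2 M 0"
  then have "w [] \<in> M" "\<forall>xs. xs \<noteq> [] \<longrightarrow> w xs = 0" by (auto simp: ce_cochains_def)
  then have "w = cochain0 (w [])" "w [] \<in> M" by (auto simp: cochain0_def fun_eq_iff)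
  then show "w \<in> cochain0 ` M" by blast
qed (auto simp: ce_cochains_def cochain0_def)

lemma cochain1_linear:
  assumes "f \<in> sl2" "g \<in> sl2"
  shows "cochain1 A B C [f + g] = cochain1 A B C [f] + cochain1 A B C [g]"
    "cochain1 A B C [a *\<^sub>R f] = a *\<^sub>R cochain1 A B C [f]"
proof -
  show "cochain1 A B C [f + g] = cochain1 A B C [f] + cochain1 A B C [g]"
    unfolding cochain_eval(2)[OF subspace_add[OF subspace_sl2 assms]] cochain_eval(2)[OF assms(1)]
      cochain_eval(2)[OF assms(2)] c_linear
    by (simp add: algebra_simps)
  show "cochain1 A B C [a *\<^sub>R f] = a *\<^sub>R cochain1 A B C [f]"
    unfolding cochain_eval(2)[OF subspace_scale[OF subspace_sl2 assms(1)]]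
      cochain_eval(2)[OF assms(1)] c_linear
    by (simp add: algebra_simps)
qed

lemma ce_cochains_1:
  assumes M: "subspace M"
  shows "ce_cochains sl2 M 1 = {cochain1 A B C |A B C. A \<in> M \<and> B \<in> M \<and> C \<in> M}"
proof (intro equalityI subsetI)
  fix w assume w: "w \<in> ce_cochains sl2 M 1"
  have mem: "w [g] \<in> M" if "g \<in> sl2" for g
    by (rule ce_cochains_closed[OF w]) (use that in simp_all)
  note multi = ce_cochains_multilinear[OF w]
  have add: "w [g + h] = w [g] + w [h]" if "g \<in> sl2" "h \<in> sl2" for g h
    using multi[of "[g]" 0] that by auto
  have scale: "w [a *\<^sub>R g] = a *\<^sub>R w [g]" if "g \<in> sl2" for g a
    using multi[of "[g]" 0] that by auto
  note zero = ce_cochains_outside[OF w]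
  have "w xs = cochain1 (w [e0]) (w [e1]) (w [e2]) xs" for xs
  proof (cases "length xs = 1 \<and> set xs \<subseteq> sl2")
    case True
    then obtain g where g: "xs = [g]" "g \<in> sl2" by (auto simp: length_1_conv)
    have "w [c0 g *\<^sub>R e0 + c1 g *\<^sub>R e1 + c2 g *\<^sub>R e2] =
        c0 g *\<^sub>R w [e0] + c1 g *\<^sub>R w [e1] + c2 g *\<^sub>R w [e2]"
      by (simp add: add scale e_sl2 subspace_add[OF subspace_sl2] subspace_scale[OF subspace_sl2])
    then show ?thesis
      unfolding g(1) cochain_eval(2)[OF g(2)] sl2_expand[OF g(2), symmetric] .
  next
    case False
    show ?thesis unfolding cochain1_def by (simp only: zero[OF False] if_not_P[OF False])
  qed
  then have "w = cochain1 (w [e0]) (w [e1]) (w [e2])" by (rule ext)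
  then show "w \<in> {cochain1 A B C |A B C. A \<in> M \<and> B \<in> M \<and> C \<in> M}"
    using mem e_sl2 by blast
next
  fix w assume "w \<in> {cochain1 A B C |A B C. A \<in> M \<and> B \<in> M \<and> C \<in> M}"
  then obtain A B C where w: "w = cochain1 A B C" "A \<in> M" "B \<in> M" "C \<in> M" by blast
  have "w xs \<in> M" for xs
    using w(2-) unfolding w(1) cochain1_def
    by (auto intro!: subspace_add[OF M] subspace_scale[OF M] subspace_0[OF M])
  moreover have "w xs = 0" if "\<not> (length xs = 1 \<and> set xs \<subseteq> sl2)" for xs
    unfolding w(1) cochain1_def by (simp only: if_not_P[OF that])
  moreover have "(\<forall>x\<in>sl2. \<forall>y\<in>sl2. w (xs[i := x + y]) = w (xs[i := x]) + w (xs[i := y])) \<and>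
        (\<forall>c. \<forall>x\<in>sl2. w (xs[i := c *\<^sub>R x]) = c *\<^sub>R w (xs[i := x]))"
    if xs: "length xs = 1 \<and> set xs \<subseteq> sl2 \<and> i < 1" for xs i
  proof -
    from xs obtain g where "xs = [g]" "i = 0" by (auto simp: length_1_conv)
    then show ?thesis
      unfolding w(1) by (simp add: cochain1_linear)
  qed
  moreover have "w xs = 0" if "length xs = 1 \<and> set xs \<subseteq> sl2 \<and> i < l \<and> l < 1 \<and> xs ! i = xs ! l" for xs i l
    using that by auto
  ultimately show "w \<in> ce_cochains sl2 M 1" by (rule ce_cochainsI)
qed

lemma cochain2_bilinear:
  assumes "f \<in> sl2" "g \<in> sl2" "h \<in> sl2"
  shows "cochain2 A B C [f + g, h] = cochain2 A B C [f, h] + cochain2 A B C [g, h]"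
    "cochain2 A B C [h, f + g] = cochain2 A B C [h, f] + cochain2 A B C [h, g]"
    "cochain2 A B C [a *\<^sub>R f, h] = a *\<^sub>R cochain2 A B C [f, h]"
    "cochain2 A B C [h, a *\<^sub>R f] = a *\<^sub>R cochain2 A B C [h, f]"
proof -
  note fg = subspace_add[OF subspace_sl2 assms(1,2)] subspace_scale[OF subspace_sl2 assms(1), of a]
  show "cochain2 A B C [f + g, h] = cochain2 A B C [f, h] + cochain2 A B C [g, h]"
    unfolding cochain_eval(3)[OF fg(1) assms(3)] cochain_eval(3)[OF assms(1,3)]
      cochain_eval(3)[OF assms(2,3)] c_linear
    by (simp add: algebra_simps)
  show "cochain2 A B C [h, f + g] = cochain2 A B C [h, f] + cochain2 A B C [h, g]"
    unfolding cochain_eval(3)[OF assms(3) fg(1)] cochain_eval(3)[OF assms(3,1)]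
      cochain_eval(3)[OF assms(3,2)] c_linear
    by (simp add: algebra_simps)
  show "cochain2 A B C [a *\<^sub>R f, h] = a *\<^sub>R cochain2 A B C [f, h]"
    unfolding cochain_eval(3)[OF fg(2) assms(3)] cochain_eval(3)[OF assms(1,3)] c_linear
    by (simp add: algebra_simps)
  show "cochain2 A B C [h, a *\<^sub>R f] = a *\<^sub>R cochain2 A B C [h, f]"
    unfolding cochain_eval(3)[OF assms(3) fg(2)] cochain_eval(3)[OF assms(3,1)] c_linear
    by (simp add: algebra_simps)
qed

lemma ce_cochains_2:
  assumes M: "subspace M"
  shows "ce_cochains sl2 M 2 = {cochain2 A B C |A B C. A \<in> M \<and> B \<in> M \<and> C \<in> M}"
proof (intro equalityI subsetI)
  fix w assume w: "w \<in> ce_cochains sl2 M 2"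
  have mem: "w [g, h] \<in> M" if "g \<in> sl2" "h \<in> sl2" for g h
    by (rule ce_cochains_closed[OF w]) (use that in simp_all)
  note multi = ce_cochains_multilinear[OF w]
  note alternating = ce_cochains_alternating[OF w]
  have left: "w [g + g', h] = w [g, h] + w [g', h]" and right: "w [h, g + g'] = w [h, g] + w [h, g']"
    if "g \<in> sl2" "g' \<in> sl2" "h \<in> sl2" for g g' h
    using multi[of "[g, h]" 0] multi[of "[h, g]" 1] that by auto
  have left_scale: "w [a *\<^sub>R g, h] = a *\<^sub>R w [g, h]" and right_scale: "w [h, a *\<^sub>R g] = a *\<^sub>R w [h, g]"
    if "g \<in> sl2" "h \<in> sl2" for g h a
    using multi[of "[g, h]" 0] multi[of "[h, g]" 1] that by auto
  have alt: "w [g, g] = 0" if "g \<in> sl2" for g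
    using alternating[of "[g, g]" 0 1] that by simp
  have anti: "w [h, g] = - w [g, h]" if gh: "g \<in> sl2" "h \<in> sl2" for g h
  proof -
    have s: "g + h \<in> sl2" by (intro subspace_add[OF subspace_sl2] gh)
    have "w [g + h, g + h] = (w [g, g] + w [g, h]) + (w [h, g] + w [h, h])"
      unfolding left[OF gh s] right[OF gh gh(1)] right[OF gh gh(2)] ..
    then have "w [h, g] + w [g, h] = 0"
      unfolding alt[OF s] alt[OF gh(1)] alt[OF gh(2)] by (simp add: add.commute)
    then show ?thesis by (simp only: eq_neg_iff_add_eq_0)
  qed
  note zero = ce_cochains_outside[OF w]
  have "w xs = cochain2 (w [e0, e1]) (w [e0, e2]) (w [e1, e2]) xs" for xs
  proof (cases "length xs = 2 \<and> set xs \<subseteq> sl2")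
    case True
    then obtain g h where gh: "xs = [g, h]" "g \<in> sl2" "h \<in> sl2" by (auto simp: length_2_conv)
    have R: "w [f, h] = c0 h *\<^sub>R w [f, e0] + c1 h *\<^sub>R w [f, e1] + c2 h *\<^sub>R w [f, e2]" if "f \<in> sl2" for f
    proof -
      have "w [f, c0 h *\<^sub>R e0 + c1 h *\<^sub>R e1 + c2 h *\<^sub>R e2] =
          c0 h *\<^sub>R w [f, e0] + c1 h *\<^sub>R w [f, e1] + c2 h *\<^sub>R w [f, e2]"
        using that by (simp add: right right_scale e_sl2 subspace_add[OF subspace_sl2] subspace_scale[OF subspace_sl2])
      then show ?thesis unfolding sl2_expand[OF gh(3), symmetric] .
    qed
    have L: "w [g, f] = c0 g *\<^sub>R w [e0, f] + c1 g *\<^sub>R w [e1, f] + c2 g *\<^sub>R w [e2, f]" if "f \<in> sl2" for f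
    proof -
      have "w [c0 g *\<^sub>R e0 + c1 g *\<^sub>R e1 + c2 g *\<^sub>R e2, f] =
          c0 g *\<^sub>R w [e0, f] + c1 g *\<^sub>R w [e1, f] + c2 g *\<^sub>R w [e2, f]"
        using that by (simp add: left left_scale e_sl2 subspace_add[OF subspace_sl2] subspace_scale[OF subspace_sl2])
      then show ?thesis unfolding sl2_expand[OF gh(2), symmetric] .
    qed
    have "w [g, h] = cochain2 (w [e0, e1]) (w [e0, e2]) (w [e1, e2]) [g, h]"
      unfolding L[OF gh(3)] R[OF e_sl2(1)] R[OF e_sl2(2)] R[OF e_sl2(3)] cochain_eval(3)[OF gh(2,3)]
        alt[OF e_sl2(1)] alt[OF e_sl2(2)] alt[OF e_sl2(3)]
        anti[OF e_sl2(1,2)] anti[OF e_sl2(1,3)] anti[OF e_sl2(2,3)]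
      by (simp add: algebra_simps)
    then show ?thesis unfolding gh(1) .
  next
    case False
    show ?thesis unfolding cochain2_def by (simp only: zero[OF False] if_not_P[OF False])
  qed
  then have "w = cochain2 (w [e0, e1]) (w [e0, e2]) (w [e1, e2])" by (rule ext)
  then show "w \<in> {cochain2 A B C |A B C. A \<in> M \<and> B \<in> M \<and> C \<in> M}"
    using mem e_sl2 by blast
next
  fix w assume "w \<in> {cochain2 A B C |A B C. A \<in> M \<and> B \<in> M \<and> C \<in> M}"
  then obtain A B C where w: "w = cochain2 A B C" "A \<in> M" "B \<in> M" "C \<in> M" by blast
  have "w xs \<in> M" for xs
    using w(2-) unfolding w(1) cochain2_def
    by (auto intro!: subspace_add[OF M] subspace_scale[OF M] subspace_0[OF M])
  moreover have "w xs = 0" if "\<not> (length xs = 2 \<and> set xs \<subseteq> sl2)" for xs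
    unfolding w(1) cochain2_def by (simp only: if_not_P[OF that])
  moreover have "(\<forall>x\<in>sl2. \<forall>y\<in>sl2. w (xs[i := x + y]) = w (xs[i := x]) + w (xs[i := y])) \<and>
        (\<forall>c. \<forall>x\<in>sl2. w (xs[i := c *\<^sub>R x]) = c *\<^sub>R w (xs[i := x]))"
    if xs: "length xs = 2 \<and> set xs \<subseteq> sl2 \<and> i < 2" for xs i
  proof -
    from xs obtain g h where gh: "xs = [g, h]" "g \<in> sl2" "h \<in> sl2" by (auto simp: length_2_conv)
    from xs have "i < 2" by (elim conjE)
    then have "i = 0 \<or> i = 1" by linarith
    then show ?thesis
    proof
      assume i: "i = 0"
      show ?thesis
        unfolding gh(1) w(1) i using gh(2,3) by (simp add: cochain2_bilinear)
    next
      assume i: "i = 1"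
      show ?thesis
        unfolding gh(1) w(1) i using gh(2,3) by (simp add: cochain2_bilinear)
    qed
  qed
  moreover have "w xs = 0" if "length xs = 2 \<and> set xs \<subseteq> sl2 \<and> i < l \<and> l < 2 \<and> xs ! i = xs ! l" for xs i l
  proof -
    have il: "i = 0" "l = 1" using that by auto
    from that obtain g h where gh: "xs = [g, h]" "g \<in> sl2" "h \<in> sl2" by (auto simp: length_2_conv)
    have "g = h" using that unfolding il gh(1) by simp
    then show ?thesis using gh(2,3) unfolding w(1) gh(1) by (simp add: cochain_eval)
  qed
  ultimately show "w \<in> ce_cochains sl2 M 2" by (rule ce_cochainsI)
qed

section \<open>Homogeneous parts\<close>

definition part :: "int \<Rightarrow> (('n::finite \<Rightarrow> nat) \<Rightarrow> real) \<Rightarrow> ('n \<Rightarrow> nat) \<Rightarrow> real" where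
  "part m v = (\<lambda>\<alpha>. if deg \<alpha> = m then v \<alpha> else 0)"

lemma linear_part: "linear (part m)"
  by (rule linearI) (simp_all add: part_def fun_eq_iff scaleR_fun_def)

lemma part_homog: "part m v \<in> homog m"
  by (simp add: part_def homog_def supported_on_def)

lemma part_id: "v \<in> homog m \<Longrightarrow> part m v = v"
  using supported_onD[of v "{\<alpha>. deg \<alpha> = m}"] by (auto simp: part_def homog_def fun_eq_iff simp del: of_nat_sum)

lemma part_other: "v \<in> homog l \<Longrightarrow> l \<noteq> m \<Longrightarrow> part m v = 0"
  using supported_onD[of v "{\<alpha>. deg \<alpha> = l}"] by (auto simp: part_def homog_def fun_eq_iff simp del: of_nat_sum)

lemma lower_cong_deg:
  assumes "\<And>\<beta>. deg \<beta> = deg \<alpha> + 1 \<Longrightarrow> v \<beta> = w \<beta>"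
  shows "lower t v \<alpha> = lower t w \<alpha>"
  unfolding lower_def by (intro sum.cong refl arg_cong2[of _ _ _ _ "(*)"] assms deg_incr)

lemma lower_scale_deg:
  assumes "\<And>\<beta>. deg \<beta> = deg \<alpha> + 1 \<Longrightarrow> v \<beta> = c * w \<beta>"
  shows "lower t v \<alpha> = c * lower t w \<alpha>"
proof -
  have "lower t v \<alpha> = lower t (c *\<^sub>R w) \<alpha>"
    by (rule lower_cong_deg) (simp add: assms scaleR_fun_def del: of_nat_sum)
  then show ?thesis by (simp add: linear_scale[OF linear_lower]) (simp add: scaleR_fun_def)
qed

lemma part_lower: "part m (lower t v) = lower t (part (m + 1) v)"
proof
  fix \<alpha>
  show "part m (lower t v) \<alpha> = lower t (part (m + 1) v) \<alpha>"
  proof (cases "deg \<alpha> = m")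
    case True
    then have "part m (lower t v) \<alpha> = lower t v \<alpha>" by (simp add: part_def del: of_nat_sum)
    also have "\<dots> = lower t (part (m + 1) v) \<alpha>"
      by (rule lower_cong_deg) (simp add: part_def True del: of_nat_sum)
    finally show ?thesis .
  next
    case False
    have "lower t (part (m + 1) v) \<in> homog m" using lower_homog[OF part_homog, of t "m + 1" v] by simp
    then have "lower t (part (m + 1) v) \<alpha> = 0"
      unfolding homog_def by (rule supported_onD) (use False in simp)
    then show ?thesis using False by (simp add: part_def del: of_nat_sum)
  qed
qed

text \<open>For \<open>c = k\<close>, the isotropy action of \<open>x d/dx\<close>.\<close>

definition euler :: "real \<Rightarrow> (('n::finite \<Rightarrow> nat) \<Rightarrow> real) \<Rightarrow> ('n \<Rightarrow> nat) \<Rightarrow> real" where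
  "euler c v = (\<lambda>\<alpha>. (c - real_of_int (deg \<alpha>)) * v \<alpha>)"

definition finite_support :: "('a \<Rightarrow> real) set" where
  "finite_support = {v. finite {a. v a \<noteq> 0}}"

lemma finite_supportI:
  assumes "v \<in> finite_support" "\<And>a. v a = 0 \<Longrightarrow> w a = 0"
  shows "w \<in> finite_support"
  using assms unfolding finite_support_def by (auto elim!: rev_finite_subset)

lemma homog_finite_support:
  assumes "v \<in> homog m"
  shows "v \<in> finite_support"
proof -
  have "{a. v a \<noteq> 0} \<subseteq> {\<alpha>. deg \<alpha> = m}" using assms unfolding homog_def supported_on_def by blast
  then have "finite {a. v a \<noteq> 0}" by (rule finite_subset[OF _ finite_deg])
  then show ?thesis by (simp add: finite_support_def)
qed

lemma finite_support_add:
  assumes "v \<in> finite_support" "w \<in> finite_support"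
  shows "v + w \<in> finite_support"
proof -
  have "{a. (v + w) a \<noteq> 0} \<subseteq> {a. v a \<noteq> 0} \<union> {a. w a \<noteq> 0}" by auto
  moreover have "finite ({a. v a \<noteq> 0} \<union> {a. w a \<noteq> 0})" using assms by (simp add: finite_support_def)
  ultimately have "finite {a. (v + w) a \<noteq> 0}" by (rule finite_subset)
  then show ?thesis unfolding finite_support_def by simp
qed

lemma cochain_add:
  "cochain0 A + cochain0 A' = cochain0 (A + A')"
  "cochain1 A B C + cochain1 A' B' C' = cochain1 (A + A') (B + B') (C + C')"
  "cochain2 A B C + cochain2 A' B' C' = cochain2 (A + A') (B + B') (C + C')"
proof -
  show "cochain0 A + cochain0 A' = cochain0 (A + A')"
    by (rule ext) (simp add: cochain0_def)
  have "cochain1 A B C xs + cochain1 A' B' C' xs = cochain1 (A + A') (B + B') (C + C') xs" for xs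
    unfolding cochain1_def by (simp add: algebra_simps)
  then show "cochain1 A B C + cochain1 A' B' C' = cochain1 (A + A') (B + B') (C + C')"
    by (intro ext) (simp only: plus_fun_apply)
  have "cochain2 A B C xs + cochain2 A' B' C' xs = cochain2 (A + A') (B + B') (C + C') xs" for xs
    unfolding cochain2_def by (simp add: scaleR_right_distrib)
  then show "cochain2 A B C + cochain2 A' B' C' = cochain2 (A + A') (B + B') (C + C')"
    by (intro ext) (simp only: plus_fun_apply)
qed

lemma cochain_scale:
  "r *\<^sub>R cochain0 A = cochain0 (r *\<^sub>R A)"
  "r *\<^sub>R cochain1 A B C = cochain1 (r *\<^sub>R A) (r *\<^sub>R B) (r *\<^sub>R C)"
  "r *\<^sub>R cochain2 A B C = cochain2 (r *\<^sub>R A) (r *\<^sub>R B) (r *\<^sub>R C)"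
proof -
  show "r *\<^sub>R cochain0 A = cochain0 (r *\<^sub>R A)"
    by (rule ext) (simp add: cochain0_def scaleR_fun_def)
  have "r *\<^sub>R cochain1 A B C xs = cochain1 (r *\<^sub>R A) (r *\<^sub>R B) (r *\<^sub>R C) xs" for xs
    unfolding cochain1_def by (simp add: scaleR_right_distrib mult.commute)
  then show "r *\<^sub>R cochain1 A B C = cochain1 (r *\<^sub>R A) (r *\<^sub>R B) (r *\<^sub>R C)"
    by (intro ext) (simp only: scaleR_fun_def)
  have "r *\<^sub>R cochain2 A B C xs = cochain2 (r *\<^sub>R A) (r *\<^sub>R B) (r *\<^sub>R C) xs" for xs
    unfolding cochain2_def by (simp add: scaleR_right_distrib mult.commute)
  then show "r *\<^sub>R cochain2 A B C = cochain2 (r *\<^sub>R A) (r *\<^sub>R B) (r *\<^sub>R C)"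
    by (intro ext) (simp only: scaleR_fun_def)
qed

lemma cochain_zero:
  "cochain0 A = 0 \<longleftrightarrow> A = 0"
  "cochain1 A B C = 0 \<longleftrightarrow> A = 0 \<and> B = 0 \<and> C = 0"
  "cochain2 A B C = 0 \<longleftrightarrow> A = 0 \<and> B = 0 \<and> C = 0"
  "cochain3 A = 0 \<longleftrightarrow> A = 0"
proof -
  show "cochain0 A = 0 \<longleftrightarrow> A = 0"
    using fun_cong[of "cochain0 A" 0 "[]"] by (auto simp: cochain0_def fun_eq_iff)
  show "cochain1 A B C = 0 \<longleftrightarrow> A = 0 \<and> B = 0 \<and> C = 0"
  proof
    assume "cochain1 A B C = 0"
    then have "cochain1 A B C xs = 0" for xs by simp
    from this[of "[e0]"] this[of "[e1]"] this[of "[e2]"] show "A = 0 \<and> B = 0 \<and> C = 0"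
      unfolding cochain_basis by blast
  qed (simp add: cochain1_def fun_eq_iff)
  show "cochain2 A B C = 0 \<longleftrightarrow> A = 0 \<and> B = 0 \<and> C = 0"
  proof
    assume "cochain2 A B C = 0"
    then have "cochain2 A B C xs = 0" for xs by simp
    from this[of "[e0, e1]"] this[of "[e0, e2]"] this[of "[e1, e2]"] show "A = 0 \<and> B = 0 \<and> C = 0"
      unfolding cochain_basis by blast
  qed (simp add: cochain2_def fun_eq_iff)
  show "cochain3 A = 0 \<longleftrightarrow> A = 0"
  proof
    assume "cochain3 A = 0"
    then have "cochain3 A xs = 0" for xs by simp
    from this[of "[e0, e1, e2]"] show "A = 0" unfolding cochain3_basis .
  qed (simp add: cochain3_def fun_eq_iff)
qed

text \<open>The next three lemmas isolate the linear algebra behind the differential of a 2-cochain. The value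
  on three arguments is collected by vectors first, so that only polynomial identities in the
  coordinates remain; the determinant of the coordinates factors out.\<close>

lemma scaleR_collect3:
  fixes XA XB XC :: "'a::real_vector"
  shows "f *\<^sub>R (a *\<^sub>R XA + b *\<^sub>R XB + c *\<^sub>R XC) - g *\<^sub>R (a' *\<^sub>R XA + b' *\<^sub>R XB + c' *\<^sub>R XC)
      + h *\<^sub>R (a'' *\<^sub>R XA + b'' *\<^sub>R XB + c'' *\<^sub>R XC)
    = (f * a - g * a' + h * a'') *\<^sub>R XA + (f * b - g * b' + h * b'') *\<^sub>R XB
      + (f * c - g * c' + h * c'') *\<^sub>R XC"
  by (simp add: algebra_simps)

lemma scaleR_collect:
  fixes A B C XA XB XC YA YB YC ZA ZB ZC :: "'a::real_vector"
  shows "(f0 *\<^sub>R (a *\<^sub>R XA + b *\<^sub>R XB + c *\<^sub>R XC) + f1 *\<^sub>R (a *\<^sub>R YA + b *\<^sub>R YB + c *\<^sub>R YC)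
      + f2 *\<^sub>R (a *\<^sub>R ZA + b *\<^sub>R ZB + c *\<^sub>R ZC))
    - (g0 *\<^sub>R (a' *\<^sub>R XA + b' *\<^sub>R XB + c' *\<^sub>R XC) + g1 *\<^sub>R (a' *\<^sub>R YA + b' *\<^sub>R YB + c' *\<^sub>R YC)
      + g2 *\<^sub>R (a' *\<^sub>R ZA + b' *\<^sub>R ZB + c' *\<^sub>R ZC))
    + (h0 *\<^sub>R (a'' *\<^sub>R XA + b'' *\<^sub>R XB + c'' *\<^sub>R XC) + h1 *\<^sub>R (a'' *\<^sub>R YA + b'' *\<^sub>R YB + c'' *\<^sub>R YC)
      + h2 *\<^sub>R (a'' *\<^sub>R ZA + b'' *\<^sub>R ZB + c'' *\<^sub>R ZC))
    - (p *\<^sub>R A + q *\<^sub>R B + r *\<^sub>R C) + (p' *\<^sub>R A + q' *\<^sub>R B + r' *\<^sub>R C) - (p'' *\<^sub>R A + q'' *\<^sub>R B + r'' *\<^sub>R C)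
    = (f0 * a - g0 * a' + h0 * a'') *\<^sub>R XA + (f0 * b - g0 * b' + h0 * b'') *\<^sub>R XB
    + (f0 * c - g0 * c' + h0 * c'') *\<^sub>R XC + (f1 * a - g1 * a' + h1 * a'') *\<^sub>R YA
    + (f1 * b - g1 * b' + h1 * b'') *\<^sub>R YB + (f1 * c - g1 * c' + h1 * c'') *\<^sub>R YC
    + (f2 * a - g2 * a' + h2 * a'') *\<^sub>R ZA + (f2 * b - g2 * b' + h2 * b'') *\<^sub>R ZB
    + (f2 * c - g2 * c' + h2 * c'') *\<^sub>R ZC
    + (p' - p - p'') *\<^sub>R A + (q' - q - q'') *\<^sub>R B + (r' - r - r'') *\<^sub>R C"
proof -
  have regroup: "(u1 + u2 + u3) - (v1 + v2 + v3) + (w1 + w2 + w3) - x + y - z =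
      (u1 - v1 + w1) + (u2 - v2 + w2) + (u3 - v3 + w3) + ((-1) *\<^sub>R x - (-1) *\<^sub>R y + (-1) *\<^sub>R z)"
    for u1 u2 u3 v1 v2 v3 w1 w2 w3 x y z :: 'a
    by (simp add: algebra_simps)
  have minus: "(-1) * u - (-1) * v + (-1) * w = v - u - w" for u v w :: real
    by simp
  show ?thesis
    unfolding regroup scaleR_collect3 minus by (simp only: add.assoc)
qed

lemma det_identity:
  fixes A B C XA XB XC YA YB YC ZA ZB ZC :: "'a::real_vector"
    and f0 f1 f2 g0 g1 g2 h0 h1 h2 :: real
  defines "d \<equiv> f0 * (g1 * h2 - g2 * h1) - f1 * (g0 * h2 - g2 * h0) + f2 * (g0 * h1 - g1 * h0)"
  shows "(f0 *\<^sub>R ((g0 * h1 - g1 * h0) *\<^sub>R XA + (g0 * h2 - g2 * h0) *\<^sub>R XB + (g1 * h2 - g2 * h1) *\<^sub>R XC)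
      + f1 *\<^sub>R ((g0 * h1 - g1 * h0) *\<^sub>R YA + (g0 * h2 - g2 * h0) *\<^sub>R YB + (g1 * h2 - g2 * h1) *\<^sub>R YC)
      + f2 *\<^sub>R ((g0 * h1 - g1 * h0) *\<^sub>R ZA + (g0 * h2 - g2 * h0) *\<^sub>R ZB + (g1 * h2 - g2 * h1) *\<^sub>R ZC))
    - (g0 *\<^sub>R ((f0 * h1 - f1 * h0) *\<^sub>R XA + (f0 * h2 - f2 * h0) *\<^sub>R XB + (f1 * h2 - f2 * h1) *\<^sub>R XC)
      + g1 *\<^sub>R ((f0 * h1 - f1 * h0) *\<^sub>R YA + (f0 * h2 - f2 * h0) *\<^sub>R YB + (f1 * h2 - f2 * h1) *\<^sub>R YC)
      + g2 *\<^sub>R ((f0 * h1 - f1 * h0) *\<^sub>R ZA + (f0 * h2 - f2 * h0) *\<^sub>R ZB + (f1 * h2 - f2 * h1) *\<^sub>R ZC))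
    + (h0 *\<^sub>R ((f0 * g1 - f1 * g0) *\<^sub>R XA + (f0 * g2 - f2 * g0) *\<^sub>R XB + (f1 * g2 - f2 * g1) *\<^sub>R XC)
      + h1 *\<^sub>R ((f0 * g1 - f1 * g0) *\<^sub>R YA + (f0 * g2 - f2 * g0) *\<^sub>R YB + (f1 * g2 - f2 * g1) *\<^sub>R YC)
      + h2 *\<^sub>R ((f0 * g1 - f1 * g0) *\<^sub>R ZA + (f0 * g2 - f2 * g0) *\<^sub>R ZB + (f1 * g2 - f2 * g1) *\<^sub>R ZC))
    - (((f0 * g1 - f1 * g0) * h1 - 2 * (f0 * g2 - f2 * g0) * h0) *\<^sub>R A
      + ((f0 * g1 - f1 * g0) * h2 - (f1 * g2 - f2 * g1) * h0) *\<^sub>R B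
      + (2 * (f0 * g2 - f2 * g0) * h2 - (f1 * g2 - f2 * g1) * h1) *\<^sub>R C)
    + (((f0 * h1 - f1 * h0) * g1 - 2 * (f0 * h2 - f2 * h0) * g0) *\<^sub>R A
      + ((f0 * h1 - f1 * h0) * g2 - (f1 * h2 - f2 * h1) * g0) *\<^sub>R B
      + (2 * (f0 * h2 - f2 * h0) * g2 - (f1 * h2 - f2 * h1) * g1) *\<^sub>R C)
    - (((g0 * h1 - g1 * h0) * f1 - 2 * (g0 * h2 - g2 * h0) * f0) *\<^sub>R A
      + ((g0 * h1 - g1 * h0) * f2 - (g1 * h2 - g2 * h1) * f0) *\<^sub>R B
      + (2 * (g0 * h2 - g2 * h0) * f2 - (g1 * h2 - g2 * h1) * f1) *\<^sub>R C)
    = d *\<^sub>R (XC - YB + ZA)"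
proof -
  have coeffs:
    "f0 * (g0 * h1 - g1 * h0) - g0 * (f0 * h1 - f1 * h0) + h0 * (f0 * g1 - f1 * g0) = 0"
    "f0 * (g0 * h2 - g2 * h0) - g0 * (f0 * h2 - f2 * h0) + h0 * (f0 * g2 - f2 * g0) = 0"
    "f0 * (g1 * h2 - g2 * h1) - g0 * (f1 * h2 - f2 * h1) + h0 * (f1 * g2 - f2 * g1) = d"
    "f1 * (g0 * h1 - g1 * h0) - g1 * (f0 * h1 - f1 * h0) + h1 * (f0 * g1 - f1 * g0) = 0"
    "f1 * (g0 * h2 - g2 * h0) - g1 * (f0 * h2 - f2 * h0) + h1 * (f0 * g2 - f2 * g0) = - d"
    "f1 * (g1 * h2 - g2 * h1) - g1 * (f1 * h2 - f2 * h1) + h1 * (f1 * g2 - f2 * g1) = 0"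
    "f2 * (g0 * h1 - g1 * h0) - g2 * (f0 * h1 - f1 * h0) + h2 * (f0 * g1 - f1 * g0) = d"
    "f2 * (g0 * h2 - g2 * h0) - g2 * (f0 * h2 - f2 * h0) + h2 * (f0 * g2 - f2 * g0) = 0"
    "f2 * (g1 * h2 - g2 * h1) - g2 * (f1 * h2 - f2 * h1) + h2 * (f1 * g2 - f2 * g1) = 0"
    "(f0 * h1 - f1 * h0) * g1 - 2 * (f0 * h2 - f2 * h0) * g0
      - ((f0 * g1 - f1 * g0) * h1 - 2 * (f0 * g2 - f2 * g0) * h0)
      - ((g0 * h1 - g1 * h0) * f1 - 2 * (g0 * h2 - g2 * h0) * f0) = 0"
    "(f0 * h1 - f1 * h0) * g2 - (f1 * h2 - f2 * h1) * g0
      - ((f0 * g1 - f1 * g0) * h2 - (f1 * g2 - f2 * g1) * h0)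
      - ((g0 * h1 - g1 * h0) * f2 - (g1 * h2 - g2 * h1) * f0) = 0"
    "2 * (f0 * h2 - f2 * h0) * g2 - (f1 * h2 - f2 * h1) * g1
      - (2 * (f0 * g2 - f2 * g0) * h2 - (f1 * g2 - f2 * g1) * h1)
      - (2 * (g0 * h2 - g2 * h0) * f2 - (g1 * h2 - g2 * h1) * f1) = 0"
    unfolding d_def by (simp_all add: algebra_simps)
  show ?thesis
    unfolding scaleR_collect coeffs by (simp add: scaleR_right_distrib scaleR_right_diff_distrib)
qed

section \<open>Cohomology of a coinduced module\<close>

text \<open>The properties of the module of differential operators on which the computation rests. The maps
  \<open>X0\<close>, \<open>X1\<close>, \<open>X2\<close> are the actions of \<open>d/dx\<close>, \<open>x d/dx\<close>, \<open>x\<^sup>2 d/dx\<close>, and \<open>ev\<close> takes the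
  coefficients at the point \<open>0\<close>. Coinduction is expressed by the last two assumptions: an element
  is the same as its image under \<open>X0\<close> together with its value at \<open>0\<close>.\<close>

locale sl2_coinduced =
  fixes M :: "'m::real_vector set" and act :: "(real \<Rightarrow> real) \<Rightarrow> 'm \<Rightarrow> 'm"
    and X0 X1 X2 :: "'m \<Rightarrow> 'm"
    and ev :: "'m \<Rightarrow> ('n::finite \<Rightarrow> nat) \<Rightarrow> real"
    and k :: nat and t :: "'n \<Rightarrow> nat"
  assumes M: "subspace M"
    and act: "h \<in> sl2 \<Longrightarrow> A \<in> M \<Longrightarrow> act h A = c0 h *\<^sub>R X0 A + c1 h *\<^sub>R X1 A + c2 h *\<^sub>R X2 A"
    and X_mem: "A \<in> M \<Longrightarrow> X0 A \<in> M" "A \<in> M \<Longrightarrow> X1 A \<in> M" "A \<in> M \<Longrightarrow> X2 A \<in> M"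
    and X_add: "A \<in> M \<Longrightarrow> B \<in> M \<Longrightarrow> X0 (A + B) = X0 A + X0 B"
      "A \<in> M \<Longrightarrow> B \<in> M \<Longrightarrow> X1 (A + B) = X1 A + X1 B"
      "A \<in> M \<Longrightarrow> B \<in> M \<Longrightarrow> X2 (A + B) = X2 A + X2 B"
    and X_scale: "A \<in> M \<Longrightarrow> X0 (r *\<^sub>R A) = r *\<^sub>R X0 A"
      "A \<in> M \<Longrightarrow> X1 (r *\<^sub>R A) = r *\<^sub>R X1 A" "A \<in> M \<Longrightarrow> X2 (r *\<^sub>R A) = r *\<^sub>R X2 A"
    and X01: "A \<in> M \<Longrightarrow> X0 (X1 A) = X1 (X0 A) + X0 A"
    and X02: "A \<in> M \<Longrightarrow> X0 (X2 A) = X2 (X0 A) + 2 *\<^sub>R X1 A"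
    and X12: "A \<in> M \<Longrightarrow> X1 (X2 A) = X2 (X1 A) + X2 A"
    and ev_linear: "linear ev"
    and ev_finite: "A \<in> M \<Longrightarrow> ev A \<in> finite_support"
    and ev1: "A \<in> M \<Longrightarrow> ev (X1 A) = euler (real k) (ev A)"
    and ev2: "A \<in> M \<Longrightarrow> ev (X2 A) = lower t (ev A)"
    and integrate: "A \<in> M \<Longrightarrow> v \<in> finite_support \<Longrightarrow> \<exists>B\<in>M. X0 B = A \<and> ev B = v"
    and unique: "A \<in> M \<Longrightarrow> X0 A = 0 \<Longrightarrow> ev A = 0 \<Longrightarrow> A = 0"
begin

lemmas M_mem = subspace_add[OF M] subspace_scale[OF M] subspace_diff[OF M] subspace_0[OF M]
  subspace_neg[OF M] X_mem

lemma X_diff: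
  assumes "A \<in> M" "B \<in> M"
  shows "X0 (A - B) = X0 A - X0 B" "X1 (A - B) = X1 A - X1 B" "X2 (A - B) = X2 A - X2 B"
proof -
  note C = subspace_scale[OF M assms(2), of "-1"]
  show "X0 (A - B) = X0 A - X0 B" "X1 (A - B) = X1 A - X1 B" "X2 (A - B) = X2 A - X2 B"
    using X_add[OF assms(1) C] X_scale[OF assms(2), of "-1"] by simp_all
qed

lemma X_0: "X0 0 = 0" "X1 0 = 0" "X2 0 = 0"
  using X_scale[OF subspace_0[OF M], of 0] by simp_all

lemma differential_0:
  assumes "A \<in> M"
  shows "ce_differential sl2 vf_bracket act 0 (cochain0 A) = cochain1 (X0 A) (X1 A) (X2 A)"
proof
  fix xs :: "(real \<Rightarrow> real) list"
  show "ce_differential sl2 vf_bracket act 0 (cochain0 A) xs = cochain1 (X0 A) (X1 A) (X2 A) xs"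
  proof (cases "length xs = 1 \<and> set xs \<subseteq> sl2")
    case True
    then obtain g where g: "xs = [g]" "g \<in> sl2" by (auto simp: length_1_conv)
    show ?thesis
      unfolding g(1) cochain_eval(2)[OF g(2)] act[OF g(2) assms, symmetric]
      using g(2) by (simp add: ce_differential_def delete_nth_def cochain0_def)
  next
    case False
    have neg: "\<not> (length xs = Suc 0 \<and> set xs \<subseteq> sl2)" using False by simp
    show ?thesis
      unfolding cochain1_def ce_differential_def by (simp only: if_not_P[OF False] if_not_P[OF neg])
  qed
qed

lemma differential_1:
  assumes ABC: "A \<in> M" "B \<in> M" "C \<in> M"
  shows "ce_differential sl2 vf_bracket act 1 (cochain1 A B C) =
    cochain2 (X0 B - X1 A - A) (X0 C - X2 A - 2 *\<^sub>R B) (X1 C - X2 B - C)"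
    (is "_ = cochain2 ?P ?Q ?R")
proof
  fix xs :: "(real \<Rightarrow> real) list"
  show "ce_differential sl2 vf_bracket act 1 (cochain1 A B C) xs = cochain2 ?P ?Q ?R xs"
  proof (cases "length xs = 2 \<and> set xs \<subseteq> sl2")
    case True
    then obtain g h where gh: "xs = [g, h]" "g \<in> sl2" "h \<in> sl2" by (auto simp: length_2_conv)
    have mem: "c0 f *\<^sub>R A + c1 f *\<^sub>R B + c2 f *\<^sub>R C \<in> M" for f by (intro M_mem ABC)
    have "ce_differential sl2 vf_bracket act 1 (cochain1 A B C) [g, h] =
        act g (cochain1 A B C [h]) - act h (cochain1 A B C [g]) - cochain1 A B C [vf_bracket g h]"
      using gh(2,3) by (simp add: ce_differential_def delete_nth_def atMost_Suc)
    also have "\<dots> = cochain2 ?P ?Q ?R [g, h]"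
      unfolding cochain_eval(2)[OF gh(2)] cochain_eval(2)[OF gh(3)] cochain_eval(3)[OF gh(2,3)]
        cochain_eval(2)[OF vf_bracket_coords(1)[OF gh(2,3)]] vf_bracket_coords(2-)[OF gh(2,3)]
        act[OF gh(2) mem] act[OF gh(3) mem]
      by (simp add: X_add X_scale M_mem ABC) (simp add: algebra_simps)
    finally show ?thesis unfolding gh(1) .
  next
    case False
    have neg: "\<not> (length xs = Suc 1 \<and> set xs \<subseteq> sl2)" using False by simp
    show ?thesis
      unfolding cochain2_def ce_differential_def by (simp only: if_not_P[OF False] if_not_P[OF neg])
  qed
qed

lemma differential_2:
  assumes ABC: "A \<in> M" "B \<in> M" "C \<in> M"
  shows "ce_differential sl2 vf_bracket act 2 (cochain2 A B C) = cochain3 (X0 C - X1 B + X2 A)"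
proof
  fix xs :: "(real \<Rightarrow> real) list"
  show "ce_differential sl2 vf_bracket act 2 (cochain2 A B C) xs = cochain3 (X0 C - X1 B + X2 A) xs"
  proof (cases "length xs = 3 \<and> set xs \<subseteq> sl2")
    case True
    then obtain f g h where fgh: "xs = [f, g, h]" "f \<in> sl2" "g \<in> sl2" "h \<in> sl2"
      by (auto simp: length_3_conv)
    let ?w = "cochain2 A B C"
    have mem: "a *\<^sub>R A + b *\<^sub>R B + c *\<^sub>R C \<in> M" for a b c by (intro M_mem ABC)
    have X: "X0 (a *\<^sub>R A + b *\<^sub>R B + c *\<^sub>R C) = a *\<^sub>R X0 A + b *\<^sub>R X0 B + c *\<^sub>R X0 C"
      "X1 (a *\<^sub>R A + b *\<^sub>R B + c *\<^sub>R C) = a *\<^sub>R X1 A + b *\<^sub>R X1 B + c *\<^sub>R X1 C"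
      "X2 (a *\<^sub>R A + b *\<^sub>R B + c *\<^sub>R C) = a *\<^sub>R X2 A + b *\<^sub>R X2 B + c *\<^sub>R X2 C" for a b c
      by (simp_all add: X_add X_scale M_mem ABC)
    note br = vf_bracket_coords(2-)[OF fgh(2,3)] vf_bracket_coords(2-)[OF fgh(2,4)]
      vf_bracket_coords(2-)[OF fgh(3,4)]
    note br_mem = vf_bracket_coords(1)[OF fgh(2,3)] vf_bracket_coords(1)[OF fgh(2,4)]
      vf_bracket_coords(1)[OF fgh(3,4)]
    have "ce_differential sl2 vf_bracket act 2 ?w [f, g, h] =
        act f (?w [g, h]) - act g (?w [f, h]) + act h (?w [f, g])
        - ?w [vf_bracket f g, h] + ?w [vf_bracket f h, g] - ?w [vf_bracket g h, f]"
      using fgh(2-) by (simp add: ce_differential_def delete_nth_def numeral_2_eq_2 atMost_Suc lessThan_Suc)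
    also have "\<dots> = cochain3 (X0 C - X1 B + X2 A) [f, g, h]"
      unfolding cochain_eval(3)[OF fgh(2,3)] cochain_eval(3)[OF fgh(2,4)] cochain_eval(3)[OF fgh(3,4)]
        cochain_eval(3)[OF br_mem(1) fgh(4)] cochain_eval(3)[OF br_mem(2) fgh(3)]
        cochain_eval(3)[OF br_mem(3) fgh(2)] br act[OF fgh(2) mem] act[OF fgh(3) mem] act[OF fgh(4) mem] X
        det_identity
      using fgh(2-) by (simp add: cochain3_def)
    finally show ?thesis unfolding fgh(1) .
  next
    case False
    have neg: "\<not> (length xs = Suc 2 \<and> set xs \<subseteq> sl2)" using False by simp
    show ?thesis
      unfolding cochain3_def ce_differential_def by (simp only: if_not_P[OF False] if_not_P[OF neg])
  qed
qed

text \<open>The cocycle conditions in coordinates; the arguments are the values on the basis, respectively on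
  its pairs in lexicographic order.\<close>

definition is_cocycle0 :: "'m \<Rightarrow> bool" where
  "is_cocycle0 A \<longleftrightarrow> A \<in> M \<and> X0 A = 0 \<and> X1 A = 0 \<and> X2 A = 0"

definition is_cocycle1 :: "'m \<Rightarrow> 'm \<Rightarrow> 'm \<Rightarrow> bool" where
  "is_cocycle1 A B C \<longleftrightarrow> A \<in> M \<and> B \<in> M \<and> C \<in> M \<and>
    X0 B = X1 A + A \<and> X0 C = X2 A + 2 *\<^sub>R B \<and> X1 C = X2 B + C"

definition is_cocycle2 :: "'m \<Rightarrow> 'm \<Rightarrow> 'm \<Rightarrow> bool" where
  "is_cocycle2 A B C \<longleftrightarrow> A \<in> M \<and> B \<in> M \<and> C \<in> M \<and> X0 C = X1 B - X2 A"

lemma cocycles_0: "ce_cocycles sl2 vf_bracket M act 0 = {cochain0 A |A. is_cocycle0 A}"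
  unfolding ce_cocycles_def ce_cochains_0 is_cocycle0_def
  by (auto simp: differential_0 cochain_zero)

lemma cocycles_1: "ce_cocycles sl2 vf_bracket M act 1 = {cochain1 A B C |A B C. is_cocycle1 A B C}"
proof -
  have "ce_differential sl2 vf_bracket act 1 (cochain1 A B C) = 0 \<longleftrightarrow>
      X0 B = X1 A + A \<and> X0 C = X2 A + 2 *\<^sub>R B \<and> X1 C = X2 B + C"
    if "A \<in> M" "B \<in> M" "C \<in> M" for A B C
    unfolding differential_1[OF that] cochain_zero diff_diff_eq right_minus_eq ..
  then show ?thesis
    unfolding ce_cocycles_def ce_cochains_1[OF M] is_cocycle1_def by blast
qed

lemma cocycles_2: "ce_cocycles sl2 vf_bracket M act 2 = {cochain2 A B C |A B C. is_cocycle2 A B C}"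
proof -
  have eq: "x - y + z = 0 \<longleftrightarrow> x = y - z" for x y z :: 'm
  proof -
    have "x - y + z = x - (y - z)" by simp
    then show ?thesis by (simp only: right_minus_eq)
  qed
  have "ce_differential sl2 vf_bracket act 2 (cochain2 A B C) = 0 \<longleftrightarrow> X0 C = X1 B - X2 A"
    if "A \<in> M" "B \<in> M" "C \<in> M" for A B C
    unfolding differential_2[OF that] cochain_zero by (rule eq)
  then show ?thesis
    unfolding ce_cocycles_def ce_cochains_2[OF M] is_cocycle2_def by blast
qed

lemma coboundaries_1:
  "ce_coboundaries sl2 vf_bracket M act 1 = {cochain1 (X0 A) (X1 A) (X2 A) |A. A \<in> M}"
  unfolding One_nat_def ce_coboundaries.simps ce_cochains_0 image_image
  by (auto simp: differential_0)

lemma coboundaries_2: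
  "ce_coboundaries sl2 vf_bracket M act 2 =
    {cochain2 (X0 B - X1 A - A) (X0 C - X2 A - 2 *\<^sub>R B) (X1 C - X2 B - C) |A B C.
      A \<in> M \<and> B \<in> M \<and> C \<in> M}"
proof -
  have "ce_coboundaries sl2 vf_bracket M act 2 =
      ce_differential sl2 vf_bracket act 1 ` ce_cochains sl2 M 1"
    by (simp add: numeral_2_eq_2)
  also have "\<dots> = {ce_differential sl2 vf_bracket act 1 (cochain1 A B C) |A B C.
      A \<in> M \<and> B \<in> M \<and> C \<in> M}"
    unfolding ce_cochains_1[OF M] by blast
  also have "\<dots> = {cochain2 (X0 B - X1 A - A) (X0 C - X2 A - 2 *\<^sub>R B) (X1 C - X2 B - C) |A B C.
      A \<in> M \<and> B \<in> M \<and> C \<in> M}"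
    by (intro Collect_cong ex_cong1) (metis differential_1)
  finally show ?thesis .
qed

lemma subspace_cocycles_0: "subspace {cochain0 A |A. is_cocycle0 A}"
proof (rule subspaceI)
  have "is_cocycle0 0" by (simp add: is_cocycle0_def X_0 M_mem)
  moreover have "cochain0 (0 :: 'm) = 0" unfolding cochain_zero by (rule refl)
  ultimately show "0 \<in> {cochain0 A |A. is_cocycle0 A}" by (intro CollectI exI[of _ 0]) simp
next
  fix v w assume "v \<in> {cochain0 A |A. is_cocycle0 A}" "w \<in> {cochain0 A |A. is_cocycle0 A}"
  then obtain A A' where vw: "v = cochain0 A" "w = cochain0 A'" and "is_cocycle0 A" "is_cocycle0 A'"
    by auto
  then have "is_cocycle0 (A + A')" by (simp add: is_cocycle0_def X_add M_mem)
  then show "v + w \<in> {cochain0 A |A. is_cocycle0 A}" unfolding vw cochain_add by blast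
next
  fix r v assume "v \<in> {cochain0 A |A. is_cocycle0 A}"
  then obtain A where v: "v = cochain0 A" and "is_cocycle0 A" by auto
  then have "is_cocycle0 (r *\<^sub>R A)" by (simp add: is_cocycle0_def X_scale M_mem)
  then show "r *\<^sub>R v \<in> {cochain0 A |A. is_cocycle0 A}" unfolding v cochain_scale by blast
qed

lemma subspace_cocycles_1: "subspace {cochain1 A B C |A B C. is_cocycle1 A B C}"
proof (rule subspaceI)
  have "is_cocycle1 0 0 0" by (simp add: is_cocycle1_def X_0 M_mem)
  moreover have "cochain1 (0 :: 'm) 0 0 = 0" unfolding cochain_zero by simp
  ultimately show "0 \<in> {cochain1 A B C |A B C. is_cocycle1 A B C}"
    by (intro CollectI exI[of _ 0] conjI) simp_all
next
  fix v w assume "v \<in> {cochain1 A B C |A B C. is_cocycle1 A B C}" "w \<in> {cochain1 A B C |A B C. is_cocycle1 A B C}"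
  then obtain A B C A' B' C' where vw: "v = cochain1 A B C" "w = cochain1 A' B' C'"
    and "is_cocycle1 A B C" "is_cocycle1 A' B' C'" by auto
  then have "is_cocycle1 (A + A') (B + B') (C + C')"
    by (simp add: is_cocycle1_def X_add M_mem scaleR_right_distrib)
  then show "v + w \<in> {cochain1 A B C |A B C. is_cocycle1 A B C}" unfolding vw cochain_add by blast
next
  fix r v assume "v \<in> {cochain1 A B C |A B C. is_cocycle1 A B C}"
  then obtain A B C where v: "v = cochain1 A B C" and "is_cocycle1 A B C" by auto
  then have "is_cocycle1 (r *\<^sub>R A) (r *\<^sub>R B) (r *\<^sub>R C)"
    by (simp add: is_cocycle1_def X_scale M_mem scaleR_right_distrib)
  then show "r *\<^sub>R v \<in> {cochain1 A B C |A B C. is_cocycle1 A B C}" unfolding v cochain_scale by blast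
qed

lemma subspace_cocycles_2: "subspace {cochain2 A B C |A B C. is_cocycle2 A B C}"
proof (rule subspaceI)
  have "is_cocycle2 0 0 0" by (simp add: is_cocycle2_def X_0 M_mem)
  moreover have "cochain2 (0 :: 'm) 0 0 = 0" unfolding cochain_zero by simp
  ultimately show "0 \<in> {cochain2 A B C |A B C. is_cocycle2 A B C}"
    by (intro CollectI exI[of _ 0] conjI) simp_all
next
  fix v w assume "v \<in> {cochain2 A B C |A B C. is_cocycle2 A B C}" "w \<in> {cochain2 A B C |A B C. is_cocycle2 A B C}"
  then obtain A B C A' B' C' where vw: "v = cochain2 A B C" "w = cochain2 A' B' C'"
    and "is_cocycle2 A B C" "is_cocycle2 A' B' C'" by auto
  then have "is_cocycle2 (A + A') (B + B') (C + C')"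
    by (simp add: is_cocycle2_def X_add M_mem)
  then show "v + w \<in> {cochain2 A B C |A B C. is_cocycle2 A B C}" unfolding vw cochain_add by blast
next
  fix r v assume "v \<in> {cochain2 A B C |A B C. is_cocycle2 A B C}"
  then obtain A B C where v: "v = cochain2 A B C" and "is_cocycle2 A B C" by auto
  then have "is_cocycle2 (r *\<^sub>R A) (r *\<^sub>R B) (r *\<^sub>R C)"
    by (simp add: is_cocycle2_def X_scale M_mem scaleR_diff_right)
  then show "r *\<^sub>R v \<in> {cochain2 A B C |A B C. is_cocycle2 A B C}" unfolding v cochain_scale by blast
qed

end

lemma euler_apply: "deg \<alpha> = m \<Longrightarrow> euler c v \<alpha> = (c - real_of_int m) * v \<alpha>"
  by (simp only: euler_def)

lemma part_euler: "part (int k) (euler (real k) v) = 0"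
  "part (int k - 1) (euler (real k) v) = part (int k - 1) v"
proof -
  show "part (int k) (euler (real k) v) = 0"
  proof
    fix \<alpha>
    show "part (int k) (euler (real k) v) \<alpha> = 0 \<alpha>"
      unfolding part_def using euler_apply[of \<alpha> "int k" "real k" v] by (simp del: of_nat_sum)
  qed
  show "part (int k - 1) (euler (real k) v) = part (int k - 1) v"
  proof
    fix \<alpha>
    show "part (int k - 1) (euler (real k) v) \<alpha> = part (int k - 1) v \<alpha>"
      unfolding part_def using euler_apply[of \<alpha> "int k - 1" "real k" v] by (simp del: of_nat_sum)
  qed
qed

lemma euler_homog: "v \<in> homog (int k) \<Longrightarrow> euler (real k) v = 0"
  and euler_homog_pred: "v \<in> homog (int k - 1) \<Longrightarrow> euler (real k) v = v"
proof -
  have other: "euler c v \<alpha> = 0" if "v \<in> homog m" "deg \<alpha> \<noteq> m" for c m \<alpha> and v :: "('a \<Rightarrow> nat) \<Rightarrow> real"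
    using supported_onD[OF that(1)[unfolded homog_def], of \<alpha>] that(2) by (simp add: euler_def)
  show "euler (real k) v = 0" if v: "v \<in> homog (int k)"
  proof
    fix \<alpha>
    show "euler (real k) v \<alpha> = 0 \<alpha>"
      using other[OF v, of \<alpha>] euler_apply[of \<alpha> "int k" "real k" v]
      by (cases "deg \<alpha> = int k") (simp_all del: of_nat_sum)
  qed
  show "euler (real k) v = v" if v: "v \<in> homog (int k - 1)"
  proof
    fix \<alpha>
    show "euler (real k) v \<alpha> = v \<alpha>"
      using other[OF v, of \<alpha>] euler_apply[of \<alpha> "int k - 1" "real k" v]
        supported_onD[OF v[unfolded homog_def], of \<alpha>]
      by (cases "deg \<alpha> = int k - 1") (simp_all del: of_nat_sum)
  qed
qed

lemma homog_if_euler: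
  assumes "euler (real k) v = 0"
  shows "v \<in> homog (int k)"
proof -
  have "deg \<alpha> = int k" if "v \<alpha> \<noteq> 0" for \<alpha>
  proof -
    have "(real k - real_of_int (deg \<alpha>)) * v \<alpha> = 0"
      using fun_cong[OF assms, of \<alpha>] by (simp only: euler_def zero_fun_apply)
    then have "real k = real_of_int (deg \<alpha>)" using that by (simp del: of_nat_sum)
    then show ?thesis by linarith
  qed
  then show ?thesis unfolding homog_def supported_on_def by blast
qed

lemma linear_eval: "linear (\<lambda>w. w xs)"
  by (rule linearI) (simp_all add: scaleR_fun_def)

context sl2_coinduced
begin

text \<open>An invariant is determined by its value at \<open>0\<close>, which is homogeneous of degree \<open>k\<close> by invariance
  under \<open>x d/dx\<close> and killed by lowering. Conversely, the constant extension of such a value is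
  invariant, because every obstruction is killed by \<open>X0\<close> and vanishes at \<open>0\<close>.\<close>

lemma has_dim_cohomology_0:
  assumes fin: "finite K" and ind: "independent K"
    and K: "span K = {v \<in> homog (int k). lower t v = 0}"
  shows "has_dim (ce_cohomology sl2 vf_bracket M act 0) (int (card K))"
  unfolding ce_cohomology_def ce_coboundaries.simps cocycles_0
proof (rule has_dim_quotient_space[where \<phi> = "\<lambda>w. ev (w [])" and ?C0.0 = "{}"])
  show "linear (\<lambda>w. ev (w []))"
    using linear_compose[OF linear_eval ev_linear, of "[]"] by (simp add: o_def)
  show "independent ({} \<union> K)" using ind by simp
  show "(\<lambda>w. ev (w [])) ` {cochain0 A |A. is_cocycle0 A} = span ({} \<union> K)"
  proof (intro equalityI subsetI)
    fix x assume "x \<in> (\<lambda>w. ev (w [])) ` {cochain0 A |A. is_cocycle0 A}"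
    then obtain A where x: "x = ev A" and A: "A \<in> M" "X1 A = 0" "X2 A = 0"
      by (auto simp: is_cocycle0_def cochain_eval)
    have "euler (real k) x = 0" "lower t x = 0"
      using ev1[OF A(1)] ev2[OF A(1)] linear_0[OF ev_linear] unfolding x A by simp_all
    then show "x \<in> span ({} \<union> K)" using K homog_if_euler by simp
  next
    fix x assume "x \<in> span ({} \<union> K)"
    then have x: "x \<in> homog (int k)" "lower t x = 0" using K by simp_all
    obtain A where A: "A \<in> M" "X0 A = 0" "ev A = x"
      using integrate[OF M_mem(4) homog_finite_support[OF x(1)]] by blast
    have "X1 A = 0"
      by (rule unique) (simp_all add: A M_mem X01 X_0 ev1 euler_homog[OF x(1)])
    moreover have "X2 A = 0"
      by (rule unique) (simp_all add: A M_mem X02 X_0 ev2 x(2) calculation)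
    ultimately have "is_cocycle0 A" using A by (simp add: is_cocycle0_def)
    moreover have "x = ev (cochain0 A [])" by (simp add: cochain_eval A)
    ultimately show "x \<in> (\<lambda>w. ev (w [])) ` {cochain0 A |A. is_cocycle0 A}" by blast
  qed
  have "w = 0" if "w \<in> {cochain0 A |A. is_cocycle0 A}" "ev (w []) = 0" for w
  proof -
    from that obtain A where w: "w = cochain0 A" and A: "A \<in> M" "X0 A = 0" "ev A = 0"
      by (auto simp: is_cocycle0_def cochain_eval)
    show ?thesis unfolding w using unique[OF A] by (simp only: cochain_zero)
  qed
  then show "{0} = {w \<in> {cochain0 A |A. is_cocycle0 A}. ev (w []) \<in> span {}}"
    using subspace_0[OF subspace_cocycles_0] linear_0[OF ev_linear] by auto
qed (simp_all add: fin subspace_cocycles_0)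

lemma is_cocycle1_coboundary:
  assumes "A \<in> M"
  shows "is_cocycle1 (X0 A) (X1 A) (X2 A)"
  by (simp add: is_cocycle1_def M_mem assms X01 X02 X12)

lemma is_cocycle1_ev:
  assumes "is_cocycle1 A B C"
  shows "lower t (ev B) = euler (real k) (ev C) - ev C"
proof -
  have mem: "B \<in> M" "C \<in> M" and C: "X1 C = X2 B + C" using assms by (simp_all add: is_cocycle1_def)
  have "X2 B = X1 C - C" using C by simp
  then have "ev (X2 B) = ev (X1 C - C)" by simp
  then show ?thesis by (simp add: linear_diff[OF ev_linear] ev1 ev2 mem)
qed

text \<open>A primitive \<open>D\<close> must satisfy \<open>X0 D = A\<close>, which leaves its value \<open>v\<close> at \<open>0\<close> free. The equation for
  \<open>x d/dx\<close> forces \<open>v\<close> in all degrees other than \<open>k\<close>, where the eigenvalue is invertible; in degree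
  \<open>k\<close> the given preimage \<open>u\<close> is used. The remaining equations hold at \<open>0\<close>, in degrees other than
  \<open>k - 1\<close> by the cocycle condition, and away from \<open>0\<close> by uniqueness.\<close>

lemma is_cocycle1_exact:
  assumes coc: "is_cocycle1 A B C" and u: "u \<in> homog (int k)"
    and B0: "part (int k) (ev B) = 0" and C0: "part (int k - 1) (ev C) = lower t u"
  shows "\<exists>D\<in>M. A = X0 D \<and> B = X1 D \<and> C = X2 D"
proof -
  have mem: "A \<in> M" "B \<in> M" "C \<in> M" and X0B: "X0 B = X1 A + A" and X0C: "X0 C = X2 A + 2 *\<^sub>R B"
    using coc by (simp_all add: is_cocycle1_def)
  define v where "v = (\<lambda>\<alpha>. if deg \<alpha> = int k then u \<alpha> else ev B \<alpha> / (real k - real_of_int (deg \<alpha>)))"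
  have "v = u + (v - u)" by simp
  moreover have "v - u \<in> finite_support"
    by (rule finite_supportI[OF ev_finite[OF mem(2)]])
      (use supported_onD[OF u[unfolded homog_def]] in \<open>simp add: v_def del: of_nat_sum\<close>)
  ultimately have "v \<in> finite_support"
    using finite_support_add[OF homog_finite_support[OF u]] by metis
  from integrate[OF mem(1) this] obtain D where D: "D \<in> M" "X0 D = A" "ev D = v" by blast
  have "X1 D - B = 0"
  proof (rule unique)
    show "X1 D - B \<in> M" by (intro M_mem D mem)
    show "X0 (X1 D - B) = 0" by (simp add: X_diff M_mem D mem X01 X0B)
    have "euler (real k) v \<alpha> = ev B \<alpha>" for \<alpha>
    proof (cases "deg \<alpha> = int k")
      case True
      then have "ev B \<alpha> = 0" using fun_cong[OF B0, of \<alpha>] by (simp add: part_def del: of_nat_sum)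
      then show ?thesis using euler_apply[OF True, of "real k" v] by simp
    next
      case False
      then have "real k - real_of_int (deg \<alpha>) \<noteq> 0" by linarith
      then show ?thesis using False by (simp add: euler_def v_def del: of_nat_sum)
    qed
    then have "euler (real k) v = ev B" by (rule ext)
    then show "ev (X1 D - B) = 0" by (simp add: linear_diff[OF ev_linear] ev1 D)
  qed
  then have B: "X1 D = B" by simp
  have "X2 D - C = 0"
  proof (rule unique)
    show "X2 D - C \<in> M" by (intro M_mem D mem)
    show "X0 (X2 D - C) = 0" by (simp add: X_diff M_mem D mem X02 X0C B)
    have "lower t v \<alpha> = ev C \<alpha>" for \<alpha>
    proof (cases "deg \<alpha> = int k - 1")
      case True
      have "lower t v \<alpha> = lower t u \<alpha>"
        by (rule lower_cong_deg) (simp add: v_def True del: of_nat_sum)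
      also have "\<dots> = ev C \<alpha>" unfolding C0[symmetric] by (simp add: part_def True del: of_nat_sum)
      finally show ?thesis .
    next
      case False
      let ?c = "real k - real_of_int (deg \<alpha>) - 1"
      have "?c \<noteq> 0" using False by linarith
      have "lower t v \<alpha> = inverse ?c * lower t (ev B) \<alpha>"
      proof (rule lower_scale_deg)
        fix \<beta> :: "'n \<Rightarrow> nat" assume \<beta>: "deg \<beta> = deg \<alpha> + 1"
        then have "deg \<beta> \<noteq> int k" using False by linarith
        moreover have "real k - real_of_int (deg \<beta>) = ?c" unfolding \<beta> by simp
        ultimately show "v \<beta> = inverse ?c * ev B \<beta>" unfolding v_def by (simp only: if_False divide_inverse mult.commute)
      qed
      also have "lower t (ev B) \<alpha> = ?c * ev C \<alpha>"
        unfolding is_cocycle1_ev[OF coc] by (simp add: euler_def algebra_simps)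
      finally have "lower t v \<alpha> = (inverse ?c * ?c) * ev C \<alpha>" by (simp only: mult.assoc)
      then show ?thesis unfolding left_inverse[OF \<open>?c \<noteq> 0\<close>] by simp
    qed
    then have "lower t v = ev C" by (rule ext)
    then show "ev (X2 D - C) = 0" by (simp add: linear_diff[OF ev_linear] ev2 D)
  qed
  then have "X2 D = C" by simp
  then show ?thesis using B D by blast
qed

text \<open>Every class is represented by a cocycle that vanishes on \<open>d/dx\<close>: extend the value on \<open>x d/dx\<close> as
  a constant, and the value on \<open>x\<^sup>2 d/dx\<close> by integration.\<close>

lemma is_cocycle1_extend:
  assumes a: "a \<in> homog (int k)" "lower t a = 0" and b: "b \<in> homog (int k - 1)"
  shows "\<exists>B C. is_cocycle1 0 B C \<and> ev B = a \<and> ev C = b"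
proof -
  obtain B where B: "B \<in> M" "X0 B = 0" "ev B = a"
    using integrate[OF M_mem(4) homog_finite_support[OF a(1)]] by blast
  obtain C where C: "C \<in> M" "X0 C = 2 *\<^sub>R B" "ev C = b"
    using integrate[OF M_mem(2)[OF B(1)] homog_finite_support[OF b]] by blast
  have "X1 C - X2 B - C = 0"
  proof (rule unique)
    show "X1 C - X2 B - C \<in> M" by (intro M_mem B C)
    show "X0 (X1 C - X2 B - C) = 0"
      by (simp add: X_diff M_mem B C X01 X02 X_0 X_scale)
    show "ev (X1 C - X2 B - C) = 0"
      by (simp add: linear_diff[OF ev_linear] ev1 ev2 B C a euler_homog_pred[OF b])
  qed
  then have "X1 C = X2 B + C" by (simp add: algebra_simps)
  then show ?thesis using B C by (auto simp: is_cocycle1_def X_0 M_mem)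
qed

text \<open>The class of a cocycle is detected by the part of degree \<open>k\<close> of its value on \<open>x d/dx\<close> and the part
  of degree \<open>k - 1\<close> of its value on \<open>x\<^sup>2 d/dx\<close>, both at \<open>0\<close>. The former lies in the kernel of
  lowering, the latter is arbitrary, and the coboundaries are the cocycles for which the former
  vanishes and the latter lies in the image of lowering. As the degrees differ, the two
  parts can be added without loss.\<close>

lemma has_dim_cohomology_1:
  assumes fin: "finite K" "finite C" and disj: "I \<inter> (K \<union> C) = {}" "K \<inter> C = {}"
    and ind: "independent (I \<union> (K \<union> C))"
    and K: "span K = {v \<in> homog (int k). lower t v = 0}" and I: "span I = lower t ` homog (int k)"
    and IC: "span (I \<union> C) = homog (int k - 1)"
  shows "has_dim (ce_cohomology sl2 vf_bracket M act 1) (int (card K + card C))"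
proof -
  let ?Z = "{cochain1 A B C |A B C. is_cocycle1 A B C}"
  define \<phi> where "\<phi> w = part (int k) (ev (w [e1])) + part (int k - 1) (ev (w [e2]))" for w :: "(real \<Rightarrow> real) list \<Rightarrow> 'm"
  have \<phi>_eval: "\<phi> (cochain1 A B C) = part (int k) (ev B) + part (int k - 1) (ev C)" for A B C
    by (simp add: \<phi>_def cochain_basis)
  have lin: "linear \<phi>"
    unfolding \<phi>_def
    using linear_compose_add[OF linear_compose[OF linear_compose[OF linear_eval ev_linear] linear_part]
        linear_compose[OF linear_compose[OF linear_eval ev_linear] linear_part], of "int k" "[e1]" "int k - 1" "[e2]"]
    by (simp add: o_def)
  have all: "span (I \<union> (K \<union> C)) = {a + b |a b. a \<in> span K \<and> b \<in> homog (int k - 1)}"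
  proof -
    have "I \<union> (K \<union> C) = K \<union> (I \<union> C)" by blast
    then show ?thesis by (simp only: span_Un[of K "I \<union> C"] IC)
  qed
  have im: "\<phi> ` ?Z = span (I \<union> (K \<union> C))"
  proof (intro equalityI subsetI)
    fix x assume "x \<in> \<phi> ` ?Z"
    then obtain A B D where coc: "is_cocycle1 A B D" and x: "x = part (int k) (ev B) + part (int k - 1) (ev D)"
      using \<phi>_eval by auto
    have "lower t (part (int k) (ev B)) = part (int k - 1) (lower t (ev B))"
      by (simp add: part_lower)
    also have "\<dots> = 0"
      unfolding is_cocycle1_ev[OF coc] linear_diff[OF linear_part] part_euler by simp
    finally have "part (int k) (ev B) \<in> span K" using K part_homog by simp
    then show "x \<in> span (I \<union> (K \<union> C))" unfolding all x using part_homog by blast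
  next
    fix x assume "x \<in> span (I \<union> (K \<union> C))"
    then obtain a b where x: "x = a + b" and "a \<in> span K" and b: "b \<in> homog (int k - 1)"
      unfolding all by blast
    then have a: "a \<in> homog (int k)" "lower t a = 0" using K by simp_all
    from is_cocycle1_extend[OF a b] obtain B D where "is_cocycle1 0 B D" and ev: "ev B = a" "ev D = b"
      by blast
    moreover have "\<phi> (cochain1 0 B D) = x" unfolding \<phi>_eval ev x part_id[OF a(1)] part_id[OF b] ..
    ultimately show "x \<in> \<phi> ` ?Z" by blast
  qed
  have bound: "{cochain1 (X0 A) (X1 A) (X2 A) |A. A \<in> M} = {w \<in> ?Z. \<phi> w \<in> span I}"
  proof (intro equalityI subsetI)
    fix w assume "w \<in> {cochain1 (X0 A) (X1 A) (X2 A) |A. A \<in> M}"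
    then obtain A where A: "A \<in> M" and w: "w = cochain1 (X0 A) (X1 A) (X2 A)" by blast
    have "\<phi> w = lower t (part (int k) (ev A))"
      unfolding w \<phi>_eval ev1[OF A] ev2[OF A] part_euler part_lower by simp
    then have "\<phi> w \<in> span I" unfolding I using part_homog by blast
    then show "w \<in> {w \<in> ?Z. \<phi> w \<in> span I}" unfolding w using is_cocycle1_coboundary[OF A] by blast
  next
    fix w assume "w \<in> {w \<in> ?Z. \<phi> w \<in> span I}"
    then obtain A B D where w: "w = cochain1 A B D" and coc: "is_cocycle1 A B D" and "\<phi> w \<in> span I"
      by blast
    then obtain u where u: "u \<in> homog (int k)"
      and eq: "part (int k) (ev B) + part (int k - 1) (ev D) = lower t u"
      unfolding I w \<phi>_eval by blast
    have lu: "lower t u \<in> homog (int k - 1)" by (rule lower_homog[OF u])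
    have "part (int k) (part (int k) (ev B) + part (int k - 1) (ev D)) = part (int k) (lower t u)"
      unfolding eq ..
    then have "part (int k) (ev B) = 0"
      by (simp add: linear_add[OF linear_part] part_id[OF part_homog] part_other[OF part_homog] part_other[OF lu])
    moreover from this eq have "part (int k - 1) (ev D) = lower t u" by simp
    ultimately obtain E where "E \<in> M" "A = X0 E \<and> B = X1 E \<and> D = X2 E"
      using is_cocycle1_exact[OF coc u] by blast
    then show "w \<in> {cochain1 (X0 A) (X1 A) (X2 A) |A. A \<in> M}" unfolding w by blast
  qed
  have "has_dim (quotient_space ?Z {cochain1 (X0 A) (X1 A) (X2 A) |A. A \<in> M}) (int (card (K \<union> C)))"
    by (rule has_dim_quotient_space[OF subspace_cocycles_1 lin finite_UnI[OF fin] ind disj(1) im bound])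
  then show ?thesis
    unfolding ce_cohomology_def cocycles_1 coboundaries_1 card_Un_disjoint[OF fin disj(2)] .
qed

lemma is_cocycle2_coboundary:
  assumes "A \<in> M" "B \<in> M" "C \<in> M"
  shows "is_cocycle2 (X0 B - X1 A - A) (X0 C - X2 A - 2 *\<^sub>R B) (X1 C - X2 B - C)"
  unfolding is_cocycle2_def
  by (simp add: M_mem assms X_diff X_scale X01 X02 X12)

text \<open>A primitive that vanishes on \<open>d/dx\<close> is found by integrating twice. The constants of integration
  \<open>- u\<close> and \<open>v\<close> are adjusted so that the third component agrees at \<open>0\<close>: in degree \<open>k - 1\<close>, where \<open>v\<close>
  does not contribute, \<open>u\<close> supplies the value, and in all other degrees \<open>v\<close> is obtained by
  division.\<close>

lemma is_cocycle2_exact: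
  assumes coc: "is_cocycle2 A B C" and u: "u \<in> homog (int k)"
    and C0: "part (int k - 1) (ev C) = lower t u"
  shows "\<exists>D E. D \<in> M \<and> E \<in> M \<and> A = X0 D \<and> B = X0 E - 2 *\<^sub>R D \<and> C = X1 E - X2 D - E"
proof -
  have mem: "A \<in> M" "B \<in> M" "C \<in> M" and X0C: "X0 C = X1 B - X2 A"
    using coc by (simp_all add: is_cocycle2_def)
  have "- u \<in> homog (int k)" using subspace_neg[OF subspace_homog u] .
  from integrate[OF mem(1) homog_finite_support[OF this]]
  obtain D where D: "D \<in> M" "X0 D = A" "ev D = - u" by blast
  define v where "v = (\<lambda>\<alpha>. if deg \<alpha> = int k - 1 then 0 else ev C \<alpha> / (real k - real_of_int (deg \<alpha>) - 1))"
  have "v \<in> finite_support"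
    by (rule finite_supportI[OF ev_finite[OF mem(3)]]) (simp add: v_def)
  then obtain E where E: "E \<in> M" "X0 E = B + 2 *\<^sub>R D" "ev E = v"
    using integrate[of "B + 2 *\<^sub>R D" v] M_mem(1)[OF mem(2) M_mem(2)[OF D(1), of 2]] by blast
  have "C - (X1 E - X2 D - E) = 0"
  proof (rule unique)
    show "C - (X1 E - X2 D - E) \<in> M" by (intro M_mem D E mem)
    show "X0 (C - (X1 E - X2 D - E)) = 0"
      by (simp add: X_diff X_add X_scale M_mem D E mem X01 X02 X0C)
    have "ev C \<alpha> = euler (real k) v \<alpha> + lower t u \<alpha> - v \<alpha>" for \<alpha>
    proof (cases "deg \<alpha> = int k - 1")
      case True
      then show ?thesis
        using fun_cong[OF C0, of \<alpha>] euler_apply[OF True, of "real k" v] by (simp add: part_def v_def del: of_nat_sum)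
    next
      case False
      have "real k - real_of_int (deg \<alpha>) - 1 \<noteq> 0" using False by linarith
      moreover have "lower t u \<alpha> = 0"
        using supported_onD[OF lower_homog[OF u, unfolded homog_def]] False by simp
      moreover have "euler (real k) v \<alpha> - v \<alpha> = (real k - real_of_int (deg \<alpha>) - 1) * v \<alpha>"
        by (simp add: euler_def algebra_simps)
      ultimately show ?thesis using False by (simp add: v_def del: of_nat_sum)
    qed
    then have "ev C = euler (real k) v + lower t u - v" by (simp add: fun_eq_iff)
    then show "ev (C - (X1 E - X2 D - E)) = 0"
      by (simp add: linear_diff[OF ev_linear] ev1 ev2 D E mem M_mem linear_neg[OF linear_lower])
  qed
  then have "C = X1 E - X2 D - E" by simp
  moreover have "B = X0 E - 2 *\<^sub>R D" using E by simp
  ultimately show ?thesis using D E by blast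
qed

text \<open>The class is detected by the part of degree \<open>k - 1\<close>, at \<open>0\<close>, of the value on the pair
  \<open>x d/dx\<close>, \<open>x\<^sup>2 d/dx\<close>.\<close>

lemma has_dim_cohomology_2:
  assumes fin: "finite C" and disj: "I \<inter> C = {}" and ind: "independent (I \<union> C)"
    and I: "span I = lower t ` homog (int k)" and IC: "span (I \<union> C) = homog (int k - 1)"
  shows "has_dim (ce_cohomology sl2 vf_bracket M act 2) (int (card C))"
proof -
  let ?Z = "{cochain2 A B C |A B C. is_cocycle2 A B C}"
  let ?B = "{cochain2 (X0 B - X1 A - A) (X0 C - X2 A - 2 *\<^sub>R B) (X1 C - X2 B - C) |A B C.
      A \<in> M \<and> B \<in> M \<and> C \<in> M}"
  define \<phi> where "\<phi> w = part (int k - 1) (ev (w [e1, e2]))" for w :: "(real \<Rightarrow> real) list \<Rightarrow> 'm"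
  have \<phi>_eval: "\<phi> (cochain2 A B C) = part (int k - 1) (ev C)" for A B C
    by (simp add: \<phi>_def cochain_basis)
  have lin: "linear \<phi>"
    unfolding \<phi>_def
    using linear_compose[OF linear_compose[OF linear_eval ev_linear] linear_part, of "int k - 1" "[e1, e2]"]
    by (simp add: o_def)
  have im: "\<phi> ` ?Z = span (I \<union> C)"
    unfolding IC
  proof (intro equalityI subsetI)
    fix x assume "x \<in> \<phi> ` ?Z"
    then show "x \<in> homog (int k - 1)" using \<phi>_eval part_homog by auto
  next
    fix b :: "('n \<Rightarrow> nat) \<Rightarrow> real" assume b: "b \<in> homog (int k - 1)"
    obtain D where D: "D \<in> M" "X0 D = 0" "ev D = b"
      using integrate[OF M_mem(4) homog_finite_support[OF b]] by blast
    then have "is_cocycle2 0 0 D" by (simp add: is_cocycle2_def M_mem X_0)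
    moreover have "\<phi> (cochain2 0 0 D) = b" unfolding \<phi>_eval D part_id[OF b] ..
    ultimately show "b \<in> \<phi> ` ?Z" by blast
  qed
  have bound: "?B = {w \<in> ?Z. \<phi> w \<in> span I}"
  proof (intro equalityI subsetI)
    fix w assume "w \<in> ?B"
    then obtain A B D where mem: "A \<in> M" "B \<in> M" "D \<in> M"
      and w: "w = cochain2 (X0 B - X1 A - A) (X0 D - X2 A - 2 *\<^sub>R B) (X1 D - X2 B - D)" by blast
    have "\<phi> w = - lower t (part (int k) (ev B))"
      unfolding w \<phi>_eval
      by (simp add: linear_diff[OF ev_linear] ev1 ev2 mem linear_diff[OF linear_part] part_euler part_lower)
    then have "\<phi> w = lower t (- part (int k) (ev B))" by (simp add: linear_neg[OF linear_lower])
    then have "\<phi> w \<in> span I" unfolding I using subspace_neg[OF subspace_homog part_homog] by blast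
    then show "w \<in> {w \<in> ?Z. \<phi> w \<in> span I}" unfolding w using is_cocycle2_coboundary[OF mem] by blast
  next
    fix w assume "w \<in> {w \<in> ?Z. \<phi> w \<in> span I}"
    then obtain A B D where w: "w = cochain2 A B D" and coc: "is_cocycle2 A B D" and "\<phi> w \<in> span I"
      by blast
    then obtain u where u: "u \<in> homog (int k)" and eq: "part (int k - 1) (ev D) = lower t u"
      unfolding I w \<phi>_eval by blast
    from is_cocycle2_exact[OF coc u eq] obtain E F where EF: "E \<in> M" "F \<in> M" "A = X0 E"
      "B = X0 F - 2 *\<^sub>R E" "D = X1 F - X2 E - F" by blast
    then have "w = cochain2 (X0 E - X1 0 - 0) (X0 F - X2 0 - 2 *\<^sub>R E) (X1 F - X2 E - F)"
      unfolding w by (simp add: X_0)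
    then show "w \<in> ?B" using M_mem(4) EF(1,2) by blast
  qed
  show ?thesis
    unfolding ce_cohomology_def cocycles_2 coboundaries_2
    by (rule has_dim_quotient_space[OF subspace_cocycles_2 lin fin ind disj im bound])
qed

end

section \<open>Smooth functions\<close>

lemma smooth_iff: "smooth f \<longleftrightarrow> (\<forall>x. f field_differentiable at x) \<and> smooth (deriv f)"
proof
  assume f: "smooth f"
  have "f field_differentiable at x" for x
    using f unfolding smooth_def by (metis funpow_0)
  moreover have "smooth (deriv f)"
    unfolding smooth_def
  proof (intro allI)
    fix m x
    show "(deriv ^^ m) (deriv f) field_differentiable at x"
      using f[unfolded smooth_def, rule_format, of "Suc m" x] by (simp only: funpow_Suc_right o_def)
  qed
  ultimately show "(\<forall>x. f field_differentiable at x) \<and> smooth (deriv f)" by blast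
next
  assume f: "(\<forall>x. f field_differentiable at x) \<and> smooth (deriv f)"
  show "smooth f"
    unfolding smooth_def
  proof (intro allI)
    fix m x
    show "(deriv ^^ m) f field_differentiable at x"
    proof (cases m)
      case 0
      then show ?thesis using f by simp
    next
      case (Suc l)
      show ?thesis
        using f[unfolded smooth_def] unfolding Suc funpow_Suc_right o_def by blast
    qed
  qed
qed

text \<open>Smoothness is the greatest property that implies differentiability and passes to the derivative.\<close>

lemma smooth_coinduct:
  assumes "P f" and step: "\<And>g. P g \<Longrightarrow> (\<forall>x. g field_differentiable at x) \<and> P (deriv g)"
  shows "smooth f"
proof -
  have "P ((deriv ^^ m) f)" for m
    by (induction m) (use assms in auto)
  then show ?thesis unfolding smooth_def using step by blast
qed

lemma smooth_deriv: "smooth f \<Longrightarrow> smooth (deriv f)"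
  using smooth_iff by blast

lemma smooth_higher_deriv: "smooth f \<Longrightarrow> smooth ((deriv ^^ m) f)"
  by (induction m) (simp_all add: smooth_deriv)

lemma smooth_field_differentiable: "smooth f \<Longrightarrow> f field_differentiable at x"
  using smooth_iff by blast

lemma smooth_DERIV: "smooth f \<Longrightarrow> (f has_field_derivative deriv f x) (at x)"
  by (simp add: smooth_field_differentiable DERIV_deriv_iff_field_differentiable)

lemma smooth_const: "smooth (\<lambda>x. c)"
proof (rule smooth_coinduct[where P = "\<lambda>f. \<exists>c. f = (\<lambda>x. c)"])
  fix g :: "real \<Rightarrow> real" assume "\<exists>c. g = (\<lambda>x. c)"
  then obtain c where "g = (\<lambda>x. c)" by blast
  then show "(\<forall>x. g field_differentiable at x) \<and> (\<exists>c. deriv g = (\<lambda>x. c))" by auto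
qed blast

lemma smooth_shift: "smooth (\<lambda>x. x - c)"
proof -
  have D: "((\<lambda>x. x - c) has_field_derivative 1) (at x)" for x :: real
    by (auto intro!: derivative_eq_intros)
  then have "deriv (\<lambda>x. x - c) = (\<lambda>x. 1)" by (intro ext DERIV_imp_deriv)
  then show ?thesis
    using D smooth_const[of 1] unfolding smooth_iff[of "\<lambda>x. x - c"] field_differentiable_def by auto
qed

text \<open>The derivative of a product of smooth functions is no longer a product, but the sums of such products
  are closed under differentiation, which makes \<open>smooth_coinduct\<close> applicable.\<close>

inductive smooth_expr :: "(real \<Rightarrow> real) \<Rightarrow> bool" where
  product: "smooth f \<Longrightarrow> smooth g \<Longrightarrow> smooth_expr (\<lambda>x. f x * g x)"
| sum: "smooth_expr f \<Longrightarrow> smooth_expr g \<Longrightarrow> smooth_expr (\<lambda>x. f x + g x)"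

lemma smooth_expr_smooth: "smooth_expr f \<Longrightarrow> smooth f"
proof (erule smooth_coinduct[where P = smooth_expr])
  fix f assume "smooth_expr f"
  then show "(\<forall>x. f field_differentiable at x) \<and> smooth_expr (deriv f)"
  proof induction
    case (product f g)
    have "deriv (\<lambda>x. f x * g x) = (\<lambda>x. f x * deriv g x + deriv f x * g x)"
      using product by (intro ext) (simp add: smooth_field_differentiable)
    moreover have "smooth_expr (\<lambda>x. f x * deriv g x + deriv f x * g x)"
      by (intro smooth_expr.intros smooth_deriv product)
    ultimately show ?case
      using product by (simp add: field_differentiable_mult smooth_field_differentiable)
  next
    case (sum f g)
    have "deriv (\<lambda>x. f x + g x) = (\<lambda>x. deriv f x + deriv g x)"
      using sum.IH by (intro ext) simp
    then show ?case using sum.IH by (auto intro!: field_differentiable_add smooth_expr.intros)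
  qed
qed

lemma smooth_mult: "smooth f \<Longrightarrow> smooth g \<Longrightarrow> smooth (\<lambda>x. f x * g x)"
  by (rule smooth_expr_smooth[OF smooth_expr.product])

lemma smooth_add:
  assumes "smooth f" "smooth g"
  shows "smooth (\<lambda>x. f x + g x)"
proof -
  have "smooth_expr (\<lambda>x. f x * 1 + g x * 1)"
    by (intro smooth_expr.intros assms smooth_const)
  then show ?thesis using smooth_expr_smooth by simp
qed

lemma smooth_power_shift: "smooth (\<lambda>x. (x - c) ^ n)"
  by (induction n) (simp_all add: smooth_const smooth_mult smooth_shift)

lemma smooth_antiderivative:
  assumes "smooth f"
  shows "\<exists>F. smooth F \<and> deriv F = f \<and> F 0 = c"
proof -
  have "continuous (at x) f" for x
    using smooth_field_differentiable[OF assms] by (rule field_differentiable_imp_continuous_at)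
  then obtain G where G: "\<And>x. (G has_vector_derivative f x) (at x)"
    using einterval_antiderivative[of "-\<infinity>" \<infinity> f] by auto
  define F where "F = (\<lambda>x. G x - G 0 + c)"
  have F: "(F has_field_derivative f x) (at x)" for x
    using G[of x] unfolding F_def has_real_derivative_iff_has_vector_derivative[symmetric]
    by (auto intro!: derivative_eq_intros)
  then have "deriv F = f" by (intro ext DERIV_imp_deriv)
  moreover have "smooth F"
    using F assms calculation smooth_iff[of F] field_differentiable_def by metis
  moreover have "F 0 = c" by (simp add: F_def)
  ultimately show ?thesis by blast
qed

lemma smooth_sl2:
  assumes "h \<in> sl2"
  shows "smooth h"
proof -
  have "smooth (\<lambda>x. c0 h + c1 h * (x - 0) ^ 1 + c2 h * (x - 0) ^ 2)"
    by (intro smooth_add smooth_mult smooth_const smooth_power_shift)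
  moreover have "h = (\<lambda>x. c0 h + c1 h * (x - 0) ^ 1 + c2 h * (x - 0) ^ 2)"
    by (rule ext) (use c_eval[OF assms] in simp)
  ultimately show ?thesis by simp
qed

lemma deriv_sl2: "h \<in> sl2 \<Longrightarrow> deriv h x = c1 h + 2 * c2 h * x"
  by (rule DERIV_imp_deriv[OF sl2_deriv])

lemma smooth_lie_density:
  assumes "h \<in> sl2" "smooth f"
  shows "smooth (lie_density \<nu> h f)"
  unfolding lie_density_def using smooth_sl2[OF assms(1)] assms(2)
  by (intro smooth_add smooth_mult smooth_deriv smooth_const)

section \<open>Lie derivatives of multidifferential monomials\<close>

text \<open>Dividing by factorials turns \<open>\<Omega>\<^sup>\<alpha>\<close> into a plain product of divided derivatives.\<close>

definition divided_deriv :: "nat \<Rightarrow> (real \<Rightarrow> real) \<Rightarrow> real \<Rightarrow> real" where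
  "divided_deriv j f x = (deriv ^^ j) f x / fact j"

lemma divided_deriv_DERIV:
  assumes "smooth f"
  shows "(divided_deriv j f has_field_derivative real (Suc j) * divided_deriv (Suc j) f x) (at x)"
proof -
  have "((deriv ^^ j) f has_field_derivative (deriv ^^ Suc j) f x) (at x)"
    using smooth_DERIV[OF smooth_higher_deriv[OF assms]] by simp
  then have "((\<lambda>x. (deriv ^^ j) f x / fact j) has_field_derivative (deriv ^^ Suc j) f x / fact j) (at x)"
    by (rule DERIV_cdivide)
  moreover have "(deriv ^^ Suc j) f x / fact j = real (Suc j) * divided_deriv (Suc j) f x"
    unfolding divided_deriv_def fact_Suc by (simp del: of_nat_Suc)
  ultimately show ?thesis unfolding divided_deriv_def by simp
qed

text \<open>The Leibniz rule stops after three terms because the third derivative of \<open>h\<close> vanishes.\<close>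

lemma divided_deriv_lie_density:
  assumes h: "h \<in> sl2" and f: "smooth f"
  shows "divided_deriv j (lie_density \<nu> h f) x =
    real (Suc j) * h x * divided_deriv (Suc j) f x + (real j + \<nu>) * deriv h x * divided_deriv j f x +
    (if j = 0 then 0 else (real j - 1 + 2 * \<nu>) * c2 h * divided_deriv (j - 1) f x)"
proof (induction j arbitrary: x)
  case 0
  show ?case by (simp add: divided_deriv_def lie_density_def)
next
  case (Suc j)
  note D = divided_deriv_DERIV[OF f]
  have "(deriv h has_field_derivative 2 * c2 h) (at x)"
  proof -
    have "deriv h = (\<lambda>x. c1 h + 2 * c2 h * x)" using deriv_sl2[OF h] by (rule ext)
    then show ?thesis by (auto intro!: derivative_eq_intros)
  qed
  note hD = this
  have "((\<lambda>x. divided_deriv j (lie_density \<nu> h f) x) has_field_derivative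
      real (Suc j) * (deriv h x * divided_deriv (Suc j) f x + h x * (real (Suc (Suc j)) * divided_deriv (Suc (Suc j)) f x))
      + (real j + \<nu>) * (2 * c2 h * divided_deriv j f x + deriv h x * (real (Suc j) * divided_deriv (Suc j) f x))
      + (if j = 0 then 0 else (real j - 1 + 2 * \<nu>) * c2 h * (real j * divided_deriv j f x))) (at x)"
    (is "(_ has_field_derivative ?E) _")
  proof (cases j)
    case 0
    show ?thesis
      unfolding Suc.IH using 0
      by (auto intro!: derivative_eq_intros smooth_DERIV[OF smooth_sl2[OF h]] hD D simp: algebra_simps)
  next
    case (Suc l)
    show ?thesis
      unfolding Suc.IH using Suc
      by (auto intro!: derivative_eq_intros smooth_DERIV[OF smooth_sl2[OF h]] hD D simp: algebra_simps)
  qed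
  then have "real (Suc j) * divided_deriv (Suc j) (lie_density \<nu> h f) x = ?E"
    by (rule DERIV_unique[OF divided_deriv_DERIV[OF smooth_lie_density[OF h f]]])
  also have "\<dots> = real (Suc j) *
     (real (Suc (Suc j)) * h x * divided_deriv (Suc (Suc j)) f x + (real (Suc j) + \<nu>) * deriv h x * divided_deriv (Suc j) f x +
      (real j + 2 * \<nu>) * c2 h * divided_deriv j f x)"
    by (simp add: algebra_simps)
  finally show ?case by simp
qed

lemma higher_deriv_power_shift:
  "(deriv ^^ j) (\<lambda>y. (y - c) ^ n) = (\<lambda>y::real. fact j * real (n choose j) * (y - c) ^ (n - j))"
proof (induction j)
  case (Suc j)
  have "Suc j * (n choose Suc j) = (n - j) * (n choose j)"
    by (simp only: binomial_absorption binomial_absorb_comp)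
  then have eq: "fact (Suc j) * real (n choose Suc j) = fact j * (real (n - j) * real (n choose j))"
    by (metis (no_types, opaque_lifting) fact_Suc mult.assoc mult.commute of_nat_fact of_nat_mult)
  have "((\<lambda>y. fact j * real (n choose j) * (y - c) ^ (n - j)) has_field_derivative
      fact (Suc j) * real (n choose Suc j) * (y - c) ^ (n - Suc j)) (at y)" for y
    unfolding eq by (auto intro!: derivative_eq_intros)
  then have "deriv (\<lambda>y. fact j * real (n choose j) * (y - c) ^ (n - j)) =
      (\<lambda>y. fact (Suc j) * real (n choose Suc j) * (y - c) ^ (n - Suc j))"
    by (intro ext DERIV_imp_deriv)
  then show ?case using Suc by simp
qed simp

lemma divided_deriv_power_shift:
  "divided_deriv j (\<lambda>y. (y - c) ^ n) c = (if j = n then 1 else 0)"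
  by (cases "j \<le> n") (auto simp: divided_deriv_def higher_deriv_power_shift power_0_left)

lemma Omega_eq:
  assumes "\<forall>i. smooth (F i)"
  shows "Omega \<alpha> F x = (\<Prod>i\<in>UNIV. divided_deriv (\<alpha> i) (F i) x)"
  using assms by (simp add: Omega_def divided_deriv_def prod_dividef)

lemma Omega_DERIV:
  assumes "\<forall>i. smooth (F i)"
  shows "(Omega \<alpha> F has_field_derivative (\<Sum>i\<in>UNIV. real (Suc (\<alpha> i)) * Omega (incr i \<alpha>) F x)) (at x)"
proof -
  have "(\<lambda>x. Omega \<alpha> F x) = (\<lambda>x. \<Prod>i\<in>UNIV. divided_deriv (\<alpha> i) (F i) x)"
    using Omega_eq[OF assms] by (rule ext)
  moreover have "((\<lambda>x. \<Prod>i\<in>UNIV. divided_deriv (\<alpha> i) (F i) x) has_field_derivative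
     (\<Sum>i\<in>UNIV. (real (Suc (\<alpha> i)) * divided_deriv (Suc (\<alpha> i)) (F i) x) *
       (\<Prod>l\<in>UNIV - {i}. divided_deriv (\<alpha> l) (F l) x))) (at x)"
    by (rule has_field_derivative_prod) (use assms divided_deriv_DERIV in blast)
  moreover have "divided_deriv (Suc (\<alpha> i)) (F i) x * (\<Prod>l\<in>UNIV - {i}. divided_deriv (\<alpha> l) (F l) x) =
      Omega (incr i \<alpha>) F x" for i
    unfolding Omega_eq[OF assms] by (subst (2) prod.remove[of _ i]) (auto simp: incr_apply intro!: prod.cong)
  ultimately show ?thesis by (simp add: mult.assoc)
qed

lemma Omega_lie_density:
  assumes F: "\<forall>i. smooth (F i)" and h: "h \<in> sl2"
  shows "Omega \<alpha> (F(i := lie_density \<nu> h (F i))) x =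
    real (Suc (\<alpha> i)) * h x * Omega (incr i \<alpha>) F x + (real (\<alpha> i) + \<nu>) * deriv h x * Omega \<alpha> F x +
    (if \<alpha> i = 0 then 0 else (real (\<alpha> i) - 1 + 2 * \<nu>) * c2 h * Omega (decr i \<alpha>) F x)"
proof -
  let ?P = "\<Prod>l\<in>UNIV - {i}. divided_deriv (\<alpha> l) (F l) x"
  have F': "\<forall>l. smooth ((F(i := lie_density \<nu> h (F i))) l)"
    using F smooth_lie_density[OF h] by simp
  have split: "Omega \<beta> G x = divided_deriv (\<beta> i) (G i) x * (\<Prod>l\<in>UNIV - {i}. divided_deriv (\<beta> l) (G l) x)"
    if "\<forall>l. smooth (G l)" for \<beta> G
    unfolding Omega_eq[OF that] by (rule prod.remove) auto
  have Fi: "smooth (F i)" using F by blast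
  have "Omega \<alpha> (F(i := lie_density \<nu> h (F i))) x = divided_deriv (\<alpha> i) (lie_density \<nu> h (F i)) x * ?P"
    unfolding split[OF F'] by (auto intro!: prod.cong)
  moreover have "Omega (incr i \<alpha>) F x = divided_deriv (Suc (\<alpha> i)) (F i) x * ?P"
    unfolding split[OF F] by (auto simp: incr_apply intro!: prod.cong)
  moreover have "Omega (decr i \<alpha>) F x = divided_deriv (\<alpha> i - 1) (F i) x * ?P"
    unfolding split[OF F] by (auto simp: decr_apply intro!: prod.cong)
  moreover have "Omega \<alpha> F x = divided_deriv (\<alpha> i) (F i) x * ?P" by (rule split[OF F])
  ultimately show ?thesis
    unfolding divided_deriv_lie_density[OF h Fi] by (simp add: algebra_simps)
qed

section \<open>Symbols of differential operators\<close>

type_synonym 'n operator = "('n \<Rightarrow> real \<Rightarrow> real) \<Rightarrow> real \<Rightarrow> real"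

definition monomial_op :: "(real \<Rightarrow> real) \<Rightarrow> ('n::finite \<Rightarrow> nat) \<Rightarrow> 'n operator" where
  "monomial_op a \<alpha> = (\<lambda>F x. a x * Omega \<alpha> F x)"

text \<open>Applied to powers of \<open>y - x\<close> and evaluated at \<open>y = x\<close>, all monomials \<open>\<Omega>\<^sup>\<beta>\<close> except \<open>\<Omega>\<^sup>\<alpha>\<close>
  vanish, so that this is the coefficient of \<open>\<Omega>\<^sup>\<alpha>\<close>. The definition makes it linear in the operator
  without reference to a representation.\<close>

definition symbol :: "('n::finite) operator \<Rightarrow> ('n \<Rightarrow> nat) \<Rightarrow> real \<Rightarrow> real" where
  "symbol A \<alpha> x = A (\<lambda>i y. (y - x) ^ \<alpha> i) x"

lemma symbol_add: "symbol (A + B) \<alpha> x = symbol A \<alpha> x + symbol B \<alpha> x"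
  and symbol_scale: "symbol (r *\<^sub>R A) \<alpha> x = r * symbol A \<alpha> x"
  and symbol_0: "symbol 0 \<alpha> x = 0"
  by (simp_all add: symbol_def scaleR_fun_def)

lemma symbol_sum: "symbol (\<Sum>i\<in>I. A i) \<alpha> x = (\<Sum>i\<in>I. symbol (A i) \<alpha> x)"
  by (simp add: symbol_def sum_fun_apply)

lemma symbol_monomial_op: "symbol (monomial_op a \<beta>) \<alpha> x = (if \<alpha> = \<beta> then a x else 0)"
proof -
  have smooth: "\<forall>i. smooth (\<lambda>y. (y - x) ^ \<alpha> i)" by (simp add: smooth_power_shift)
  have "Omega \<beta> (\<lambda>i y. (y - x) ^ \<alpha> i) x = (\<Prod>i\<in>UNIV. if \<beta> i = \<alpha> i then 1 else 0)"
    unfolding Omega_eq[OF smooth] divided_deriv_power_shift ..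
  also have "\<dots> = (if \<alpha> = \<beta> then 1 else 0)"
  proof (cases "\<alpha> = \<beta>")
    case False
    then obtain i where "\<beta> i \<noteq> \<alpha> i" by (metis ext)
    then have "(\<Prod>i\<in>UNIV. if \<beta> i = \<alpha> i then 1 else 0 :: real) = 0"
      by (intro prod_zero bexI[of _ i]) simp_all
    then show ?thesis using False by simp
  qed simp
  finally show ?thesis by (simp add: symbol_def monomial_op_def)
qed

lemma sum_monomial_op_apply:
  "(\<Sum>\<alpha>\<in>S. monomial_op (a \<alpha>) \<alpha>) F x = (\<Sum>\<alpha>\<in>S. a \<alpha> x * Omega \<alpha> F x)"
  by (simp add: sum_fun_apply monomial_op_def)

lemma diff_ops_eq:
  "(diff_ops :: ('n::finite) operator set) = {\<Sum>\<alpha>\<in>S. monomial_op (a \<alpha>) \<alpha> |S a. finite S \<and> (\<forall>\<alpha>\<in>S. smooth (a \<alpha>))}"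
proof -
  have "(\<lambda>F x. \<Sum>\<alpha>\<in>S. a \<alpha> x * Omega \<alpha> F x) = (\<Sum>\<alpha>\<in>S. monomial_op (a \<alpha>) \<alpha>)"
    for S and a :: "('n \<Rightarrow> nat) \<Rightarrow> real \<Rightarrow> real"
    by (intro ext) (rule sum_monomial_op_apply[symmetric])
  then show ?thesis unfolding diff_ops_def by (simp only:) blast
qed

lemma diff_opsI: "finite S \<Longrightarrow> (\<And>\<alpha>. \<alpha> \<in> S \<Longrightarrow> smooth (a \<alpha>)) \<Longrightarrow> (\<Sum>\<alpha>\<in>S. monomial_op (a \<alpha>) \<alpha>) \<in> diff_ops"
  unfolding diff_ops_eq by blast

lemma diff_ops_symbol:
  assumes "A \<in> diff_ops"
  shows "\<exists>S. finite S \<and> (\<forall>\<alpha> x. \<alpha> \<notin> S \<longrightarrow> symbol A \<alpha> x = 0) \<and> (\<forall>\<alpha>. smooth (symbol A \<alpha>)) \<and>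
    A = (\<Sum>\<alpha>\<in>S. monomial_op (symbol A \<alpha>) \<alpha>)"
proof -
  from assms obtain S a where S: "finite S" "\<forall>\<alpha>\<in>S. smooth (a \<alpha>)"
    and A: "A = (\<Sum>\<alpha>\<in>S. monomial_op (a \<alpha>) \<alpha>)"
    unfolding diff_ops_eq by blast
  have sym: "symbol A \<alpha> x = (if \<alpha> \<in> S then a \<alpha> x else 0)" for \<alpha> x
    unfolding A symbol_sum symbol_monomial_op using S(1) by simp
  show ?thesis
  proof (intro exI[of _ S] conjI allI impI)
    show "finite S" by (rule S(1))
    show "symbol A \<alpha> x = 0" if "\<alpha> \<notin> S" for \<alpha> x using that by (simp add: sym)
    show "smooth (symbol A \<alpha>)" for \<alpha>
    proof -
      have "symbol A \<alpha> = (if \<alpha> \<in> S then a \<alpha> else (\<lambda>x. 0))" by (rule ext) (simp add: sym)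
      then show ?thesis using S(2) smooth_const by simp
    qed
    have "a \<alpha> = symbol A \<alpha>" if "\<alpha> \<in> S" for \<alpha> by (rule ext) (simp add: sym that)
    then have "(\<Sum>\<alpha>\<in>S. monomial_op (a \<alpha>) \<alpha>) = (\<Sum>\<alpha>\<in>S. monomial_op (symbol A \<alpha>) \<alpha>)"
      by (intro sum.cong refl) simp
    then show "A = (\<Sum>\<alpha>\<in>S. monomial_op (symbol A \<alpha>) \<alpha>)" using A by (rule trans[rotated])
  qed
qed

lemma diff_ops_smooth_symbol: "A \<in> diff_ops \<Longrightarrow> smooth (symbol A \<alpha>)"
  using diff_ops_symbol by blast

lemma diff_ops_expand:
  assumes A: "A \<in> diff_ops" and S: "finite S" "\<forall>\<alpha> x. \<alpha> \<notin> S \<longrightarrow> symbol A \<alpha> x = 0"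
  shows "(\<Sum>\<alpha>\<in>S. monomial_op (symbol A \<alpha>) \<alpha>) = A"
proof -
  obtain S' where S': "finite S'" "\<forall>\<alpha> x. \<alpha> \<notin> S' \<longrightarrow> symbol A \<alpha> x = 0"
    and A_eq: "A = (\<Sum>\<alpha>\<in>S'. monomial_op (symbol A \<alpha>) \<alpha>)"
    using diff_ops_symbol[OF A] by blast
  have zero: "monomial_op (symbol A \<alpha>) \<alpha> = 0" if "\<alpha> \<notin> S \<or> \<alpha> \<notin> S'" for \<alpha>
  proof -
    have "symbol A \<alpha> x = 0" for x using that S(2) S'(2) by blast
    then show ?thesis unfolding monomial_op_def by (intro ext) simp
  qed
  have "(\<Sum>\<alpha>\<in>S. monomial_op (symbol A \<alpha>) \<alpha>) = (\<Sum>\<alpha>\<in>S \<union> S'. monomial_op (symbol A \<alpha>) \<alpha>)"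
    by (rule sum.mono_neutral_left) (use S(1) S'(1) zero in simp_all)
  also have "\<dots> = (\<Sum>\<alpha>\<in>S'. monomial_op (symbol A \<alpha>) \<alpha>)"
    by (rule sum.mono_neutral_right) (use S(1) S'(1) zero in simp_all)
  finally show ?thesis using A_eq by (rule trans[OF _ sym])
qed

lemma diff_ops_eqI:
  assumes A: "A \<in> diff_ops" and B: "B \<in> diff_ops" and eq: "\<And>\<alpha> x. symbol A \<alpha> x = symbol B \<alpha> x"
  shows "A = B"
proof -
  obtain S where S: "finite S" "\<forall>\<alpha> x. \<alpha> \<notin> S \<longrightarrow> symbol A \<alpha> x = 0"
    using diff_ops_symbol[OF A] by blast
  have "\<forall>\<alpha> x. \<alpha> \<notin> S \<longrightarrow> symbol B \<alpha> x = 0" using S(2) eq by simp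
  note expand = diff_ops_expand[OF A S] diff_ops_expand[OF B S(1) this]
  have "symbol A = symbol B" by (intro ext eq)
  then have "(\<Sum>\<alpha>\<in>S. monomial_op (symbol A \<alpha>) \<alpha>) = (\<Sum>\<alpha>\<in>S. monomial_op (symbol B \<alpha>) \<alpha>)"
    by (simp only:)
  then show ?thesis unfolding expand .
qed

lemma monomial_op_mem: "smooth a \<Longrightarrow> monomial_op a \<alpha> \<in> diff_ops"
  using diff_opsI[of "{\<alpha>}" "\<lambda>_. a"] by simp

lemma subspace_diff_ops: "subspace (diff_ops :: ('n::finite) operator set)"
proof (rule subspaceI)
  show "0 \<in> (diff_ops :: 'n operator set)"
    using diff_opsI[of "{} :: ('n \<Rightarrow> nat) set"] by simp
next
  fix A B :: "'n operator" assume AB: "A \<in> diff_ops" "B \<in> diff_ops"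
  obtain S where S: "finite S" "\<forall>\<alpha> x. \<alpha> \<notin> S \<longrightarrow> symbol A \<alpha> x = 0"
    using diff_ops_symbol[OF AB(1)] by blast
  obtain S' where S': "finite S'" "\<forall>\<alpha> x. \<alpha> \<notin> S' \<longrightarrow> symbol B \<alpha> x = 0"
    using diff_ops_symbol[OF AB(2)] by blast
  have fin: "finite (S \<union> S')" using S(1) S'(1) by (rule finite_UnI)
  have "(\<Sum>\<alpha>\<in>S \<union> S'. monomial_op (symbol A \<alpha>) \<alpha>) = A"
    by (rule diff_ops_expand[OF AB(1) fin]) (use S(2) in simp)
  moreover have "(\<Sum>\<alpha>\<in>S \<union> S'. monomial_op (symbol B \<alpha>) \<alpha>) = B"
    by (rule diff_ops_expand[OF AB(2) fin]) (use S'(2) in simp)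
  ultimately have "A + B = (\<Sum>\<alpha>\<in>S \<union> S'. monomial_op (symbol A \<alpha>) \<alpha> + monomial_op (symbol B \<alpha>) \<alpha>)"
    by (simp only: sum.distrib)
  also have "\<dots> = (\<Sum>\<alpha>\<in>S \<union> S'. monomial_op (\<lambda>x. symbol A \<alpha> x + symbol B \<alpha> x) \<alpha>)"
  proof (rule sum.cong[OF refl])
    show "monomial_op (symbol A \<alpha>) \<alpha> + monomial_op (symbol B \<alpha>) \<alpha> =
        monomial_op (\<lambda>x. symbol A \<alpha> x + symbol B \<alpha> x) \<alpha>" for \<alpha>
      by (intro ext) (simp add: monomial_op_def distrib_right)
  qed
  also have "\<dots> \<in> diff_ops"
    by (rule diff_opsI[OF fin smooth_add]) (rule diff_ops_smooth_symbol[OF AB(1)], rule diff_ops_smooth_symbol[OF AB(2)])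
  finally show "A + B \<in> diff_ops" .
next
  fix r and A :: "'n operator" assume A: "A \<in> diff_ops"
  then obtain S where S: "finite S" "\<forall>\<alpha> x. \<alpha> \<notin> S \<longrightarrow> symbol A \<alpha> x = 0"
    using diff_ops_symbol by blast
  have "r *\<^sub>R A = (\<Sum>\<alpha>\<in>S. r *\<^sub>R monomial_op (symbol A \<alpha>) \<alpha>)"
    by (subst diff_ops_expand[OF A S, symmetric]) (rule scaleR_sum_right)
  also have "\<dots> = (\<Sum>\<alpha>\<in>S. monomial_op (\<lambda>x. r * symbol A \<alpha> x) \<alpha>)"
  proof (rule sum.cong[OF refl])
    show "r *\<^sub>R monomial_op (symbol A \<alpha>) \<alpha> = monomial_op (\<lambda>x. r * symbol A \<alpha> x) \<alpha>" for \<alpha>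
      by (intro ext) (simp add: monomial_op_def scaleR_fun_def)
  qed
  also have "\<dots> \<in> diff_ops"
    by (rule diff_opsI[OF S(1) smooth_mult[OF smooth_const]]) (rule diff_ops_smooth_symbol[OF A])
  finally show "r *\<^sub>R A \<in> diff_ops" .
qed

text \<open>The terms with an additional derivative cancel: those from differentiating \<open>\<Omega>\<^sup>\<alpha>\<close> are the same as
  those from the Leibniz rule on the arguments. What remains preserves the exponent or lowers it
  by one.\<close>

lemma op_action_eq:
  fixes lam :: "'n::finite \<Rightarrow> real"
  assumes h: "h \<in> sl2" and S: "finite S" and a: "\<And>\<alpha>. smooth (a \<alpha>)"
  shows "op_action lam \<mu> h (\<Sum>\<alpha>\<in>S. monomial_op (a \<alpha>) \<alpha>) =
    (\<Sum>\<alpha>\<in>S. monomial_op (\<lambda>x. h x * deriv (a \<alpha>) x +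
        (\<mu> - (\<Sum>i\<in>UNIV. lam i) - real (\<Sum>i\<in>UNIV. \<alpha> i)) * deriv h x * a \<alpha> x) \<alpha>
      + (\<Sum>i\<in>UNIV. monomial_op (\<lambda>x. if \<alpha> i = 0 then 0 else
          - (real (\<alpha> i) - 1 + 2 * lam i) * c2 h * a \<alpha> x) (decr i \<alpha>)))"
    (is "op_action lam \<mu> h ?A = ?B")
proof (intro ext)
  fix F x
  show "op_action lam \<mu> h ?A F x = ?B F x"
  proof (cases "\<forall>i. smooth (F i)")
    case False
    then have "Omega \<alpha> F x = 0" for \<alpha> unfolding Omega_def by (simp only: False if_False zero_fun_apply)
    then show ?thesis
      unfolding op_action_def if_not_P[OF False] by (simp add: sum_fun_apply monomial_op_def)
  next
    case True
    let ?O = "\<lambda>\<alpha>. Omega \<alpha> F x" and ?h = "h x" and ?h' = "deriv h x"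
    have "(?A F has_field_derivative (\<Sum>\<alpha>\<in>S. deriv (a \<alpha>) x * ?O \<alpha> +
        (\<Sum>i\<in>UNIV. real (Suc (\<alpha> i)) * ?O (incr i \<alpha>)) * a \<alpha> x)) (at x)"
    proof -
      have A_fun: "?A F = (\<lambda>x. \<Sum>\<alpha>\<in>S. a \<alpha> x * Omega \<alpha> F x)"
        by (rule ext) (rule sum_monomial_op_apply)
      show ?thesis
        unfolding A_fun by (rule DERIV_sum) (rule DERIV_mult[OF smooth_DERIV[OF a] Omega_DERIV[OF True]])
    qed
    then have dA: "deriv (?A F) x = (\<Sum>\<alpha>\<in>S. deriv (a \<alpha>) x * ?O \<alpha> +
        (\<Sum>i\<in>UNIV. real (Suc (\<alpha> i)) * ?O (incr i \<alpha>)) * a \<alpha> x)"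
      by (rule DERIV_imp_deriv)
    have summand: "?h * (deriv (a \<alpha>) x * ?O \<alpha> + (\<Sum>i\<in>UNIV. real (Suc (\<alpha> i)) * ?O (incr i \<alpha>)) * a \<alpha> x)
        + \<mu> * ?h' * (a \<alpha> x * ?O \<alpha>)
        - (\<Sum>i\<in>UNIV. a \<alpha> x * Omega \<alpha> (F(i := lie_density (lam i) h (F i))) x)
      = (?h * deriv (a \<alpha>) x + (\<mu> - (\<Sum>i\<in>UNIV. lam i) - real (\<Sum>i\<in>UNIV. \<alpha> i)) * ?h' * a \<alpha> x) * ?O \<alpha>
        + (\<Sum>i\<in>UNIV. (if \<alpha> i = 0 then 0 else - (real (\<alpha> i) - 1 + 2 * lam i) * c2 h * a \<alpha> x) * ?O (decr i \<alpha>))"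
      for \<alpha>
    proof -
      let ?d = "\<lambda>i. (if \<alpha> i = 0 then 0 else - (real (\<alpha> i) - 1 + 2 * lam i) * c2 h * a \<alpha> x) * ?O (decr i \<alpha>)"
      have "a \<alpha> x * Omega \<alpha> (F(i := lie_density (lam i) h (F i))) x =
          (?h * a \<alpha> x) * (real (Suc (\<alpha> i)) * ?O (incr i \<alpha>)) +
          (real (\<alpha> i) + lam i) * (?h' * a \<alpha> x * ?O \<alpha>) - ?d i" for i
      proof -
        have d: "?d i = - (a \<alpha> x * (if \<alpha> i = 0 then 0
            else (real (\<alpha> i) - 1 + 2 * lam i) * c2 h * ?O (decr i \<alpha>)))"
          by (simp add: algebra_simps)
        have expand: "y * (s * r * P + q * r' * w + e) = (r * y) * (s * P) + q * (r' * y * w) - - (y * e)"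
          for y s r P q r' w e :: real
          by (simp add: algebra_simps)
        show ?thesis unfolding Omega_lie_density[OF True h] d by (rule expand)
      qed
      then have eq: "(\<Sum>i\<in>UNIV. a \<alpha> x * Omega \<alpha> (F(i := lie_density (lam i) h (F i))) x) =
          (?h * a \<alpha> x) * (\<Sum>i\<in>UNIV. real (Suc (\<alpha> i)) * ?O (incr i \<alpha>)) +
          ((\<Sum>i\<in>UNIV. real (\<alpha> i)) + (\<Sum>i\<in>UNIV. lam i)) * (?h' * a \<alpha> x * ?O \<alpha>) - (\<Sum>i\<in>UNIV. ?d i)"
        by (simp only: sum.distrib sum_subtractf sum_distrib_left[symmetric] sum_distrib_right[symmetric])
      have combine: "r * (da * w + P * y) + \<mu> * r' * (y * w) - ((r * y) * P + (Q + L) * (r' * y * w) - D)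
          = (r * da + (\<mu> - L - Q) * r' * y) * w + D" for r da w P y r' Q L D :: real
        by (simp add: algebra_simps)
      show ?thesis unfolding eq of_nat_sum by (rule combine)
    qed
    have "op_action lam \<mu> h ?A F x = ?h * deriv (?A F) x + \<mu> * ?h' * ?A F x
        - (\<Sum>i\<in>UNIV. ?A (F(i := lie_density (lam i) h (F i))) x)"
      by (simp only: op_action_def if_P[OF True] lie_density_def minus_apply sum_fun_apply)
    also have "\<dots> = (\<Sum>\<alpha>\<in>S. ?h * (deriv (a \<alpha>) x * ?O \<alpha> + (\<Sum>i\<in>UNIV. real (Suc (\<alpha> i)) * ?O (incr i \<alpha>)) * a \<alpha> x)
        + \<mu> * ?h' * (a \<alpha> x * ?O \<alpha>)
        - (\<Sum>i\<in>UNIV. a \<alpha> x * Omega \<alpha> (F(i := lie_density (lam i) h (F i))) x))"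
    proof -
      have swap: "(\<Sum>i\<in>UNIV. ?A (F(i := lie_density (lam i) h (F i))) x) =
          (\<Sum>\<alpha>\<in>S. \<Sum>i\<in>UNIV. a \<alpha> x * Omega \<alpha> (F(i := lie_density (lam i) h (F i))) x)"
        unfolding sum_monomial_op_apply by (rule sum.swap)
      have combine: "c * (\<Sum>\<alpha>\<in>S. p \<alpha>) + d * (\<Sum>\<alpha>\<in>S. q \<alpha>) - (\<Sum>\<alpha>\<in>S. r \<alpha>) = (\<Sum>\<alpha>\<in>S. c * p \<alpha> + d * q \<alpha> - r \<alpha>)"
        for c d :: real and p q r
        by (simp only: sum_subtractf sum.distrib sum_distrib_left)
      show ?thesis by (subst swap, subst dA, subst sum_monomial_op_apply, rule combine)
    qed
    also have "\<dots> = ?B F x"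
      unfolding summand by (simp only: sum_fun_apply plus_fun_apply monomial_op_def)
    finally show ?thesis .
  qed
qed

lemma
  fixes lam :: "'n::finite \<Rightarrow> real"
  assumes h: "h \<in> sl2" and A: "A \<in> diff_ops"
  shows op_action_mem: "op_action lam \<mu> h A \<in> diff_ops"
    and symbol_op_action: "symbol (op_action lam \<mu> h A) \<beta> x =
      h x * deriv (symbol A \<beta>) x + (\<mu> - (\<Sum>i\<in>UNIV. lam i) - real (\<Sum>i\<in>UNIV. \<beta> i)) * deriv h x * symbol A \<beta> x
      + c2 h * (\<Sum>i\<in>UNIV. (- 2 * lam i - real (\<beta> i)) * symbol A (incr i \<beta>) x)"
proof -
  obtain S where S: "finite S" "\<forall>\<alpha> x. \<alpha> \<notin> S \<longrightarrow> symbol A \<alpha> x = 0" "\<forall>\<alpha>. smooth (symbol A \<alpha>)"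
    and A_eq: "A = (\<Sum>\<alpha>\<in>S. monomial_op (symbol A \<alpha>) \<alpha>)"
    using diff_ops_symbol[OF A] by blast
  let ?a = "symbol A" and ?h' = "deriv h"
  let ?u = "\<lambda>\<alpha> x. h x * deriv (?a \<alpha>) x + (\<mu> - (\<Sum>i\<in>UNIV. lam i) - real (\<Sum>i\<in>UNIV. \<alpha> i)) * ?h' x * ?a \<alpha> x"
  let ?d = "\<lambda>\<alpha> i x. if \<alpha> i = 0 then 0 else - (real (\<alpha> i) - 1 + 2 * lam i) * c2 h * ?a \<alpha> x"
  have eq: "op_action lam \<mu> h A = (\<Sum>\<alpha>\<in>S. monomial_op (?u \<alpha>) \<alpha> + (\<Sum>i\<in>UNIV. monomial_op (?d \<alpha> i) (decr i \<alpha>)))"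
    by (subst (1) A_eq, rule op_action_eq[OF h S(1)]) (rule S(3)[rule_format])
  have u: "smooth (?u \<alpha>)" for \<alpha>
    by (intro smooth_add smooth_mult smooth_const smooth_deriv smooth_sl2[OF h] S(3)[rule_format])
  have d: "smooth (?d \<alpha> i)" for \<alpha> i
  proof (cases "\<alpha> i = 0")
    case False
    have "smooth (\<lambda>x. - (real (\<alpha> i) - 1 + 2 * lam i) * c2 h * ?a \<alpha> x)"
      by (intro smooth_mult[OF smooth_const] S(3)[rule_format])
    then show ?thesis using False by simp
  qed (simp add: smooth_const)
  show "op_action lam \<mu> h A \<in> diff_ops"
    unfolding eq
    by (intro subspace_sum[OF subspace_diff_ops] subspace_add[OF subspace_diff_ops] monomial_op_mem u d)
  have zero: "?u \<beta> x = 0" if "\<beta> \<notin> S"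
  proof -
    have "?a \<beta> = (\<lambda>x. 0)" using S(2)[rule_format, OF that] by (rule ext)
    then show ?thesis by simp
  qed
  have "symbol (op_action lam \<mu> h A) \<beta> x =
      (\<Sum>\<alpha>\<in>S. if \<beta> = \<alpha> then ?u \<alpha> x else 0) + (\<Sum>\<alpha>\<in>S. \<Sum>i\<in>UNIV. if \<beta> = decr i \<alpha> then ?d \<alpha> i x else 0)"
    unfolding eq symbol_sum symbol_add symbol_monomial_op by (rule sum.distrib)
  also have "(\<Sum>\<alpha>\<in>S. if \<beta> = \<alpha> then ?u \<alpha> x else 0) = ?u \<beta> x"
    using S(1) zero by simp
  also have "(\<Sum>\<alpha>\<in>S. \<Sum>i\<in>UNIV. if \<beta> = decr i \<alpha> then ?d \<alpha> i x else 0) =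
      (\<Sum>i\<in>UNIV. \<Sum>\<alpha>\<in>S. if \<beta> = decr i \<alpha> then ?d \<alpha> i x else 0)"
    by (rule sum.swap)
  also have "\<dots> = (\<Sum>i\<in>UNIV. c2 h * ((- 2 * lam i - real (\<beta> i)) * ?a (incr i \<beta>) x))"
  proof (rule sum.cong[OF refl])
    fix i
    have eq_i: "(if \<beta> = decr i \<alpha> then ?d \<alpha> i x else 0) =
        (if \<alpha> = incr i \<beta> then c2 h * ((- 2 * lam i - real (\<beta> i)) * ?a (incr i \<beta>) x) else 0)" for \<alpha>
    proof (cases "\<alpha> i = 0")
      case True
      then have "\<alpha> \<noteq> incr i \<beta>" by (auto simp: incr_def)
      then show ?thesis using True by simp
    next
      case False
      then have "\<beta> = decr i \<alpha> \<longleftrightarrow> \<alpha> = incr i \<beta>" using incr_decr[of \<alpha> i] decr_incr[of i \<beta>] by auto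
      then show ?thesis using False by (auto simp: incr_apply algebra_simps)
    qed
    have "(\<Sum>\<alpha>\<in>S. if \<beta> = decr i \<alpha> then ?d \<alpha> i x else 0) =
        (\<Sum>\<alpha>\<in>S. if \<alpha> = incr i \<beta> then c2 h * ((- 2 * lam i - real (\<beta> i)) * ?a (incr i \<beta>) x) else 0)"
      by (rule sum.cong[OF refl eq_i])
    then show "(\<Sum>\<alpha>\<in>S. if \<beta> = decr i \<alpha> then ?d \<alpha> i x else 0) =
        c2 h * ((- 2 * lam i - real (\<beta> i)) * ?a (incr i \<beta>) x)"
      using S(1) S(2)[rule_format, of "incr i \<beta>" x] by (simp add: sum.delta)
  qed
  finally show "symbol (op_action lam \<mu> h A) \<beta> x =
      h x * deriv (symbol A \<beta>) x + (\<mu> - (\<Sum>i\<in>UNIV. lam i) - real (\<Sum>i\<in>UNIV. \<beta> i)) * deriv h x * symbol A \<beta> x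
      + c2 h * (\<Sum>i\<in>UNIV. (- 2 * lam i - real (\<beta> i)) * symbol A (incr i \<beta>) x)"
    unfolding sum_distrib_left .
qed

section \<open>Differential operators form a coinduced module\<close>

definition eval0 :: "('n::finite) operator \<Rightarrow> ('n \<Rightarrow> nat) \<Rightarrow> real" where
  "eval0 A = (\<lambda>\<alpha>. symbol A \<alpha> 0)"

lemma linear_eval0: "linear (eval0 :: ('n::finite) operator \<Rightarrow> _)"
proof (rule linearI)
  show "eval0 (A + B) = eval0 A + eval0 B" for A B :: "'n operator"
    by (rule ext) (simp only: eval0_def symbol_add plus_fun_apply)
  show "eval0 (r *\<^sub>R A) = r *\<^sub>R eval0 A" for r and A :: "'n operator"
    by (rule ext, unfold eval0_def symbol_scale) (simp add: scaleR_fun_def)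
qed

lemma e_apply: "e0 x = 1" "e1 x = x" "e2 x = x\<^sup>2"
  by (simp_all add: e_defs)

lemma diff_ops_eq_0:
  assumes "A \<in> diff_ops" "\<And>\<alpha> x. symbol A \<alpha> x = 0"
  shows "A = 0"
  by (rule diff_ops_eqI[OF assms(1) subspace_0[OF subspace_diff_ops]]) (simp add: assms(2) symbol_0)

context
  fixes lam :: "'n::finite \<Rightarrow> real" and \<mu> :: real and k :: nat and t :: "'n \<Rightarrow> nat"
  assumes k: "real k = \<mu> - (\<Sum>i\<in>UNIV. lam i)" and t: "\<forall>i. real (t i) = - 2 * lam i"
begin

abbreviation "shift_weight \<alpha> \<equiv> real k - real_of_int (deg \<alpha>)"

lemma symbol_action:
  assumes h: "h \<in> sl2" and A: "A \<in> diff_ops"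
  shows "symbol (op_action lam \<mu> h A) \<alpha> x =
    h x * deriv (symbol A \<alpha>) x + shift_weight \<alpha> * (c1 h + 2 * c2 h * x) * symbol A \<alpha> x
    + c2 h * lower t (\<lambda>\<beta>. symbol A \<beta> x) \<alpha>"
proof -
  have deg: "real (\<Sum>i\<in>UNIV. \<alpha> i) = real_of_int (deg \<alpha>)" by (rule of_int_of_nat_eq[symmetric])
  have low: "(\<Sum>i\<in>UNIV. (- 2 * lam i - real (\<alpha> i)) * symbol A (incr i \<alpha>) x) =
      lower t (\<lambda>\<beta>. symbol A \<beta> x) \<alpha>"
    unfolding lower_def by (rule sum.cong[OF refl]) (simp only: t[rule_format])
  show ?thesis
    unfolding symbol_op_action[OF h A] deriv_sl2[OF h] k[symmetric] deg low ..
qed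

abbreviation "X i \<equiv> op_action lam \<mu> (i :: real \<Rightarrow> real)"

lemma symbol_X0:
  assumes "A \<in> diff_ops"
  shows "symbol (X e0 A) \<alpha> = deriv (symbol A \<alpha>)"
  by (rule ext, unfold symbol_action[OF e_sl2(1) assms]) (simp add: e_apply)

lemma symbol_X1:
  assumes "A \<in> diff_ops"
  shows "symbol (X e1 A) \<alpha> = (\<lambda>x. x * deriv (symbol A \<alpha>) x + shift_weight \<alpha> * symbol A \<alpha> x)"
  by (rule ext, unfold symbol_action[OF e_sl2(2) assms]) (simp add: e_apply del: of_nat_sum)

lemma symbol_X2:
  assumes "A \<in> diff_ops"
  shows "symbol (X e2 A) \<alpha> = (\<lambda>x. x\<^sup>2 * deriv (symbol A \<alpha>) x + 2 * shift_weight \<alpha> * x * symbol A \<alpha> x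
    + lower t (\<lambda>\<beta>. symbol A \<beta> x) \<alpha>)"
  by (rule ext, unfold symbol_action[OF e_sl2(3) assms]) (simp add: e_apply del: of_nat_sum)

lemma X_closed:
  assumes "A \<in> diff_ops"
  shows "X e0 A \<in> diff_ops" "X e1 A \<in> diff_ops" "X e2 A \<in> diff_ops"
  by (rule op_action_mem[OF e_sl2(1) assms] op_action_mem[OF e_sl2(2) assms] op_action_mem[OF e_sl2(3) assms])+

lemma action_expand:
  assumes h: "h \<in> sl2" and A: "A \<in> diff_ops"
  shows "X h A = c0 h *\<^sub>R X e0 A + c1 h *\<^sub>R X e1 A + c2 h *\<^sub>R X e2 A"
proof (rule diff_ops_eqI[OF op_action_mem[OF h A]])
  show "c0 h *\<^sub>R X e0 A + c1 h *\<^sub>R X e1 A + c2 h *\<^sub>R X e2 A \<in> diff_ops"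
    by (intro subspace_add[OF subspace_diff_ops] subspace_scale[OF subspace_diff_ops] X_closed A)
  show "symbol (X h A) \<alpha> x = symbol (c0 h *\<^sub>R X e0 A + c1 h *\<^sub>R X e1 A + c2 h *\<^sub>R X e2 A) \<alpha> x" for \<alpha> x
    unfolding symbol_add symbol_scale symbol_X0[OF A] symbol_X1[OF A] symbol_X2[OF A] symbol_action[OF h A]
    unfolding c_eval[OF h, of x]
    by (simp add: algebra_simps power2_eq_square del: of_nat_sum)
qed

lemma symbol_deriv_linear:
  assumes "A \<in> diff_ops" "B \<in> diff_ops"
  shows "deriv (symbol (A + B) \<alpha>) x = deriv (symbol A \<alpha>) x + deriv (symbol B \<alpha>) x"
    and "deriv (symbol (r *\<^sub>R A) \<alpha>) x = r * deriv (symbol A \<alpha>) x"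
proof -
  note D = smooth_DERIV[OF diff_ops_smooth_symbol]
  have "symbol (A + B) \<alpha> = (\<lambda>x. symbol A \<alpha> x + symbol B \<alpha> x)" by (rule ext) (rule symbol_add)
  then show "deriv (symbol (A + B) \<alpha>) x = deriv (symbol A \<alpha>) x + deriv (symbol B \<alpha>) x"
    using DERIV_imp_deriv[OF DERIV_add[OF D[OF assms(1)] D[OF assms(2)]]] by simp
  have "symbol (r *\<^sub>R A) \<alpha> = (\<lambda>x. r * symbol A \<alpha> x)" by (rule ext) (rule symbol_scale)
  then show "deriv (symbol (r *\<^sub>R A) \<alpha>) x = r * deriv (symbol A \<alpha>) x"
    using DERIV_imp_deriv[OF DERIV_cmult[OF D[OF assms(1)]]] by simp
qed

lemma action_linear:
  assumes h: "h \<in> sl2" and A: "A \<in> diff_ops"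
  shows action_add: "B \<in> diff_ops \<Longrightarrow> X h (A + B) = X h A + X h B"
    and action_scale: "X h (r *\<^sub>R A) = r *\<^sub>R X h A"
proof -
  note mem = op_action_mem[OF h] subspace_add[OF subspace_diff_ops] subspace_scale[OF subspace_diff_ops]
  have lower_add: "lower t (\<lambda>\<beta>. v \<beta> + w \<beta>) \<alpha> = lower t v \<alpha> + lower t w \<alpha>" for v w \<alpha>
    by (simp add: lower_def distrib_left sum.distrib)
  have lower_scale: "lower t (\<lambda>\<beta>. r * v \<beta>) \<alpha> = r * lower t v \<alpha>" for v \<alpha>
    by (simp add: lower_def sum_distrib_left mult.left_commute)
  show "X h (A + B) = X h A + X h B" if B: "B \<in> diff_ops"
  proof (rule diff_ops_eqI)
    show "symbol (X h (A + B)) \<alpha> x = symbol (X h A + X h B) \<alpha> x" for \<alpha> x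
      unfolding symbol_add symbol_action[OF h A] symbol_action[OF h B]
        symbol_action[OF h subspace_add[OF subspace_diff_ops A B]] symbol_deriv_linear(1)[OF A B] lower_add
      by (simp add: algebra_simps del: of_nat_sum)
  qed (intro mem A B)+
  show "X h (r *\<^sub>R A) = r *\<^sub>R X h A"
  proof (rule diff_ops_eqI)
    show "symbol (X h (r *\<^sub>R A)) \<alpha> x = symbol (r *\<^sub>R X h A) \<alpha> x" for \<alpha> x
      unfolding symbol_scale symbol_action[OF h A]
        symbol_action[OF h subspace_scale[OF subspace_diff_ops A]] symbol_deriv_linear(2)[OF A A] lower_scale
      by (simp add: algebra_simps del: of_nat_sum)
  qed (intro mem A)+
qed

lemma lower_DERIV:
  assumes "A \<in> diff_ops"
  shows "((\<lambda>x. lower t (\<lambda>\<beta>. symbol A \<beta> x) \<alpha>) has_field_derivative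
    lower t (\<lambda>\<beta>. deriv (symbol A \<beta>) x) \<alpha>) (at x)"
  unfolding lower_def
  by (rule DERIV_sum) (rule DERIV_cmult[OF smooth_DERIV[OF diff_ops_smooth_symbol[OF assms]]])

lemma deriv_X1:
  assumes "A \<in> diff_ops"
  shows "deriv (symbol (X e1 A) \<alpha>) x =
    deriv (symbol A \<alpha>) x + x * deriv (deriv (symbol A \<alpha>)) x + shift_weight \<alpha> * deriv (symbol A \<alpha>) x"
proof -
  note s = diff_ops_smooth_symbol[OF assms, of \<alpha>]
  show ?thesis
    unfolding symbol_X1[OF assms]
    by (rule DERIV_imp_deriv)
      (auto intro!: derivative_eq_intros smooth_DERIV[OF s] smooth_DERIV[OF smooth_deriv[OF s]])
qed

lemma deriv_X2:
  assumes "A \<in> diff_ops"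
  shows "deriv (symbol (X e2 A) \<alpha>) x =
    2 * x * deriv (symbol A \<alpha>) x + x\<^sup>2 * deriv (deriv (symbol A \<alpha>)) x
    + 2 * shift_weight \<alpha> * (symbol A \<alpha> x + x * deriv (symbol A \<alpha>) x)
    + lower t (\<lambda>\<beta>. deriv (symbol A \<beta>) x) \<alpha>"
proof -
  note s = diff_ops_smooth_symbol[OF assms, of \<alpha>]
  show ?thesis
    unfolding symbol_X2[OF assms]
    by (rule DERIV_imp_deriv)
      (auto intro!: derivative_eq_intros smooth_DERIV[OF s] smooth_DERIV[OF smooth_deriv[OF s]]
        lower_DERIV[OF assms] simp: algebra_simps simp del: of_nat_sum)
qed

lemma lower_shift:
  "lower t (\<lambda>\<beta>. x * w \<beta> + shift_weight \<beta> * v \<beta>) \<alpha> =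
    x * lower t w \<alpha> + (shift_weight \<alpha> - 1) * lower t v \<alpha>"
proof -
  have "shift_weight (incr i \<alpha>) = shift_weight \<alpha> - 1" for i unfolding deg_incr by simp
  then show ?thesis
    unfolding lower_def by (simp add: sum_distrib_left sum.distrib[symmetric] algebra_simps del: of_nat_sum)
qed

text \<open>The commutation relations are checked on symbols. In the last one the first derivatives of the
  lowered symbols cancel, and since lowering shifts the weight by one, one copy of the lowering
  term is left over.\<close>

lemma X_brackets:
  assumes A: "A \<in> diff_ops"
  shows "X e0 (X e1 A) = X e1 (X e0 A) + X e0 A"
    and "X e0 (X e2 A) = X e2 (X e0 A) + 2 *\<^sub>R X e1 A"
    and "X e1 (X e2 A) = X e2 (X e1 A) + X e2 A"
proof -
  note mem = X_closed[OF A] X_closed subspace_add[OF subspace_diff_ops] subspace_scale[OF subspace_diff_ops]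
  show "X e0 (X e1 A) = X e1 (X e0 A) + X e0 A"
  proof (rule diff_ops_eqI)
    show "symbol (X e0 (X e1 A)) \<alpha> x = symbol (X e1 (X e0 A) + X e0 A) \<alpha> x" for \<alpha> x
      unfolding symbol_add symbol_X0[OF X_closed(2)[OF A]] deriv_X1[OF A]
        symbol_X1[OF X_closed(1)[OF A]] symbol_X0[OF A]
      by simp
  qed (intro mem A)+
  show "X e0 (X e2 A) = X e2 (X e0 A) + 2 *\<^sub>R X e1 A"
  proof (rule diff_ops_eqI)
    show "symbol (X e0 (X e2 A)) \<alpha> x = symbol (X e2 (X e0 A) + 2 *\<^sub>R X e1 A) \<alpha> x" for \<alpha> x
      unfolding symbol_add symbol_scale symbol_X0[OF X_closed(3)[OF A]] deriv_X2[OF A]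
        symbol_X2[OF X_closed(1)[OF A]] symbol_X0[OF A] symbol_X1[OF A]
      by (simp add: algebra_simps del: of_nat_sum)
  qed (intro mem A)+
  show "X e1 (X e2 A) = X e2 (X e1 A) + X e2 A"
  proof (rule diff_ops_eqI)
    show "symbol (X e1 (X e2 A)) \<alpha> x = symbol (X e2 (X e1 A) + X e2 A) \<alpha> x" for \<alpha> x
      unfolding symbol_add symbol_X1[OF X_closed(3)[OF A]] deriv_X2[OF A]
        symbol_X2[OF X_closed(2)[OF A]] deriv_X1[OF A]
      unfolding symbol_X1[OF A] symbol_X2[OF A] lower_shift
      by (simp add: algebra_simps power2_eq_square del: of_nat_sum)
  qed (intro mem A)+
qed

text \<open>Integrate each coefficient, with the prescribed value at \<open>0\<close> as constant of integration.\<close>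

lemma diff_ops_integrate:
  assumes A: "A \<in> diff_ops" and v: "v \<in> finite_support"
  shows "\<exists>B\<in>diff_ops. X e0 B = A \<and> eval0 B = v"
proof -
  obtain S where S: "finite S" "\<forall>\<alpha> x. \<alpha> \<notin> S \<longrightarrow> symbol A \<alpha> x = 0" "\<forall>\<alpha>. smooth (symbol A \<alpha>)"
    using diff_ops_symbol[OF A] by blast
  have "\<forall>\<alpha>. \<exists>F. smooth F \<and> deriv F = symbol A \<alpha> \<and> F 0 = v \<alpha>"
    using smooth_antiderivative S(3) by blast
  then obtain b where b: "\<And>\<alpha>. smooth (b \<alpha>)" "\<And>\<alpha>. deriv (b \<alpha>) = symbol A \<alpha>" "\<And>\<alpha>. b \<alpha> 0 = v \<alpha>"
    by metis
  let ?S = "S \<union> {\<alpha>. v \<alpha> \<noteq> 0}"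
  have fin: "finite ?S" using S(1) v by (simp add: finite_support_def)
  define B where "B = (\<Sum>\<alpha>\<in>?S. monomial_op (b \<alpha>) \<alpha>)"
  have B: "B \<in> diff_ops" unfolding B_def by (rule diff_opsI[OF fin b(1)])
  have sym: "symbol B \<alpha> = (if \<alpha> \<in> ?S then b \<alpha> else (\<lambda>x. 0))" for \<alpha>
  proof
    show "symbol B \<alpha> x = (if \<alpha> \<in> ?S then b \<alpha> else (\<lambda>x. 0)) x" for x
      unfolding B_def symbol_sum symbol_monomial_op sum.delta'[OF fin] by simp
  qed
  have "X e0 B = A"
  proof (rule diff_ops_eqI[OF X_closed(1)[OF B] A])
    show "symbol (X e0 B) \<alpha> x = symbol A \<alpha> x" for \<alpha> x
      unfolding symbol_X0[OF B] sym using S(2) by (simp add: b(2))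
  qed
  moreover have "eval0 B = v"
    unfolding eval0_def sym by (rule ext) (simp add: b(3))
  ultimately show ?thesis using B by blast
qed

lemma diff_ops_unique:
  assumes A: "A \<in> diff_ops" and X: "X e0 A = 0" and ev: "eval0 A = 0"
  shows "A = 0"
proof (rule diff_ops_eq_0[OF A])
  fix \<alpha> x
  have "deriv (symbol A \<alpha>) y = 0" for y
    using fun_cong[OF symbol_X0[OF A], of \<alpha> y] unfolding X by (simp add: symbol_0)
  then have "(symbol A \<alpha> has_field_derivative 0) (at y)" for y
    using smooth_DERIV[OF diff_ops_smooth_symbol[OF A], of \<alpha> y] by simp
  then have "symbol A \<alpha> x = symbol A \<alpha> 0" using DERIV_isconst_all by blast
  also have "\<dots> = 0" using fun_cong[OF ev, of \<alpha>] by (simp add: eval0_def)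
  finally show "symbol A \<alpha> x = 0" .
qed

lemma eval0_finite:
  assumes "A \<in> diff_ops"
  shows "eval0 A \<in> finite_support"
proof -
  obtain S where S: "finite S" "\<forall>\<alpha> x. \<alpha> \<notin> S \<longrightarrow> symbol A \<alpha> x = 0"
    using diff_ops_symbol[OF assms] by blast
  have "{\<alpha>. eval0 A \<alpha> \<noteq> 0} \<subseteq> S" unfolding eval0_def using S(2) by blast
  then have "finite {\<alpha>. eval0 A \<alpha> \<noteq> 0}" using S(1) by (rule finite_subset)
  then show ?thesis by (simp add: finite_support_def)
qed

lemma eval0_X:
  assumes "A \<in> diff_ops"
  shows "eval0 (X e1 A) = euler (real k) (eval0 A)" "eval0 (X e2 A) = lower t (eval0 A)"
  unfolding eval0_def symbol_X1[OF assms] symbol_X2[OF assms] euler_def by simp_all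

lemma diff_ops_coinduced: "sl2_coinduced diff_ops (op_action lam \<mu>) (X e0) (X e1) (X e2) eval0 k t"
  by (rule sl2_coinduced.intro[OF subspace_diff_ops action_expand X_closed
        action_add[OF e_sl2(1)] action_add[OF e_sl2(2)] action_add[OF e_sl2(3)]
        action_scale[OF e_sl2(1)] action_scale[OF e_sl2(2)] action_scale[OF e_sl2(3)]
        X_brackets linear_eval0 eval0_finite eval0_X diff_ops_integrate diff_ops_unique])

end

section \<open>The dimensions of the cohomology spaces\<close>

theorem corollary6p3:
  fixes lam :: "'n::finite \<Rightarrow> real" and \<mu> :: real
    and k :: nat and t :: "'n \<Rightarrow> nat"
  assumes "real k = \<mu> - (\<Sum>i\<in>UNIV. lam i)"
    and "\<forall>i. real (t i) = - 2 * lam i"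
  shows "let T = (\<Sum>i\<in>UNIV. t i);
             b = int ((CARD('n) + k - 2) choose k);
             \<delta> = int (dnum t (int k - 1)) - int (dnum t (int k))
         in (real k \<le> (real T + 1) / 2 \<or> k > T + 1 \<longrightarrow>
               has_dim (sl2_cohomology lam \<mu> 2) 0 \<and>
               has_dim (sl2_cohomology lam \<mu> 0) b \<and>
               has_dim (sl2_cohomology lam \<mu> 1) b) \<and>
            ((real T + 1) / 2 \<le> real k \<and> k \<le> T + 1 \<longrightarrow>
               has_dim (sl2_cohomology lam \<mu> 2) \<delta> \<and>
               has_dim (sl2_cohomology lam \<mu> 0) (b + \<delta>) \<and>
               has_dim (sl2_cohomology lam \<mu> 1) (b + 2 * \<delta>))"
proof -
  interpret D: sl2_coinduced diff_ops "op_action lam \<mu>" "op_action lam \<mu> e0" "op_action lam \<mu> e1"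
    "op_action lam \<mu> e2" eval0 k t
    by (rule diff_ops_coinduced[OF assms])
  define T where "T = (\<Sum>i\<in>UNIV. t i)"
  define b where "b = int ((CARD('n) + k - 2) choose k)"
  define \<delta> where "\<delta> = int (dnum t (int k - 1)) - int (dnum t (int k))"
  obtain K I C where fin: "finite K" "finite I" "finite C" and disj: "I \<inter> (K \<union> C) = {}" "K \<inter> C = {}"
    and ind: "independent (I \<union> (K \<union> C))"
    and K: "span K = {v \<in> homog (int k). lower t v = 0}" and I: "span I = lower t ` homog (int k)"
    and IC: "span (I \<union> C) = homog (int k - 1)"
    and card_K: "card K + dim (lower t ` homog (int k)) = card {\<alpha> :: 'n \<Rightarrow> nat. deg \<alpha> = int k}"
    and card_C: "card C + dim (lower t ` homog (int k)) = card {\<alpha> :: 'n \<Rightarrow> nat. deg \<alpha> = int k - 1}"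
    by (rule lower_bases)
  have indK: "independent K" and indIC: "independent (I \<union> C)" and disjIC: "I \<inter> C = {}"
    using ind disj independent_mono by blast+
  have dims: "has_dim (sl2_cohomology lam \<mu> 0) (int (card K))"
    "has_dim (sl2_cohomology lam \<mu> 1) (int (card K + card C))"
    "has_dim (sl2_cohomology lam \<mu> 2) (int (card C))"
    unfolding sl2_cohomology_def
    by (rule D.has_dim_cohomology_0[OF fin(1) indK K]
        D.has_dim_cohomology_1[OF fin(1,3) disj ind K I IC]
        D.has_dim_cohomology_2[OF fin(3) disjIC indIC I IC])+
  have K_C: "int (card K) = b + int (card C)"
    using card_K card_C card_deg_diff[of k, where 'n = 'n] unfolding b_def by linarith
  have small: "card C = 0" if "real k \<le> (real T + 1) / 2"
  proof -
    have "real (2 * k) \<le> real (T + 1)" using that by simp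
    then have "int (2 * k) \<le> int (T + 1)" by (simp only: of_nat_le_iff)
    then have "2 * (int k - 1) < int (\<Sum>i\<in>UNIV. t i)" unfolding T_def[symmetric] by simp
    from lower_surj[OF this] have "lower t ` homog (int k) = homog (int k - 1)" by simp
    then show ?thesis using card_C dim_homog[of "int k - 1", where 'n = 'n] by simp
  qed
  have large: "int (card C) = \<delta>" if "(real T + 1) / 2 \<le> real k"
  proof -
    have "real (T + 1) \<le> real (2 * k)" using that by simp
    then have "int (T + 1) \<le> int (2 * k)" by (simp only: of_nat_le_iff)
    then have "int (\<Sum>i\<in>UNIV. t i) < 2 * int k" unfolding T_def[symmetric] by simp
    from rank_lower_large[OF this] show ?thesis
      using card_C card_deg_split[of "int k - 1" t] unfolding \<delta>_def by linarith
  qed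
  have none: "\<delta> = 0" if "k > T + 1"
  proof -
    have "in_box t m = {}" if "int T < m" for m
    proof -
      have "deg \<alpha> \<le> int T" if "\<forall>i. \<alpha> i \<le> t i" for \<alpha>
        unfolding T_def of_nat_le_iff by (rule sum_mono) (use that in blast)
      then have "\<not> ((\<forall>i. \<alpha> i \<le> t i) \<and> deg \<alpha> = m)" for \<alpha>
        using \<open>int T < m\<close> by (metis not_less)
      then show ?thesis unfolding in_box_def by blast
    qed
    then show ?thesis using that by (simp add: \<delta>_def dnum_eq)
  qed
  have first: "card C = 0" if "real k \<le> (real T + 1) / 2 \<or> k > T + 1"
    using that
  proof
    assume "k > T + 1"
    then have "real (T + 1) < real k" by (simp only: of_nat_less_iff)
    then have "(real T + 1) / 2 \<le> real k" by simp
    then show ?thesis using large none[OF \<open>k > T + 1\<close>] by simp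
  qed (rule small)
  show ?thesis
    unfolding Let_def T_def[symmetric] b_def[symmetric] \<delta>_def[symmetric]
    using dims K_C first large by (auto simp: algebra_simps)
qed

end
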